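(* Let $\mathcal{A}$ be an abelian category and $m$ a natural number. The Dold--Kan correspondence $C\colon\mathcal{A}_\Delta\rightleftarrows\mathrm{Ch}_{\geq0}(\mathcal{A})\colon N$ restricts to an equivalence of categories between the full subcategory of $\mathcal{A}_\Delta$ spanned by the outer $m$-Kan complexes and the full subcategory of $\mathrm{Ch}_{\geq0}(\mathcal{A})$ spanned by the $m$-truncated chain complexes.
   Context: $\mathcal{A}_\Delta$ is the category of simplicial objects in $\mathcal{A}$ and $\mathrm{Ch}_{\ge0}(\mathcal{A})$ the category of connective chain complexes. $C(X)=\overline{X}$ is the normalised Moore chain complex, $\overline{X}_n=\bigcap_{i=1}^n\ker(d_i\colon X_n\to X_{n-1})$ with differential $d_0$; $N$ is its right adjoint (the Dold--Kan nerve). By the Dold--Kan correspondence $C$ and $N$ are adjoint equivalences. For a simplicial subset $K\subset\Delta^n$ put $X_K=\lim\big((\Delta_{/K})^{\mathrm{op}}\to\Delta^{\mathrm{op}}\xrightarrow{X}\mathcal{A}\big)$, $\Delta_{/K}$ being the category of simplices of $K$. $\Lambda^n_i\subset\Delta^n$ is the $i$-th horn (the union of the facets containing the vertex $i$). A simplicial object $X$ is an outer $m$-Kan complex if for every $n>m$ the canonical maps $X_n\to X_{\Lambda_0^n}$ and $X_n\to X_{\Lambda_n^n}$ are isomorphisms. A connective chain complex $Y$ is $m$-truncated if $Y_n$ is a zero object for every $n>m$. *)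

theory Defs
  imports "HOL-Library.FuncSet" "HOL-Algebra.Group"
begin

section \<open>Categories, functors, natural transformations\<close>

text \<open>
  Objects and arrows live in two types. Arrows need not determine their source and target, so
  everything that depends on them (functors, zero arrows, sums) takes the objects as arguments.
\<close>

record ('o, 'a) cat =
  Obj :: "'o set"
  Hom :: "'o \<Rightarrow> 'o \<Rightarrow> 'a set"
  Id :: "'o \<Rightarrow> 'a"
  Comp :: "'a \<Rightarrow> 'a \<Rightarrow> 'a" (infixl "\<cdot>\<index>" 70)

locale category =
  fixes C :: "('o, 'a, 'z) cat_scheme" (structure)
  assumes Hom_Obj: "f \<in> Hom C a b \<Longrightarrow> a \<in> Obj C \<and> b \<in> Obj C"
    and Id_Hom: "a \<in> Obj C \<Longrightarrow> Id C a \<in> Hom C a a"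
    and Comp_Hom: "\<lbrakk>f \<in> Hom C a b; g \<in> Hom C b c\<rbrakk> \<Longrightarrow> g \<cdot> f \<in> Hom C a c"
    and Comp_Id: "f \<in> Hom C a b \<Longrightarrow> f \<cdot> Id C a = f"
    and Id_Comp: "f \<in> Hom C a b \<Longrightarrow> Id C b \<cdot> f = f"
    and Comp_assoc: "\<lbrakk>f \<in> Hom C a b; g \<in> Hom C b c; h \<in> Hom C c d\<rbrakk>
           \<Longrightarrow> (h \<cdot> g) \<cdot> f = h \<cdot> (g \<cdot> f)"

definition opposite :: "('o, 'a, 'z) cat_scheme \<Rightarrow> ('o, 'a) cat" where
  "opposite C = \<lparr>Obj = Obj C, Hom = (\<lambda>a b. Hom C b a), Id = Id C, Comp = (\<lambda>g f. f \<cdot>\<^bsub>C\<^esub> g)\<rparr>"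

definition full_subcategory :: "('o, 'a, 'z) cat_scheme \<Rightarrow> 'o set \<Rightarrow> ('o, 'a) cat" where
  "full_subcategory C S =
     \<lparr>Obj = Obj C \<inter> S, Hom = (\<lambda>a b. if a \<in> S \<and> b \<in> S then Hom C a b else {}),
      Id = Id C, Comp = Comp C\<rparr>"

definition is_iso :: "('o, 'a, 'z) cat_scheme \<Rightarrow> 'o \<Rightarrow> 'o \<Rightarrow> 'a \<Rightarrow> bool" where
  "is_iso C a b f \<longleftrightarrow> f \<in> Hom C a b \<and>
     (\<exists>g \<in> Hom C b a. g \<cdot>\<^bsub>C\<^esub> f = Id C a \<and> f \<cdot>\<^bsub>C\<^esub> g = Id C b)"

definition is_monic :: "('o, 'a, 'z) cat_scheme \<Rightarrow> 'o \<Rightarrow> 'o \<Rightarrow> 'a \<Rightarrow> bool" where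
  "is_monic C a b f \<longleftrightarrow> f \<in> Hom C a b \<and>
     (\<forall>t. \<forall>g \<in> Hom C t a. \<forall>h \<in> Hom C t a. f \<cdot>\<^bsub>C\<^esub> g = f \<cdot>\<^bsub>C\<^esub> h \<longrightarrow> g = h)"

definition is_epic :: "('o, 'a, 'z) cat_scheme \<Rightarrow> 'o \<Rightarrow> 'o \<Rightarrow> 'a \<Rightarrow> bool" where
  "is_epic C a b f \<longleftrightarrow> is_monic (opposite C) b a f"

definition zero_object :: "('o, 'a, 'z) cat_scheme \<Rightarrow> 'o \<Rightarrow> bool" where
  "zero_object C z \<longleftrightarrow> z \<in> Obj C \<and>
     (\<forall>a \<in> Obj C. (\<exists>!f. f \<in> Hom C a z) \<and> (\<exists>!f. f \<in> Hom C z a))"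

record ('o, 'a, 'p, 'b) ftor =
  Fob :: "'o \<Rightarrow> 'p"
  Far :: "'o \<Rightarrow> 'o \<Rightarrow> 'a \<Rightarrow> 'b"

locale cat_functor = src: category C + tgt: category D
  for C :: "('o, 'a, 'y) cat_scheme" and D :: "('p, 'b, 'z) cat_scheme" +
  fixes F :: "('o, 'a, 'p, 'b) ftor"
  assumes Fob_Obj: "a \<in> Obj C \<Longrightarrow> Fob F a \<in> Obj D"
    and Far_Hom: "f \<in> Hom C a b \<Longrightarrow> Far F a b f \<in> Hom D (Fob F a) (Fob F b)"
    and Far_Id: "a \<in> Obj C \<Longrightarrow> Far F a a (Id C a) = Id D (Fob F a)"
    and Far_Comp: "\<lbrakk>f \<in> Hom C a b; g \<in> Hom C b c\<rbrakk>
           \<Longrightarrow> Far F a c (g \<cdot>\<^bsub>C\<^esub> f) = Far F b c g \<cdot>\<^bsub>D\<^esub> Far F a b f"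

definition id_ftor :: "('o, 'a, 'o, 'a) ftor" where
  "id_ftor = \<lparr>Fob = (\<lambda>a. a), Far = (\<lambda>a b f. f)\<rparr>"

definition comp_ftor ::
    "('p, 'b, 'q, 'c) ftor \<Rightarrow> ('o, 'a, 'p, 'b) ftor \<Rightarrow> ('o, 'a, 'q, 'c) ftor" where
  "comp_ftor G F = \<lparr>Fob = (\<lambda>a. Fob G (Fob F a)),
                    Far = (\<lambda>a b f. Far G (Fob F a) (Fob F b) (Far F a b f))\<rparr>"

definition opposite_ftor :: "('o, 'a, 'p, 'b) ftor \<Rightarrow> ('o, 'a, 'p, 'b) ftor" where
  "opposite_ftor F = \<lparr>Fob = Fob F, Far = (\<lambda>a b f. Far F b a f)\<rparr>"

definition nat_trans :: "('o, 'a, 'y) cat_scheme \<Rightarrow> ('p, 'b, 'z) cat_scheme \<Rightarrow>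
    ('o, 'a, 'p, 'b) ftor \<Rightarrow> ('o, 'a, 'p, 'b) ftor \<Rightarrow> ('o \<Rightarrow> 'b) \<Rightarrow> bool" where
  "nat_trans C D F G \<eta> \<longleftrightarrow>
     (\<forall>a \<in> Obj C. \<eta> a \<in> Hom D (Fob F a) (Fob G a)) \<and>
     (\<forall>a b. \<forall>f \<in> Hom C a b. \<eta> b \<cdot>\<^bsub>D\<^esub> Far F a b f = Far G a b f \<cdot>\<^bsub>D\<^esub> \<eta> a)"

text \<open>
  Functors and natural transformations are normalised outside their domains, so that equality
  in the functor category is equality on the domain.
\<close>

definition functor_category :: "('o, 'a, 'y) cat_scheme \<Rightarrow> ('p, 'b, 'z) cat_scheme \<Rightarrow>
    (('o, 'a, 'p, 'b) ftor, 'o \<Rightarrow> 'b) cat" where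
  "functor_category C D =
     (let Fs = {F. cat_functor C D F \<and> Fob F \<in> extensional (Obj C) \<and>
                   (\<forall>a b. Far F a b \<in> extensional (Hom C a b))}
      in \<lparr>Obj = Fs,
          Hom = (\<lambda>F G. {\<eta>. F \<in> Fs \<and> G \<in> Fs \<and> nat_trans C D F G \<eta> \<and> \<eta> \<in> extensional (Obj C)}),
          Id = (\<lambda>F. \<lambda>a \<in> Obj C. Id D (Fob F a)),
          Comp = (\<lambda>\<tau> \<eta>. \<lambda>a \<in> Obj C. \<tau> a \<cdot>\<^bsub>D\<^esub> \<eta> a)\<rparr>)"

definition adjunction :: "('o, 'a, 'y) cat_scheme \<Rightarrow> ('p, 'b, 'z) cat_scheme \<Rightarrow>
    ('o, 'a, 'p, 'b) ftor \<Rightarrow> ('p, 'b, 'o, 'a) ftor \<Rightarrow> ('o \<Rightarrow> 'a) \<Rightarrow> ('p \<Rightarrow> 'b) \<Rightarrow> bool" where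
  "adjunction C D F G \<eta> \<epsilon> \<longleftrightarrow>
     cat_functor C D F \<and> cat_functor D C G \<and>
     nat_trans C C id_ftor (comp_ftor G F) \<eta> \<and>
     nat_trans D D (comp_ftor F G) id_ftor \<epsilon> \<and>
     (\<forall>a \<in> Obj C. \<epsilon> (Fob F a) \<cdot>\<^bsub>D\<^esub> Far F a (Fob G (Fob F a)) (\<eta> a) = Id D (Fob F a)) \<and>
     (\<forall>b \<in> Obj D. Far G (Fob F (Fob G b)) b (\<epsilon> b) \<cdot>\<^bsub>C\<^esub> \<eta> (Fob G b) = Id C (Fob G b))"

definition adjoint_equivalence :: "('o, 'a, 'y) cat_scheme \<Rightarrow> ('p, 'b, 'z) cat_scheme \<Rightarrow>
    ('o, 'a, 'p, 'b) ftor \<Rightarrow> ('p, 'b, 'o, 'a) ftor \<Rightarrow> ('o \<Rightarrow> 'a) \<Rightarrow> ('p \<Rightarrow> 'b) \<Rightarrow> bool" where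
  "adjoint_equivalence C D F G \<eta> \<epsilon> \<longleftrightarrow>
     adjunction C D F G \<eta> \<epsilon> \<and>
     (\<forall>a \<in> Obj C. is_iso C a (Fob G (Fob F a)) (\<eta> a)) \<and>
     (\<forall>b \<in> Obj D. is_iso D (Fob F (Fob G b)) b (\<epsilon> b))"


section \<open>Limits\<close>

definition is_cone :: "('j, 'k, 'y) cat_scheme \<Rightarrow> ('o, 'a, 'z) cat_scheme \<Rightarrow>
    ('j, 'k, 'o, 'a) ftor \<Rightarrow> 'o \<Rightarrow> ('j \<Rightarrow> 'a) \<Rightarrow> bool" where
  "is_cone J C D L \<pi> \<longleftrightarrow> L \<in> Obj C \<and> (\<forall>j \<in> Obj J. \<pi> j \<in> Hom C L (Fob D j)) \<and>
     (\<forall>i j. \<forall>f \<in> Hom J i j. Far D i j f \<cdot>\<^bsub>C\<^esub> \<pi> i = \<pi> j)"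

definition is_limit :: "('j, 'k, 'y) cat_scheme \<Rightarrow> ('o, 'a, 'z) cat_scheme \<Rightarrow>
    ('j, 'k, 'o, 'a) ftor \<Rightarrow> 'o \<Rightarrow> ('j \<Rightarrow> 'a) \<Rightarrow> bool" where
  "is_limit J C D L \<pi> \<longleftrightarrow> is_cone J C D L \<pi> \<and>
     (\<forall>M \<rho>. is_cone J C D M \<rho> \<longrightarrow>
        (\<exists>!u. u \<in> Hom C M L \<and> (\<forall>j \<in> Obj J. \<pi> j \<cdot>\<^bsub>C\<^esub> u = \<rho> j)))"

definition limit_cone :: "('j, 'k, 'y) cat_scheme \<Rightarrow> ('o, 'a, 'z) cat_scheme \<Rightarrow>
    ('j, 'k, 'o, 'a) ftor \<Rightarrow> 'o \<times> ('j \<Rightarrow> 'a)" where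
  "limit_cone J C D = (SOME (L, \<pi>). is_limit J C D L \<pi>)"


section \<open>Abelian categories\<close>

record ('o, 'a) addcat = "('o, 'a) cat" +
  Zero :: "'o \<Rightarrow> 'o \<Rightarrow> 'a"
  Add :: "'o \<Rightarrow> 'o \<Rightarrow> 'a \<Rightarrow> 'a \<Rightarrow> 'a"

locale preadditive_category = category A
  for A :: "('o, 'a, 'z) addcat_scheme" (structure) +
  assumes Hom_group: "\<lbrakk>a \<in> Obj A; b \<in> Obj A\<rbrakk> \<Longrightarrow>
        comm_group \<lparr>carrier = Hom A a b, mult = Add A a b, one = Zero A a b\<rparr>"
    and Comp_Add: "\<lbrakk>f \<in> Hom A a b; f' \<in> Hom A a b; g \<in> Hom A b c\<rbrakk>
        \<Longrightarrow> g \<cdot> Add A a b f f' = Add A a c (g \<cdot> f) (g \<cdot> f')"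
    and Add_Comp: "\<lbrakk>f \<in> Hom A a b; g \<in> Hom A b c; g' \<in> Hom A b c\<rbrakk>
        \<Longrightarrow> Add A b c g g' \<cdot> f = Add A a c (g \<cdot> f) (g' \<cdot> f)"

definition is_biproduct :: "('o, 'a, 'z) addcat_scheme \<Rightarrow>
    'o \<Rightarrow> 'o \<Rightarrow> 'o \<Rightarrow> 'a \<Rightarrow> 'a \<Rightarrow> 'a \<Rightarrow> 'a \<Rightarrow> bool" where
  "is_biproduct A a b s p q i j \<longleftrightarrow>
     p \<in> Hom A s a \<and> q \<in> Hom A s b \<and> i \<in> Hom A a s \<and> j \<in> Hom A b s \<and>
     p \<cdot>\<^bsub>A\<^esub> i = Id A a \<and> q \<cdot>\<^bsub>A\<^esub> j = Id A b \<and>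
     p \<cdot>\<^bsub>A\<^esub> j = Zero A b a \<and> q \<cdot>\<^bsub>A\<^esub> i = Zero A a b \<and>
     Add A s s (i \<cdot>\<^bsub>A\<^esub> p) (j \<cdot>\<^bsub>A\<^esub> q) = Id A s"

definition is_kernel :: "('o, 'a, 'z) addcat_scheme \<Rightarrow>
    'o \<Rightarrow> 'o \<Rightarrow> 'a \<Rightarrow> 'o \<Rightarrow> 'a \<Rightarrow> bool" where
  "is_kernel A a b f K k \<longleftrightarrow>
     f \<in> Hom A a b \<and> k \<in> Hom A K a \<and> f \<cdot>\<^bsub>A\<^esub> k = Zero A K b \<and>
     (\<forall>t. \<forall>g \<in> Hom A t a. f \<cdot>\<^bsub>A\<^esub> g = Zero A t b \<longrightarrow>
        (\<exists>!u. u \<in> Hom A t K \<and> k \<cdot>\<^bsub>A\<^esub> u = g))"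

definition is_cokernel :: "('o, 'a, 'z) addcat_scheme \<Rightarrow>
    'o \<Rightarrow> 'o \<Rightarrow> 'a \<Rightarrow> 'o \<Rightarrow> 'a \<Rightarrow> bool" where
  "is_cokernel A a b f Q q \<longleftrightarrow>
     f \<in> Hom A a b \<and> q \<in> Hom A b Q \<and> q \<cdot>\<^bsub>A\<^esub> f = Zero A a Q \<and>
     (\<forall>t. \<forall>g \<in> Hom A b t. g \<cdot>\<^bsub>A\<^esub> f = Zero A a t \<longrightarrow>
        (\<exists>!u. u \<in> Hom A Q t \<and> u \<cdot>\<^bsub>A\<^esub> q = g))"

locale abelian_category = preadditive_category A
  for A :: "('o, 'a, 'z) addcat_scheme" (structure) +
  assumes ex_zero_object: "\<exists>z. zero_object A z"
    and ex_biproduct: "\<lbrakk>a \<in> Obj A; b \<in> Obj A\<rbrakk> \<Longrightarrow> \<exists>s p q i j. is_biproduct A a b s p q i j"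
    and ex_kernel: "f \<in> Hom A a b \<Longrightarrow> \<exists>K k. is_kernel A a b f K k"
    and ex_cokernel: "f \<in> Hom A a b \<Longrightarrow> \<exists>Q q. is_cokernel A a b f Q q"
    and monic_is_kernel: "is_monic A a b f \<Longrightarrow> \<exists>c g. is_kernel A b c g a f"
    and epic_is_cokernel: "is_epic A a b f \<Longrightarrow> \<exists>c g. is_cokernel A c a g b f"

definition kernel :: "('o, 'a, 'z) addcat_scheme \<Rightarrow> 'o \<Rightarrow> 'o \<Rightarrow> 'a \<Rightarrow> 'o \<times> 'a" where
  "kernel A a b f = (SOME (K, k). is_kernel A a b f K k)"

text \<open>
  The intersection of a set of subobjects \<open>(U, u : U \<rightarrow> x)\<close> of \<open>x\<close>, as the wide pullback of the
  monomorphisms \<open>u\<close>. The empty intersection is \<open>x\<close> itself, up to isomorphism.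
\<close>

definition is_intersection :: "('o, 'a, 'z) cat_scheme \<Rightarrow> 'o \<Rightarrow> ('o \<times> 'a) set \<Rightarrow>
    'o \<Rightarrow> 'a \<Rightarrow> bool" where
  "is_intersection C x S K k \<longleftrightarrow>
     k \<in> Hom C K x \<and> (\<forall>(U, u) \<in> S. \<exists>s \<in> Hom C K U. u \<cdot>\<^bsub>C\<^esub> s = k) \<and>
     (\<forall>t. \<forall>g \<in> Hom C t x. (\<forall>(U, u) \<in> S. \<exists>s \<in> Hom C t U. u \<cdot>\<^bsub>C\<^esub> s = g) \<longrightarrow>
        (\<exists>!v. v \<in> Hom C t K \<and> k \<cdot>\<^bsub>C\<^esub> v = g))"

definition intersection :: "('o, 'a, 'z) cat_scheme \<Rightarrow> 'o \<Rightarrow> ('o \<times> 'a) set \<Rightarrow> 'o \<times> 'a" where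
  "intersection C x S = (SOME (K, k). is_intersection C x S K k)"


section \<open>Simplicial objects\<close>

text \<open>
  The object \<open>[n] = {0, \<dots>, n}\<close> of the simplex category is represented by \<open>n\<close>. A monotone map
  \<open>[m] \<rightarrow> [n]\<close> is represented by its extension to all natural numbers that is constant from \<open>m\<close>
  onwards; composition is then composition of functions.
\<close>

definition Delta :: "(nat, nat \<Rightarrow> nat) cat" where
  "Delta = \<lparr>Obj = UNIV,
            Hom = (\<lambda>m n. {f. mono f \<and> f m \<le> n \<and> (\<forall>i \<ge> m. f i = f m)}),
            Id = (\<lambda>n i. min i n),
            Comp = (\<lambda>g f. g \<circ> f)\<rparr>"

text \<open>The injection \<open>[n - 1] \<rightarrow> [n]\<close> that omits \<open>j\<close>, for \<open>n > 0\<close>.\<close>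

definition coface :: "nat \<Rightarrow> nat \<Rightarrow> nat \<Rightarrow> nat" where
  "coface n j = (\<lambda>i. let i' = min i (n - 1) in if i' < j then i' else i' + 1)"

type_synonym ('o, 'a) simplicial_object = "(nat, nat \<Rightarrow> nat, 'o, 'a) ftor"

definition simplicial_category ::
    "('o, 'a, 'z) cat_scheme \<Rightarrow> (('o, 'a) simplicial_object, nat \<Rightarrow> 'a) cat" where
  "simplicial_category A = functor_category (opposite Delta) A"

definition face :: "('o, 'a) simplicial_object \<Rightarrow> nat \<Rightarrow> nat \<Rightarrow> 'a" where
  "face X n i = Far X n (n - 1) (coface n i)"


section \<open>Outer Kan complexes\<close>

text \<open>
  A simplicial subset \<open>K\<close> of the standard simplex \<open>\<Delta>\<^sup>n\<close> is given by its sets \<open>K k\<close> of \<open>k\<close>-simplices,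
  which are arrows \<open>[k] \<rightarrow> [n]\<close>.
\<close>

definition simplices :: "(nat \<Rightarrow> (nat \<Rightarrow> nat) set) \<Rightarrow> (nat \<times> (nat \<Rightarrow> nat), nat \<Rightarrow> nat) cat" where
  "simplices K =
     \<lparr>Obj = {(k, \<sigma>). \<sigma> \<in> K k},
      Hom = (\<lambda>(k, \<sigma>) (l, \<tau>). {\<theta> \<in> Hom Delta k l. \<sigma> \<in> K k \<and> \<tau> \<in> K l \<and> \<tau> \<cdot>\<^bsub>Delta\<^esub> \<theta> = \<sigma>}),
      Id = (\<lambda>(k, \<sigma>). Id Delta k),
      Comp = Comp Delta\<rparr>"

definition simplices_proj :: "(nat \<times> (nat \<Rightarrow> nat), nat \<Rightarrow> nat, nat, nat \<Rightarrow> nat) ftor" where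
  "simplices_proj = \<lparr>Fob = fst, Far = (\<lambda>_ _ \<theta>. \<theta>)\<rparr>"

definition subset_limit :: "('o, 'a, 'z) cat_scheme \<Rightarrow> ('o, 'a) simplicial_object \<Rightarrow>
    (nat \<Rightarrow> (nat \<Rightarrow> nat) set) \<Rightarrow> 'o \<times> (nat \<times> (nat \<Rightarrow> nat) \<Rightarrow> 'a)" where
  "subset_limit A X K =
     limit_cone (opposite (simplices K)) A (comp_ftor X (opposite_ftor simplices_proj))"

text \<open>The canonical map \<open>X\<^sub>n \<rightarrow> X\<^sub>K\<close> for \<open>K \<subseteq> \<Delta>\<^sup>n\<close>; its component at a simplex \<open>\<sigma>\<close> of \<open>K\<close> is \<open>\<sigma>\<^sup>*\<close>.\<close>

definition canonical_map :: "('o, 'a, 'z) cat_scheme \<Rightarrow> ('o, 'a) simplicial_object \<Rightarrow> nat \<Rightarrow>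
    (nat \<Rightarrow> (nat \<Rightarrow> nat) set) \<Rightarrow> 'a" where
  "canonical_map A X n K =
     (let (L, \<pi>) = subset_limit A X K
      in THE u. u \<in> Hom A (Fob X n) L \<and>
                (\<forall>(k, \<sigma>) \<in> Obj (simplices K). \<pi> (k, \<sigma>) \<cdot>\<^bsub>A\<^esub> u = Far X n k \<sigma>))"

definition facet :: "nat \<Rightarrow> nat \<Rightarrow> nat \<Rightarrow> (nat \<Rightarrow> nat) set" where
  "facet n j k = {coface n j \<cdot>\<^bsub>Delta\<^esub> \<tau> | \<tau>. \<tau> \<in> Hom Delta k (n - 1)}"

definition vertex :: "nat \<Rightarrow> nat \<Rightarrow> nat" where
  "vertex i = (\<lambda>_. i)"

definition horn :: "nat \<Rightarrow> nat \<Rightarrow> nat \<Rightarrow> (nat \<Rightarrow> nat) set" where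
  "horn n i k = (\<Union>j \<in> {j. j \<le> n \<and> vertex i \<in> facet n j 0}. facet n j k)"

definition outer_Kan ::
    "('o, 'a, 'z) cat_scheme \<Rightarrow> nat \<Rightarrow> ('o, 'a) simplicial_object set" where
  "outer_Kan A m = {X \<in> Obj (simplicial_category A). \<forall>n > m. \<forall>i \<in> {0, n}.
     is_iso A (Fob X n) (fst (subset_limit A X (horn n i))) (canonical_map A X n (horn n i))}"


section \<open>Connective chain complexes\<close>

text \<open>\<open>Diff Y n\<close> is the differential from degree \<open>n + 1\<close> to degree \<open>n\<close>.\<close>

record ('o, 'a) chain_complex =
  Deg :: "nat \<Rightarrow> 'o"
  Diff :: "nat \<Rightarrow> 'a"

definition is_chain_complex ::
    "('o, 'a, 'z) addcat_scheme \<Rightarrow> ('o, 'a) chain_complex \<Rightarrow> bool" where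
  "is_chain_complex A Y \<longleftrightarrow>
     (\<forall>n. Deg Y n \<in> Obj A) \<and>
     (\<forall>n. Diff Y n \<in> Hom A (Deg Y (Suc n)) (Deg Y n)) \<and>
     (\<forall>n. Diff Y n \<cdot>\<^bsub>A\<^esub> Diff Y (Suc n) = Zero A (Deg Y (Suc (Suc n))) (Deg Y n))"

definition chain_category ::
    "('o, 'a, 'z) addcat_scheme \<Rightarrow> (('o, 'a) chain_complex, nat \<Rightarrow> 'a) cat" where
  "chain_category A =
     \<lparr>Obj = {Y. is_chain_complex A Y},
      Hom = (\<lambda>Y Z. {f. is_chain_complex A Y \<and> is_chain_complex A Z \<and>
               (\<forall>n. f n \<in> Hom A (Deg Y n) (Deg Z n)) \<and>
               (\<forall>n. f n \<cdot>\<^bsub>A\<^esub> Diff Y n = Diff Z n \<cdot>\<^bsub>A\<^esub> f (Suc n))}),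
      Id = (\<lambda>Y n. Id A (Deg Y n)),
      Comp = (\<lambda>g f n. g n \<cdot>\<^bsub>A\<^esub> f n)\<rparr>"

definition truncated ::
    "('o, 'a, 'z) addcat_scheme \<Rightarrow> nat \<Rightarrow> ('o, 'a) chain_complex set" where
  "truncated A m = {Y \<in> Obj (chain_category A). \<forall>n > m. zero_object A (Deg Y n)}"


section \<open>The normalised Moore complex\<close>

definition moore_sub ::
    "('o, 'a, 'z) addcat_scheme \<Rightarrow> ('o, 'a) simplicial_object \<Rightarrow> nat \<Rightarrow> 'o \<times> 'a" where
  "moore_sub A X n = intersection A (Fob X n)
     ((\<lambda>i. kernel A (Fob X n) (Fob X (n - 1)) (face X n i)) ` {1..n})"

abbreviation moore_ob ::
    "('o, 'a, 'z) addcat_scheme \<Rightarrow> ('o, 'a) simplicial_object \<Rightarrow> nat \<Rightarrow> 'o" where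
  "moore_ob A X n \<equiv> fst (moore_sub A X n)"

abbreviation moore_incl ::
    "('o, 'a, 'z) addcat_scheme \<Rightarrow> ('o, 'a) simplicial_object \<Rightarrow> nat \<Rightarrow> 'a" where
  "moore_incl A X n \<equiv> snd (moore_sub A X n)"

definition moore_diff ::
    "('o, 'a, 'z) addcat_scheme \<Rightarrow> ('o, 'a) simplicial_object \<Rightarrow> nat \<Rightarrow> 'a" where
  "moore_diff A X n = (THE u. u \<in> Hom A (moore_ob A X (Suc n)) (moore_ob A X n) \<and>
     moore_incl A X n \<cdot>\<^bsub>A\<^esub> u = face X (Suc n) 0 \<cdot>\<^bsub>A\<^esub> moore_incl A X (Suc n))"

definition moore_map :: "('o, 'a, 'z) addcat_scheme \<Rightarrow> ('o, 'a) simplicial_object \<Rightarrow>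
    ('o, 'a) simplicial_object \<Rightarrow> (nat \<Rightarrow> 'a) \<Rightarrow> nat \<Rightarrow> 'a" where
  "moore_map A X X' f n = (THE u. u \<in> Hom A (moore_ob A X n) (moore_ob A X' n) \<and>
     moore_incl A X' n \<cdot>\<^bsub>A\<^esub> u = f n \<cdot>\<^bsub>A\<^esub> moore_incl A X n)"

definition moore :: "('o, 'a, 'z) addcat_scheme \<Rightarrow>
    (('o, 'a) simplicial_object, nat \<Rightarrow> 'a, ('o, 'a) chain_complex, nat \<Rightarrow> 'a) ftor" where
  "moore A = \<lparr>Fob = (\<lambda>X. \<lparr>Deg = moore_ob A X, Diff = moore_diff A X\<rparr>), Far = moore_map A\<rparr>"

end

theory Submission
  imports Defs
begin

text \<open>
  The proof computes with generalised elements. An element of degree \<open>n\<close> of a simplicial object \<open>X\<close>,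
  over an object \<open>T\<close>, is an arrow \<open>T \<rightarrow> X\<^sub>n\<close>; such elements form an abelian group on which the operators
  of the simplex category act. An element is normalised if the faces \<open>d\<^sub>1, \<dots>, d\<^sub>n\<close> vanish on it, and
  degenerate if it is a sum of pullbacks along operators \<open>[n] \<rightarrow> [k]\<close> with \<open>k < n\<close>. Everything rests on
  the fact that each element is, in exactly one way, a normalised element plus a degenerate one.
  Existence comes from Moore's filler of a horn at the vertex 0, which is a sum of degenerate elements
  (\<open>horn_filler\<close>): subtracting from \<open>x\<close> the filler of its own faces leaves a normalised element.
  Uniqueness (\<open>normalized_degenerate_zero\<close>) removes the degeneracies from a sum one after the other.
  Decomposing the identity of \<open>X\<^sub>n\<close> yields an idempotent \<open>normal_proj\<close> that fixes normalised elements and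
  kills degenerate ones. Its image is the intersection of kernels that defines the Moore complex.

  Dold--Kan. An operator \<open>\<rho> : [n] \<rightarrow> [k]\<close> is surjective, or a surjection followed by the coface
  that omits 0, or it omits some \<open>j \<ge> 1\<close> (\<open>Delta_cases\<close>). On normalised elements of degree \<open>k\<close> it acts
  accordingly as a surjective operator, as the boundary followed by one, or as zero. Moreover \<open>X\<^sub>n\<close> is the
  coproduct of copies of \<open>C(X)\<^sub>k\<close> indexed by the surjections \<open>[n] \<rightarrow> [k]\<close>: arrows out of \<open>X\<^sub>n\<close> are determined
  by their restrictions to the copies (\<open>generated_by_normalized\<close>), and the restrictions are arbitrary
  (\<open>extend_from_normalized\<close>). Hence a chain map \<open>C(X) \<rightarrow> C(X')\<close> extends uniquely to \<open>X \<rightarrow> X'\<close>, so \<open>C\<close> is fully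
  faithful. Given a complex \<open>Y\<close>, the coproducts of copies of \<open>Y\<^sub>k\<close> with operators given by the same
  trichotomy form a simplicial object, functoriality being where \<open>d d = 0\<close> enters, and its Moore complex is
  \<open>Y\<close>; so \<open>C\<close> is essentially surjective. By general category theory \<open>C\<close> then has a right adjoint,
  and every adjunction with left adjoint \<open>C\<close> has invertible unit and counit.

  Outer horns. A compatible family of faces on \<open>\<Lambda>\<^sup>n\<^sub>0\<close> always has a degenerate filler, and two fillers
  differ by a normalised element. So \<open>X\<^sub>n \<rightarrow> X\<^bsub>\<Lambda>\<^esub>\<close> is a split epimorphism with kernel \<open>C(X)\<^sub>n\<close>, and it is
  invertible precisely when \<open>C(X)\<^sub>n\<close> is zero. The horn at the last vertex becomes the horn at 0 when the
  order of the vertices is reversed. Reversal changes the normalised elements but not the degenerate ones,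
  and \<open>C(X)\<^sub>n\<close> is zero exactly if all elements of degree \<open>n\<close> are degenerate; so \<open>C(X)\<^sub>n = 0\<close> makes both
  outer horn maps invertible (\<open>outer_horns_iso_iff\<close>). Thus \<open>X\<close> is an outer \<open>m\<close>-Kan complex
  if and only if \<open>C(X)\<close> is \<open>m\<close>-truncated, and the equivalence restricts.
\<close>

section \<open>Fully faithful, essentially surjective functors and their adjoints\<close>

lemma category_full_subcategory:
  assumes "category C" shows "category (full_subcategory C S)"
proof -
  interpret category C by fact
  show ?thesis
    by unfold_locales
      (auto simp: full_subcategory_def split: if_splits
        intro: Id_Hom Comp_Hom Comp_Id Id_Comp Comp_assoc dest: Hom_Obj)
qed

lemma is_iso_full_subcategory:
  assumes "a \<in> S" "b \<in> S" "is_iso C a b f"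
  shows "is_iso (full_subcategory C S) a b f"
  using assms by (auto simp: is_iso_def full_subcategory_def)

lemma cat_functor_full_subcategory:
  assumes F: "cat_functor C D F" and ST: "\<And>a. a \<in> Obj C \<Longrightarrow> a \<in> S \<Longrightarrow> Fob F a \<in> T"
  shows "cat_functor (full_subcategory C S) (full_subcategory D T) F"
proof -
  interpret cat_functor C D F by fact
  have "category (full_subcategory C S)" "category (full_subcategory D T)"
    by (simp_all add: category_full_subcategory src.category_axioms tgt.category_axioms)
  thus ?thesis
    unfolding cat_functor_def cat_functor_axioms_def
    using Fob_Obj Far_Hom Far_Id Far_Comp ST src.Hom_Obj
    by (auto simp: full_subcategory_def split: if_splits)
qed

locale equivalence_functor = cat_functor C D F
  for C :: "('o, 'a, 'y) cat_scheme" and D :: "('p, 'b, 'z) cat_scheme"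
    and F :: "('o, 'a, 'p, 'b) ftor" +
  assumes fully_faithful: "\<lbrakk>a \<in> Obj C; b \<in> Obj C; g \<in> Hom D (Fob F a) (Fob F b)\<rbrakk>
        \<Longrightarrow> \<exists>!f. f \<in> Hom C a b \<and> Far F a b f = g"
    and essentially_surjective: "d \<in> Obj D \<Longrightarrow> \<exists>a \<in> Obj C. \<exists>e. is_iso D (Fob F a) d e"
begin

definition lift :: "'o \<Rightarrow> 'o \<Rightarrow> 'b \<Rightarrow> 'a" where
  "lift a b g = (THE f. f \<in> Hom C a b \<and> Far F a b f = g)"

lemma lift:
  assumes "a \<in> Obj C" "b \<in> Obj C" "g \<in> Hom D (Fob F a) (Fob F b)"
  shows "lift a b g \<in> Hom C a b" "Far F a b (lift a b g) = g"
  using theI'[OF fully_faithful[OF assms]] unfolding lift_def by auto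

lemma faithful:
  assumes "f \<in> Hom C a b" "f' \<in> Hom C a b" "Far F a b f = Far F a b f'"
  shows "f = f'"
proof -
  have "a \<in> Obj C" "b \<in> Obj C" using assms src.Hom_Obj by blast+
  thus ?thesis using fully_faithful[of a b "Far F a b f'"] assms Far_Hom by metis
qed

text \<open>The right adjoint picks for each \<open>b\<close> an object with an isomorphism \<open>e b : F (G b) \<rightarrow> b\<close>, acts on arrows
  by conjugation with these isomorphisms, and has \<open>e\<close> as counit; the unit lifts the inverse of \<open>e (F a)\<close>.
  Each equation between arrows of \<open>C\<close> is checked after applying the faithful functor \<open>F\<close>.\<close>

lemma adjunction_exists: "\<exists>G \<eta> \<epsilon>. adjunction C D F G \<eta> \<epsilon>"
proof -
  have "\<forall>b \<in> Obj D. \<exists>x. fst x \<in> Obj C \<and> fst (snd x) \<in> Hom D (Fob F (fst x)) b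
      \<and> snd (snd x) \<in> Hom D b (Fob F (fst x))
      \<and> snd (snd x) \<cdot>\<^bsub>D\<^esub> fst (snd x) = Id D (Fob F (fst x))
      \<and> fst (snd x) \<cdot>\<^bsub>D\<^esub> snd (snd x) = Id D b"
  proof
    fix b assume "b \<in> Obj D"
    then obtain a e where "a \<in> Obj C" "is_iso D (Fob F a) b e"
      using essentially_surjective by blast
    moreover then obtain e' where "e \<in> Hom D (Fob F a) b" "e' \<in> Hom D b (Fob F a)"
        "e' \<cdot>\<^bsub>D\<^esub> e = Id D (Fob F a)" "e \<cdot>\<^bsub>D\<^esub> e' = Id D b"
      unfolding is_iso_def by blast
    ultimately show "\<exists>x. fst x \<in> Obj C \<and> fst (snd x) \<in> Hom D (Fob F (fst x)) b
      \<and> snd (snd x) \<in> Hom D b (Fob F (fst x))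
      \<and> snd (snd x) \<cdot>\<^bsub>D\<^esub> fst (snd x) = Id D (Fob F (fst x))
      \<and> fst (snd x) \<cdot>\<^bsub>D\<^esub> snd (snd x) = Id D b"
      by (intro exI[of _ "(a, e, e')"]) simp
  qed
  from bchoice[OF this] obtain w where w: "\<And>b. b \<in> Obj D \<Longrightarrow>
      fst (w b) \<in> Obj C \<and> fst (snd (w b)) \<in> Hom D (Fob F (fst (w b))) b
      \<and> snd (snd (w b)) \<in> Hom D b (Fob F (fst (w b)))
      \<and> snd (snd (w b)) \<cdot>\<^bsub>D\<^esub> fst (snd (w b)) = Id D (Fob F (fst (w b)))
      \<and> fst (snd (w b)) \<cdot>\<^bsub>D\<^esub> snd (snd (w b)) = Id D b"
    by blast
  define g0 where "g0 b = fst (w b)" for b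
  define e where "e b = fst (snd (w b))" for b
  define e' where "e' b = snd (snd (w b))" for b
  have g0: "g0 b \<in> Obj C" and e: "e b \<in> Hom D (Fob F (g0 b)) b"
    and e': "e' b \<in> Hom D b (Fob F (g0 b))"
    and e'e: "e' b \<cdot>\<^bsub>D\<^esub> e b = Id D (Fob F (g0 b))" and ee': "e b \<cdot>\<^bsub>D\<^esub> e' b = Id D b"
    if "b \<in> Obj D" for b
    using w[OF that] unfolding g0_def e_def e'_def by auto
  define G where "G = \<lparr>Fob = g0,
      Far = (\<lambda>b b' g. lift (g0 b) (g0 b') (e' b' \<cdot>\<^bsub>D\<^esub> (g \<cdot>\<^bsub>D\<^esub> e b)))\<rparr>"
  define \<eta> where "\<eta> a = lift a (g0 (Fob F a)) (e' (Fob F a))" for a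
  have G_ob: "Fob G = g0" unfolding G_def by simp
  have conj: "e' b' \<cdot>\<^bsub>D\<^esub> (g \<cdot>\<^bsub>D\<^esub> e b) \<in> Hom D (Fob F (g0 b)) (Fob F (g0 b'))"
    if "g \<in> Hom D b b'" for b b' g
  proof -
    have "b \<in> Obj D" "b' \<in> Obj D" using tgt.Hom_Obj[OF that] by auto
    thus ?thesis using tgt.Comp_Hom[OF tgt.Comp_Hom[OF e that] e'] by blast
  qed
  have G_Hom: "Far G b b' g \<in> Hom C (g0 b) (g0 b')"
    and FG: "Far F (g0 b) (g0 b') (Far G b b' g) = e' b' \<cdot>\<^bsub>D\<^esub> (g \<cdot>\<^bsub>D\<^esub> e b)"
    if g: "g \<in> Hom D b b'" for b b' g
    using lift[OF _ _ conj[OF g]] g0 tgt.Hom_Obj[OF g] unfolding G_def by auto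
  have \<eta>: "\<eta> a \<in> Hom C a (g0 (Fob F a))"
    and F\<eta>: "Far F a (g0 (Fob F a)) (\<eta> a) = e' (Fob F a)" if "a \<in> Obj C" for a
    using lift[OF that g0 e'] Fob_Obj[OF that] unfolding \<eta>_def by auto
  have e_nat: "e b' \<cdot>\<^bsub>D\<^esub> (e' b' \<cdot>\<^bsub>D\<^esub> (g \<cdot>\<^bsub>D\<^esub> e b)) = g \<cdot>\<^bsub>D\<^esub> e b" if g: "g \<in> Hom D b b'" for b b' g
  proof -
    have b: "b \<in> Obj D" "b' \<in> Obj D" using tgt.Hom_Obj[OF g] by auto
    have ge: "g \<cdot>\<^bsub>D\<^esub> e b \<in> Hom D (Fob F (g0 b)) b'" using tgt.Comp_Hom[OF e[OF b(1)] g] .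
    show ?thesis
      using tgt.Comp_assoc[OF ge e'[OF b(2)] e[OF b(2)]] ee'[OF b(2)] tgt.Id_Comp[OF ge] by simp
  qed
  have G_functor: "cat_functor D C G"
  proof
    show "Fob G b \<in> Obj C" if "b \<in> Obj D" for b using that g0 G_ob by simp
    show "Far G a b f \<in> Hom C (Fob G a) (Fob G b)" if "f \<in> Hom D a b" for f a b
      using that G_Hom G_ob by simp
    show "Far G b b (Id D b) = Id C (Fob G b)" if b: "b \<in> Obj D" for b
    proof (rule faithful)
      show "Far G b b (Id D b) \<in> Hom C (g0 b) (g0 b)" using G_Hom[OF tgt.Id_Hom[OF b]] .
      show "Id C (Fob G b) \<in> Hom C (g0 b) (g0 b)" using G_ob g0 src.Id_Hom b by simp
      show "Far F (g0 b) (g0 b) (Far G b b (Id D b)) = Far F (g0 b) (g0 b) (Id C (Fob G b))"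
        using FG[OF tgt.Id_Hom[OF b]] tgt.Id_Comp[OF e[OF b]] e'e[OF b] Far_Id[OF g0[OF b]] G_ob
        by simp
    qed
    show "Far G a c (g \<cdot>\<^bsub>D\<^esub> f) = Far G b c g \<cdot>\<^bsub>C\<^esub> Far G a b f"
      if f: "f \<in> Hom D a b" and g: "g \<in> Hom D b c" for f a b g c
    proof (rule faithful)
      have ob: "a \<in> Obj D" "b \<in> Obj D" "c \<in> Obj D" using tgt.Hom_Obj[OF f] tgt.Hom_Obj[OF g] by auto
      have gf: "g \<cdot>\<^bsub>D\<^esub> f \<in> Hom D a c" using tgt.Comp_Hom[OF f g] .
      show "Far G a c (g \<cdot>\<^bsub>D\<^esub> f) \<in> Hom C (g0 a) (g0 c)" using G_Hom[OF gf] .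
      show "Far G b c g \<cdot>\<^bsub>C\<^esub> Far G a b f \<in> Hom C (g0 a) (g0 c)"
        using src.Comp_Hom[OF G_Hom[OF f] G_Hom[OF g]] .
      have fe: "f \<cdot>\<^bsub>D\<^esub> e a \<in> Hom D (Fob F (g0 a)) b" using tgt.Comp_Hom[OF e[OF ob(1)] f] .
      have ge: "g \<cdot>\<^bsub>D\<^esub> e b \<in> Hom D (Fob F (g0 b)) c" using tgt.Comp_Hom[OF e[OF ob(2)] g] .
      have "(e' c \<cdot>\<^bsub>D\<^esub> (g \<cdot>\<^bsub>D\<^esub> e b)) \<cdot>\<^bsub>D\<^esub> (e' b \<cdot>\<^bsub>D\<^esub> (f \<cdot>\<^bsub>D\<^esub> e a))
          = e' c \<cdot>\<^bsub>D\<^esub> ((g \<cdot>\<^bsub>D\<^esub> e b) \<cdot>\<^bsub>D\<^esub> (e' b \<cdot>\<^bsub>D\<^esub> (f \<cdot>\<^bsub>D\<^esub> e a)))"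
        using tgt.Comp_assoc[OF conj[OF f] ge e'[OF ob(3)]] .
      also have "(g \<cdot>\<^bsub>D\<^esub> e b) \<cdot>\<^bsub>D\<^esub> (e' b \<cdot>\<^bsub>D\<^esub> (f \<cdot>\<^bsub>D\<^esub> e a)) = g \<cdot>\<^bsub>D\<^esub> (f \<cdot>\<^bsub>D\<^esub> e a)"
        using tgt.Comp_assoc[OF conj[OF f] e[OF ob(2)] g] e_nat[OF f] by simp
      also have "\<dots> = (g \<cdot>\<^bsub>D\<^esub> f) \<cdot>\<^bsub>D\<^esub> e a" using tgt.Comp_assoc[OF e[OF ob(1)] f g] by simp
      finally show "Far F (g0 a) (g0 c) (Far G a c (g \<cdot>\<^bsub>D\<^esub> f))
          = Far F (g0 a) (g0 c) (Far G b c g \<cdot>\<^bsub>C\<^esub> Far G a b f)"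
        using FG[OF gf] FG[OF f] FG[OF g] Far_Comp[OF G_Hom[OF f] G_Hom[OF g]] by simp
    qed
  qed
  have \<eta>_nat: "\<eta> b \<cdot>\<^bsub>C\<^esub> f = Far G (Fob F a) (Fob F b) (Far F a b f) \<cdot>\<^bsub>C\<^esub> \<eta> a"
    if f: "f \<in> Hom C a b" for a b f
  proof (rule faithful)
    have ob: "a \<in> Obj C" "b \<in> Obj C" using src.Hom_Obj[OF f] by auto
    have Ff: "Far F a b f \<in> Hom D (Fob F a) (Fob F b)" using Far_Hom f .
    note Fob_Obj[OF ob(1), simp] Fob_Obj[OF ob(2), simp]
    show "\<eta> b \<cdot>\<^bsub>C\<^esub> f \<in> Hom C a (g0 (Fob F b))" using src.Comp_Hom[OF f \<eta>[OF ob(2)]] .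
    show "Far G (Fob F a) (Fob F b) (Far F a b f) \<cdot>\<^bsub>C\<^esub> \<eta> a \<in> Hom C a (g0 (Fob F b))"
      using src.Comp_Hom[OF \<eta>[OF ob(1)] G_Hom[OF Ff]] .
    have eFf: "Far F a b f \<cdot>\<^bsub>D\<^esub> e (Fob F a) \<in> Hom D (Fob F (g0 (Fob F a))) (Fob F b)"
      using tgt.Comp_Hom[OF e Ff] by simp
    have "(e' (Fob F b) \<cdot>\<^bsub>D\<^esub> (Far F a b f \<cdot>\<^bsub>D\<^esub> e (Fob F a))) \<cdot>\<^bsub>D\<^esub> e' (Fob F a)
        = e' (Fob F b) \<cdot>\<^bsub>D\<^esub> (Far F a b f \<cdot>\<^bsub>D\<^esub> (e (Fob F a) \<cdot>\<^bsub>D\<^esub> e' (Fob F a)))"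
      using tgt.Comp_assoc[OF e'[OF Fob_Obj[OF ob(1)]] eFf e'[OF Fob_Obj[OF ob(2)]]]
        tgt.Comp_assoc[OF e' e Ff] by simp
    also have "\<dots> = e' (Fob F b) \<cdot>\<^bsub>D\<^esub> Far F a b f" using ee' tgt.Comp_Id[OF Ff] by simp
    finally show "Far F a (g0 (Fob F b)) (\<eta> b \<cdot>\<^bsub>C\<^esub> f)
        = Far F a (g0 (Fob F b)) (Far G (Fob F a) (Fob F b) (Far F a b f) \<cdot>\<^bsub>C\<^esub> \<eta> a)"
      using Far_Comp[OF f \<eta>[OF ob(2)]] Far_Comp[OF \<eta>[OF ob(1)] G_Hom[OF Ff]] FG[OF Ff] F\<eta> ob
      by simp
  qed
  have tri2: "Far G (Fob F (g0 b)) b (e b) \<cdot>\<^bsub>C\<^esub> \<eta> (g0 b) = Id C (g0 b)" if b: "b \<in> Obj D" for b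
  proof (rule faithful)
    let ?Fg = "Fob F (g0 b)"
    have Fg: "?Fg \<in> Obj D" using Fob_Obj[OF g0[OF b]] .
    have h: "Far G ?Fg b (e b) \<in> Hom C (g0 ?Fg) (g0 b)" using G_Hom[OF e[OF b]] .
    show "Far G ?Fg b (e b) \<cdot>\<^bsub>C\<^esub> \<eta> (g0 b) \<in> Hom C (g0 b) (g0 b)"
      using src.Comp_Hom[OF \<eta>[OF g0[OF b]] h] .
    show "Id C (g0 b) \<in> Hom C (g0 b) (g0 b)" using src.Id_Hom[OF g0[OF b]] .
    have ee: "e b \<cdot>\<^bsub>D\<^esub> e ?Fg \<in> Hom D (Fob F (g0 ?Fg)) b" using tgt.Comp_Hom[OF e[OF Fg] e[OF b]] .
    have "(e' b \<cdot>\<^bsub>D\<^esub> (e b \<cdot>\<^bsub>D\<^esub> e ?Fg)) \<cdot>\<^bsub>D\<^esub> e' ?Fg = e' b \<cdot>\<^bsub>D\<^esub> (e b \<cdot>\<^bsub>D\<^esub> (e ?Fg \<cdot>\<^bsub>D\<^esub> e' ?Fg))"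
      using tgt.Comp_assoc[OF e'[OF Fg] ee e'[OF b]] tgt.Comp_assoc[OF e'[OF Fg] e[OF Fg] e[OF b]]
      by simp
    also have "\<dots> = Id D ?Fg" using ee'[OF Fg] tgt.Comp_Id[OF e[OF b]] e'e[OF b] by simp
    finally show "Far F (g0 b) (g0 b) (Far G ?Fg b (e b) \<cdot>\<^bsub>C\<^esub> \<eta> (g0 b))
        = Far F (g0 b) (g0 b) (Id C (g0 b))"
      using Far_Comp[OF \<eta>[OF g0[OF b]] h] FG[OF e[OF b]] F\<eta>[OF g0[OF b]] Far_Id[OF g0[OF b]]
      by simp
  qed
  have \<epsilon>_nat: "e b' \<cdot>\<^bsub>D\<^esub> Far F (g0 b) (g0 b') (Far G b b' g) = g \<cdot>\<^bsub>D\<^esub> e b"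
    if "g \<in> Hom D b b'" for b b' g using FG[OF that] e_nat[OF that] by simp
  have "nat_trans C C id_ftor (comp_ftor G F) \<eta>"
    unfolding nat_trans_def using \<eta> \<eta>_nat by (simp add: id_ftor_def comp_ftor_def G_ob)
  moreover have "nat_trans D D (comp_ftor F G) id_ftor e"
    unfolding nat_trans_def using e \<epsilon>_nat by (simp add: id_ftor_def comp_ftor_def G_ob)
  ultimately have "adjunction C D F G \<eta> e"
    unfolding adjunction_def
    using G_functor cat_functor_axioms tri2 F\<eta> ee' Fob_Obj by (simp add: G_ob)
  thus ?thesis by blast
qed

text \<open>The adjunction is arbitrary, so the inverses must come from the triangle identities. The inverse of
  \<open>\<eta> a\<close> is the lift of \<open>\<epsilon> (F a)\<close> along \<open>F\<close>.\<close>

lemma adjunction_unit_counit_iso: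
  assumes adj: "adjunction C D F G \<eta> \<epsilon>"
  shows "a \<in> Obj C \<Longrightarrow> is_iso C a (Fob G (Fob F a)) (\<eta> a)"
    and "b \<in> Obj D \<Longrightarrow> is_iso D (Fob F (Fob G b)) b (\<epsilon> b)"
proof -
  interpret G: cat_functor D C G using adj unfolding adjunction_def by blast
  have \<eta>: "\<eta> a \<in> Hom C a (Fob G (Fob F a))" if "a \<in> Obj C" for a
    using adj that unfolding adjunction_def nat_trans_def by (auto simp: id_ftor_def comp_ftor_def)
  have \<epsilon>: "\<epsilon> b \<in> Hom D (Fob F (Fob G b)) b" if "b \<in> Obj D" for b
    using adj that unfolding adjunction_def nat_trans_def by (auto simp: id_ftor_def comp_ftor_def)
  have \<eta>_nat: "\<eta> b \<cdot>\<^bsub>C\<^esub> f = Far G (Fob F a) (Fob F b) (Far F a b f) \<cdot>\<^bsub>C\<^esub> \<eta> a"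
    if "f \<in> Hom C a b" for a b f
    using adj that unfolding adjunction_def nat_trans_def by (auto simp: id_ftor_def comp_ftor_def)
  have \<epsilon>_nat: "\<epsilon> b \<cdot>\<^bsub>D\<^esub> Far F (Fob G a) (Fob G b) (Far G a b f) = f \<cdot>\<^bsub>D\<^esub> \<epsilon> a"
    if "f \<in> Hom D a b" for a b f
    using adj that unfolding adjunction_def nat_trans_def by (auto simp: id_ftor_def comp_ftor_def)
  have tri1: "\<epsilon> (Fob F a) \<cdot>\<^bsub>D\<^esub> Far F a (Fob G (Fob F a)) (\<eta> a) = Id D (Fob F a)"
    if "a \<in> Obj C" for a using adj that unfolding adjunction_def by blast
  have tri2: "Far G (Fob F (Fob G b)) b (\<epsilon> b) \<cdot>\<^bsub>C\<^esub> \<eta> (Fob G b) = Id C (Fob G b)"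
    if "b \<in> Obj D" for b using adj that unfolding adjunction_def by blast
  show unit: "is_iso C a (Fob G (Fob F a)) (\<eta> a)" if a: "a \<in> Obj C" for a
  proof -
    let ?Fa = "Fob F a" let ?GFa = "Fob G ?Fa"
    have Fa: "?Fa \<in> Obj D" "?GFa \<in> Obj C" using a Fob_Obj G.Fob_Obj by auto
    define r where "r = lift ?GFa a (\<epsilon> ?Fa)"
    have r: "r \<in> Hom C ?GFa a" "Far F ?GFa a r = \<epsilon> ?Fa"
      using lift[OF Fa(2) a \<epsilon>[OF Fa(1)]] unfolding r_def by auto
    have "r \<cdot>\<^bsub>C\<^esub> \<eta> a = Id C a"
      by (rule faithful[OF src.Comp_Hom[OF \<eta>[OF a] r(1)] src.Id_Hom[OF a]])
        (simp add: Far_Comp[OF \<eta>[OF a] r(1)] r(2) tri1[OF a] Far_Id[OF a])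
    moreover have "\<eta> a \<cdot>\<^bsub>C\<^esub> r = Id C ?GFa"
      using \<eta>_nat[OF r(1)] r(2) tri2[OF Fa(1)] by simp
    ultimately show ?thesis unfolding is_iso_def using \<eta>[OF a] r(1) by blast
  qed
  show "is_iso D (Fob F (Fob G b)) b (\<epsilon> b)" if b: "b \<in> Obj D"
  proof -
    let ?Gb = "Fob G b" let ?FGb = "Fob F ?Gb"
    have Gb: "?Gb \<in> Obj C" "?FGb \<in> Obj D" using b Fob_Obj G.Fob_Obj by auto
    \<comment> \<open>A right inverse of \<open>\<epsilon> b\<close> is transported from an object \<open>F a\<close> isomorphic to \<open>b\<close>, where \<open>F (\<eta> a)\<close> is one.\<close>
    obtain a e where a: "a \<in> Obj C" and e: "is_iso D (Fob F a) b e"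
      using essentially_surjective[OF b] by blast
    obtain e' where eH: "e \<in> Hom D (Fob F a) b" and e'H: "e' \<in> Hom D b (Fob F a)"
      and e'e: "e' \<cdot>\<^bsub>D\<^esub> e = Id D (Fob F a)" and ee': "e \<cdot>\<^bsub>D\<^esub> e' = Id D b"
      using e unfolding is_iso_def by blast
    let ?u = "Far F a (Fob G (Fob F a)) (\<eta> a)" let ?Ge = "Far F (Fob G (Fob F a)) ?Gb (Far G (Fob F a) b e)"
    let ?s = "?Ge \<cdot>\<^bsub>D\<^esub> (?u \<cdot>\<^bsub>D\<^esub> e')"
    have u: "?u \<in> Hom D (Fob F a) (Fob F (Fob G (Fob F a)))" using Far_Hom[OF \<eta>[OF a]] .
    have Ge: "?Ge \<in> Hom D (Fob F (Fob G (Fob F a))) ?FGb" using Far_Hom[OF G.Far_Hom[OF eH]] .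
    have ue': "?u \<cdot>\<^bsub>D\<^esub> e' \<in> Hom D b (Fob F (Fob G (Fob F a)))" using tgt.Comp_Hom[OF e'H u] .
    have s: "?s \<in> Hom D b ?FGb" using tgt.Comp_Hom[OF ue' Ge] .
    have "\<epsilon> b \<cdot>\<^bsub>D\<^esub> ?s = (\<epsilon> b \<cdot>\<^bsub>D\<^esub> ?Ge) \<cdot>\<^bsub>D\<^esub> (?u \<cdot>\<^bsub>D\<^esub> e')"
      using tgt.Comp_assoc[OF ue' Ge \<epsilon>[OF b]] by simp
    also have "\<dots> = e \<cdot>\<^bsub>D\<^esub> ((\<epsilon> (Fob F a) \<cdot>\<^bsub>D\<^esub> ?u) \<cdot>\<^bsub>D\<^esub> e')"
      using \<epsilon>_nat[OF eH] tgt.Comp_assoc[OF ue' \<epsilon> eH] tgt.Comp_assoc[OF e'H u \<epsilon>] Fob_Obj[OF a] by simp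
    also have "\<dots> = Id D b" using tri1[OF a] tgt.Id_Comp[OF e'H] ee' by simp
    finally have \<epsilon>s: "\<epsilon> b \<cdot>\<^bsub>D\<^esub> ?s = Id D b" .
    \<comment> \<open>An endomorphism \<open>x\<close> of \<open>G b\<close> is determined by \<open>\<epsilon> b \<cdot> F x\<close>; apply this to the lift of \<open>s \<cdot> \<epsilon> b\<close>.\<close>
    have transpose: "x = Far G ?FGb b (\<epsilon> b \<cdot>\<^bsub>D\<^esub> Far F ?Gb ?Gb x) \<cdot>\<^bsub>C\<^esub> \<eta> ?Gb"
      if x: "x \<in> Hom C ?Gb ?Gb" for x
      using G.Far_Comp[OF Far_Hom[OF x] \<epsilon>[OF b]] \<eta>_nat[OF x] tri2[OF b] src.Id_Comp[OF x]
        src.Comp_assoc[OF \<eta>[OF Gb(1)] G.Far_Hom[OF Far_Hom[OF x]] G.Far_Hom[OF \<epsilon>[OF b]]]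
        src.Comp_assoc[OF x \<eta>[OF Gb(1)] G.Far_Hom[OF \<epsilon>[OF b]]] by simp
    have s\<epsilon>: "?s \<cdot>\<^bsub>D\<^esub> \<epsilon> b \<in> Hom D ?FGb ?FGb" using tgt.Comp_Hom[OF \<epsilon>[OF b] s] .
    note u = lift[OF Gb(1) Gb(1) s\<epsilon>]
    have "\<epsilon> b \<cdot>\<^bsub>D\<^esub> (?s \<cdot>\<^bsub>D\<^esub> \<epsilon> b) = \<epsilon> b"
      using tgt.Comp_assoc[OF \<epsilon>[OF b] s \<epsilon>[OF b]] \<epsilon>s tgt.Id_Comp[OF \<epsilon>[OF b]] by simp
    hence "lift ?Gb ?Gb (?s \<cdot>\<^bsub>D\<^esub> \<epsilon> b) = Id C ?Gb"
      using transpose[OF u(1)] transpose[OF src.Id_Hom[OF Gb(1)]] u(2) Far_Id[OF Gb(1)]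
        tgt.Comp_Id[OF \<epsilon>[OF b]] by simp
    hence "?s \<cdot>\<^bsub>D\<^esub> \<epsilon> b = Id D ?FGb" using u(2) Far_Id[OF Gb(1)] by simp
    thus ?thesis unfolding is_iso_def using \<epsilon>[OF b] s \<epsilon>s by blast
  qed
qed

text \<open>Since \<open>\<epsilon> b\<close> is an isomorphism \<open>F (G b) \<rightarrow> b\<close>, closure of \<open>T\<close> under isomorphism puts \<open>F (G b)\<close> into \<open>T\<close>
  whenever \<open>b\<close> lies there, and hence \<open>G b\<close> into \<open>S\<close>.\<close>

lemma adjunction_restricts:
  assumes adj: "adjunction C D F G \<eta> \<epsilon>"
    and ST: "\<And>a. a \<in> Obj C \<Longrightarrow> a \<in> S \<longleftrightarrow> Fob F a \<in> T"
    and T: "\<And>b c e. is_iso D b c e \<Longrightarrow> c \<in> T \<Longrightarrow> b \<in> T"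
  shows "adjoint_equivalence (full_subcategory C S) (full_subcategory D T) F G \<eta> \<epsilon>"
proof -
  interpret G: cat_functor D C G using adj unfolding adjunction_def by blast
  note iso = adjunction_unit_counit_iso[OF adj]
  have TS: "Fob G b \<in> S" if "b \<in> Obj D" "b \<in> T" for b
    using T[OF iso(2)[OF that(1)] that(2)] ST[OF G.Fob_Obj[OF that(1)]] by simp
  have FS: "Fob F a \<in> T" if "a \<in> Obj C" "a \<in> S" for a using ST that by simp
  have 1: "cat_functor (full_subcategory C S) (full_subcategory D T) F"
    by (rule cat_functor_full_subcategory[OF cat_functor_axioms FS])
  have 2: "cat_functor (full_subcategory D T) (full_subcategory C S) G"
    by (rule cat_functor_full_subcategory[OF G.cat_functor_axioms TS])
  have "nat_trans C C id_ftor (comp_ftor G F) \<eta>" "nat_trans D D (comp_ftor F G) id_ftor \<epsilon>"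
    using adj unfolding adjunction_def by blast+
  hence "nat_trans (full_subcategory C S) (full_subcategory C S) id_ftor (comp_ftor G F) \<eta>"
    and "nat_trans (full_subcategory D T) (full_subcategory D T) (comp_ftor F G) id_ftor \<epsilon>"
    unfolding nat_trans_def using FS TS Fob_Obj G.Fob_Obj
    by (simp_all add: full_subcategory_def id_ftor_def comp_ftor_def)
  moreover have "\<forall>a\<in>Obj (full_subcategory C S).
      \<epsilon> (Fob F a) \<cdot>\<^bsub>D\<^esub> Far F a (Fob G (Fob F a)) (\<eta> a) = Id D (Fob F a)"
    and "\<forall>b\<in>Obj (full_subcategory D T).
      Far G (Fob F (Fob G b)) b (\<epsilon> b) \<cdot>\<^bsub>C\<^esub> \<eta> (Fob G b) = Id C (Fob G b)"
    using adj unfolding adjunction_def by (auto simp: full_subcategory_def)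
  ultimately have "adjunction (full_subcategory C S) (full_subcategory D T) F G \<eta> \<epsilon>"
    unfolding adjunction_def using 1 2 by (simp add: full_subcategory_def)
  moreover have "is_iso (full_subcategory C S) a (Fob G (Fob F a)) (\<eta> a)"
    if "a \<in> Obj (full_subcategory C S)" for a
    using that iso(1)[of a] FS[of a] TS[of "Fob F a"] Fob_Obj[of a]
    by (intro is_iso_full_subcategory) (auto simp: full_subcategory_def)
  moreover have "is_iso (full_subcategory D T) (Fob F (Fob G b)) b (\<epsilon> b)"
    if "b \<in> Obj (full_subcategory D T)" for b
    using that iso(2)[of b] TS[of b] FS[of "Fob G b"] G.Fob_Obj[of b]
    by (intro is_iso_full_subcategory) (auto simp: full_subcategory_def)
  ultimately show ?thesis unfolding adjoint_equivalence_def by blast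
qed

end

section \<open>Arithmetic of arrows in an abelian category\<close>

context preadditive_category
begin

abbreviation hom_group :: "'o \<Rightarrow> 'o \<Rightarrow> 'a monoid" where
  "hom_group a b \<equiv> \<lparr>carrier = Hom A a b, mult = Add A a b, one = Zero A a b\<rparr>"

definition Neg :: "'o \<Rightarrow> 'o \<Rightarrow> 'a \<Rightarrow> 'a" where
  "Neg a b f = inv\<^bsub>hom_group a b\<^esub> f"

definition Sub :: "'o \<Rightarrow> 'o \<Rightarrow> 'a \<Rightarrow> 'a \<Rightarrow> 'a" where
  "Sub a b f g = Add A a b f (Neg a b g)"

lemma Hom_comm_group: "f \<in> Hom A a b \<Longrightarrow> comm_group (hom_group a b)"
  using Hom_Obj[of f a b] Hom_group by blast

lemma Zero_Hom: "a \<in> Obj A \<Longrightarrow> b \<in> Obj A \<Longrightarrow> Zero A a b \<in> Hom A a b"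
  using monoid.one_closed[of "hom_group a b"] Hom_group[of a b]
  by (simp add: comm_group_def group_def)

lemma Add_Hom:
  assumes "f \<in> Hom A a b" "g \<in> Hom A a b" shows "Add A a b f g \<in> Hom A a b"
proof -
  interpret G: comm_group "hom_group a b" using Hom_comm_group assms(1) .
  show ?thesis using G.m_closed assms by simp
qed

lemma Neg_Hom:
  assumes "f \<in> Hom A a b" shows "Neg a b f \<in> Hom A a b"
proof -
  interpret G: comm_group "hom_group a b" using Hom_comm_group assms(1) .
  show ?thesis using G.inv_closed assms by (simp add: Neg_def)
qed

lemma Sub_Hom: "f \<in> Hom A a b \<Longrightarrow> g \<in> Hom A a b \<Longrightarrow> Sub a b f g \<in> Hom A a b"
  unfolding Sub_def by (intro Add_Hom Neg_Hom)

lemma Add_assoc: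
  assumes "f \<in> Hom A a b" "g \<in> Hom A a b" "h \<in> Hom A a b"
  shows "Add A a b (Add A a b f g) h = Add A a b f (Add A a b g h)"
proof -
  interpret G: comm_group "hom_group a b" using Hom_comm_group assms(1) .
  show ?thesis using G.m_assoc assms by simp
qed

lemma Add_commute:
  assumes "f \<in> Hom A a b" "g \<in> Hom A a b"
  shows "Add A a b f g = Add A a b g f"
proof -
  interpret G: comm_group "hom_group a b" using Hom_comm_group assms(1) .
  show ?thesis using G.m_comm assms by simp
qed

lemma Add_Zero:
  assumes "f \<in> Hom A a b"
  shows "Add A a b f (Zero A a b) = f" "Add A a b (Zero A a b) f = f"
proof -
  interpret G: comm_group "hom_group a b" using Hom_comm_group assms(1) .
  show "Add A a b f (Zero A a b) = f" "Add A a b (Zero A a b) f = f"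
    using G.l_one G.r_one assms by simp_all
qed

lemma Add_Neg:
  assumes "f \<in> Hom A a b"
  shows "Add A a b f (Neg a b f) = Zero A a b" "Add A a b (Neg a b f) f = Zero A a b"
proof -
  interpret G: comm_group "hom_group a b" using Hom_comm_group assms(1) .
  show "Add A a b f (Neg a b f) = Zero A a b" "Add A a b (Neg a b f) f = Zero A a b"
    using G.r_inv G.l_inv assms by (simp_all add: Neg_def)
qed

lemma Neg_unique:
  assumes "f \<in> Hom A a b" "g \<in> Hom A a b" "Add A a b f g = Zero A a b"
  shows "g = Neg a b f"
proof -
  interpret G: comm_group "hom_group a b" using Hom_comm_group assms(1) .
  show ?thesis using G.inv_unique'[of f g] G.m_comm[of f g] assms by (simp add: Neg_def)
qed

lemma Add_idem_Zero:
  assumes "f \<in> Hom A a b" "Add A a b f f = f" shows "f = Zero A a b"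
proof -
  interpret G: comm_group "hom_group a b" using Hom_comm_group assms(1) .
  show ?thesis using G.l_cancel_one[of f f] assms by simp
qed

lemma Neg_Add:
  assumes "f \<in> Hom A a b" "g \<in> Hom A a b"
  shows "Neg a b (Add A a b f g) = Add A a b (Neg a b f) (Neg a b g)"
proof -
  interpret G: comm_group "hom_group a b" using Hom_comm_group assms(1) .
  show ?thesis using G.inv_mult[of f g] assms by (simp add: Neg_def)
qed

lemma Neg_Zero: "a \<in> Obj A \<Longrightarrow> b \<in> Obj A \<Longrightarrow> Neg a b (Zero A a b) = Zero A a b"
  using Neg_unique[OF Zero_Hom Zero_Hom Add_Zero(1)[OF Zero_Hom]] by simp

lemma Comp_Zero:
  assumes "g \<in> Hom A b c" "a \<in> Obj A" shows "g \<cdot> Zero A a b = Zero A a c"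
proof -
  have z: "Zero A a b \<in> Hom A a b" using Zero_Hom assms Hom_Obj[OF assms(1)] by blast
  show ?thesis using Add_idem_Zero[OF Comp_Hom[OF z assms(1)]] Comp_Add[OF z z assms(1)] Add_Zero[OF z]
    by simp
qed

lemma Zero_Comp:
  assumes "f \<in> Hom A a b" "c \<in> Obj A" shows "Zero A b c \<cdot> f = Zero A a c"
proof -
  have z: "Zero A b c \<in> Hom A b c" using Zero_Hom assms Hom_Obj[OF assms(1)] by blast
  show ?thesis using Add_idem_Zero[OF Comp_Hom[OF assms(1) z]] Add_Comp[OF assms(1) z z] Add_Zero[OF z]
    by simp
qed

lemma Comp_Neg:
  assumes "f \<in> Hom A a b" "g \<in> Hom A b c" shows "g \<cdot> Neg a b f = Neg a c (g \<cdot> f)"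
  using Neg_unique[OF Comp_Hom[OF assms] Comp_Hom[OF Neg_Hom[OF assms(1)] assms(2)]]
    Comp_Add[OF assms(1) Neg_Hom[OF assms(1)] assms(2)] Add_Neg[OF assms(1)]
    Comp_Zero[OF assms(2)] Hom_Obj[OF assms(1)] by simp

lemma Neg_Comp:
  assumes "f \<in> Hom A a b" "g \<in> Hom A b c" shows "Neg b c g \<cdot> f = Neg a c (g \<cdot> f)"
  using Neg_unique[OF Comp_Hom[OF assms] Comp_Hom[OF assms(1) Neg_Hom[OF assms(2)]]]
    Add_Comp[OF assms Neg_Hom[OF assms(2)]] Add_Neg[OF assms(2)]
    Zero_Comp[OF assms(1)] Hom_Obj[OF assms(2)] by simp

lemma Comp_Sub:
  assumes "f \<in> Hom A a b" "f' \<in> Hom A a b" "g \<in> Hom A b c"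
  shows "g \<cdot> Sub a b f f' = Sub a c (g \<cdot> f) (g \<cdot> f')"
  unfolding Sub_def using Comp_Add[OF assms(1) Neg_Hom[OF assms(2)] assms(3)] Comp_Neg[OF assms(2,3)]
  by simp

lemma Sub_Comp:
  assumes "f \<in> Hom A a b" "g \<in> Hom A b c" "g' \<in> Hom A b c"
  shows "Sub b c g g' \<cdot> f = Sub a c (g \<cdot> f) (g' \<cdot> f)"
  unfolding Sub_def using Add_Comp[OF assms(1,2) Neg_Hom[OF assms(3)]] Neg_Comp[OF assms(1,3)]
  by simp

lemma Sub_self: "f \<in> Hom A a b \<Longrightarrow> Sub a b f f = Zero A a b"
  unfolding Sub_def by (rule Add_Neg)

lemma Add_Sub:
  assumes "f \<in> Hom A a b" "g \<in> Hom A a b"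
  shows "Add A a b g (Sub a b f g) = f"
proof -
  interpret G: comm_group "hom_group a b" using Hom_comm_group assms(1) .
  have "Add A a b g (Sub a b f g) = Add A a b g (Add A a b (Neg a b g) f)"
    unfolding Sub_def using Add_commute[OF assms(1) Neg_Hom[OF assms(2)]] by simp
  also have "\<dots> = Add A a b (Zero A a b) f"
    using Add_assoc[OF assms(2) Neg_Hom[OF assms(2)] assms(1)] Add_Neg[OF assms(2)] by simp
  finally show ?thesis using Add_Zero[OF assms(1)] by simp
qed

lemma Sub_eq_Zero:
  assumes "f \<in> Hom A a b" "g \<in> Hom A a b" "Sub a b f g = Zero A a b"
  shows "f = g"
  using Add_Sub[OF assms(1,2)] assms(3) Add_Zero[OF assms(2)] by simp

lemma Sub_Zero: "f \<in> Hom A a b \<Longrightarrow> Sub a b f (Zero A a b) = f"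
  using Add_Sub[of f a b "Zero A a b"] Add_Zero(2)[OF Sub_Hom[of f a b "Zero A a b"]] Zero_Hom Hom_Obj[of f a b]
  by simp

lemma Add_exchange:
  assumes "f \<in> Hom A a b" "g \<in> Hom A a b" "h \<in> Hom A a b" "k \<in> Hom A a b"
  shows "Add A a b (Add A a b f g) (Add A a b h k) = Add A a b (Add A a b f h) (Add A a b g k)"
  using Add_assoc[OF assms(1,2) Add_Hom[OF assms(3,4)]] Add_assoc[OF assms(2,3,4)]
    Add_assoc[OF assms(1,3) Add_Hom[OF assms(2,4)]] Add_assoc[OF assms(3,2,4)]
    Add_commute[OF assms(2,3)] by simp

lemma Sub_Add_Add:
  assumes "f \<in> Hom A a b" "g \<in> Hom A a b" "f' \<in> Hom A a b" "g' \<in> Hom A a b"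
  shows "Sub a b (Add A a b f g) (Add A a b f' g') = Add A a b (Sub a b f f') (Sub a b g g')"
  unfolding Sub_def Neg_Add[OF assms(3,4)]
  by (rule Add_exchange[OF assms(1,2) Neg_Hom[OF assms(3)] Neg_Hom[OF assms(4)]])

lemma Sub_Add_cancel:
  assumes "f \<in> Hom A a b" "g \<in> Hom A a b"
  shows "Sub a b (Add A a b f g) f = g"
proof -
  have z: "Zero A a b \<in> Hom A a b" using Zero_Hom Hom_Obj[OF assms(1)] by simp
  thus ?thesis using Sub_Add_Add[OF assms assms(1) z] Add_Zero[OF assms(1)] Add_Zero[OF assms(2)]
      Sub_self[OF assms(1)] Sub_Zero[OF assms(2)] by simp
qed

lemma zero_object_arrow:
  assumes "zero_object A z" "f \<in> Hom A a z" shows "f = Zero A a z"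
proof -
  have "a \<in> Obj A" "z \<in> Obj A" using Hom_Obj[OF assms(2)] by auto
  thus ?thesis using assms Zero_Hom unfolding zero_object_def by metis
qed

lemma zero_objectI:
  assumes "z \<in> Obj A" "Id A z = Zero A z z" shows "zero_object A z"
proof -
  have "f = Zero A a z" if "f \<in> Hom A a z" for f a
    using Id_Comp[OF that] Zero_Comp[OF that assms(1)] assms(2) by simp
  moreover have "f = Zero A z a" if "f \<in> Hom A z a" for f a
    using Comp_Id[OF that] Comp_Zero[OF that assms(1)] assms(2) by simp
  ultimately show ?thesis unfolding zero_object_def using Zero_Hom assms(1) by metis
qed

end

text \<open>The chosen kernels, intersections, coproducts and limits are pairs given by the choice operator;
  this reduces their properties to an existence statement.\<close>

lemma some_pair:
  assumes "P a b"
  shows "P (fst (SOME (x, y). P x y)) (snd (SOME (x, y). P x y))"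
  using someI[of "\<lambda>(x, y). P x y" "(a, b)"] assms by (metis (mono_tags, lifting) case_prod_conv prod.collapse)

context abelian_category
begin

lemma kernel_is_kernel:
  assumes "f \<in> Hom A a b"
  shows "is_kernel A a b f (fst (kernel A a b f)) (snd (kernel A a b f))"
proof -
  obtain K k where "is_kernel A a b f K k" using ex_kernel[OF assms] by blast
  thus ?thesis unfolding kernel_def by (rule some_pair)
qed

end

section \<open>Operators of the simplex category\<close>

lemma Delta_simps [simp]:
  "Obj Delta = UNIV" "Comp Delta g f = g \<circ> f"
  "Obj (opposite Delta) = UNIV" "Hom (opposite Delta) n m = Hom Delta m n"
  "Comp (opposite Delta) f g = g \<circ> f" "Id (opposite Delta) = Id Delta"
  by (simp_all add: Delta_def opposite_def)

lemma Delta_Hom_iff: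
  "f \<in> Hom Delta m n \<longleftrightarrow> mono f \<and> f m \<le> n \<and> (\<forall>i \<ge> m. f i = f m)"
  by (simp add: Delta_def)

lemma Delta_HomD:
  assumes "f \<in> Hom Delta m n"
  shows "mono f" "f m \<le> n" "m \<le> i \<Longrightarrow> f i = f m"
  using assms unfolding Delta_Hom_iff by blast+

lemma Delta_Id: "Id Delta n = (\<lambda>i. min i n)"
  by (simp add: Delta_def)

lemma Delta_le:
  assumes "f \<in> Hom Delta m n" shows "f i \<le> n"
proof -
  have "f i \<le> f (max i m)" using monoD[OF Delta_HomD(1)[OF assms]] by simp
  also have "\<dots> = f m" using Delta_HomD(3)[OF assms, of "max i m"] by simp
  finally show ?thesis using Delta_HomD(2)[OF assms] by simp
qed

lemma Delta_mono: "f \<in> Hom Delta m n \<Longrightarrow> i \<le> j \<Longrightarrow> f i \<le> f j"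
  using monoD[OF Delta_HomD(1)] .

lemma Delta_const: "f \<in> Hom Delta m n \<Longrightarrow> f (min i m) = f i"
  using Delta_HomD(3)[of f m n i] by (auto simp: min_def)

lemma Delta_HomI:
  assumes "\<And>i j. i \<le> j \<Longrightarrow> f i \<le> f j" "\<And>i. f i \<le> n" "\<And>i. m \<le> i \<Longrightarrow> f i = f m"
  shows "f \<in> Hom Delta m n"
  unfolding Delta_Hom_iff using assms by (blast intro: monoI)

lemma Delta_comp:
  assumes "f \<in> Hom Delta l m" "g \<in> Hom Delta m n" shows "g \<circ> f \<in> Hom Delta l n"
proof (rule Delta_HomI)
  show "(g \<circ> f) i \<le> (g \<circ> f) j" if "i \<le> j" for i j
    using Delta_mono[OF assms(2) Delta_mono[OF assms(1) that]] by simp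
  show "(g \<circ> f) i \<le> n" for i using Delta_le[OF assms(2)] by simp
  show "(g \<circ> f) i = (g \<circ> f) l" if "l \<le> i" for i using Delta_HomD(3)[OF assms(1) that] by simp
qed

lemma Delta_Id_Hom: "Id Delta n \<in> Hom Delta n n"
  by (rule Delta_HomI) (auto simp: Delta_Id)

lemma Delta_comp_Id: "f \<in> Hom Delta m n \<Longrightarrow> f \<circ> Id Delta m = f"
  by (auto simp: Delta_Id Delta_const)

lemma Delta_Id_comp: "f \<in> Hom Delta m n \<Longrightarrow> Id Delta n \<circ> f = f"
  using Delta_le[of f m n] by (auto simp: Delta_Id)

lemma category_opposite_Delta: "category (opposite Delta)"
  by unfold_locales (auto simp: Delta_Id_Hom Delta_comp Delta_comp_Id Delta_Id_comp comp_assoc)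

text \<open>The surjection \<open>[n + 1] \<rightarrow> [n]\<close> that takes the value \<open>i\<close> twice; as for \<^const>\<open>coface\<close>, arguments beyond the
  source are cut off.\<close>

definition codegen :: "nat \<Rightarrow> nat \<Rightarrow> nat \<Rightarrow> nat" where
  "codegen n i = (\<lambda>k. let k' = min k (Suc n) in if k' \<le> i then k' else k' - 1)"

lemma coface_apply: "coface (Suc n) j i = (if min i n < j then min i n else Suc (min i n))"
  by (simp add: coface_def Let_def)

lemma codegen_apply:
  "codegen n i k = (if min k (Suc n) \<le> i then min k (Suc n) else min k (Suc n) - 1)"
  by (simp add: codegen_def Let_def)

lemma coface_Hom: "j \<le> Suc n \<Longrightarrow> coface (Suc n) j \<in> Hom Delta n (Suc n)"
  by (rule Delta_HomI) (auto simp: coface_def Let_def)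

lemma codegen_Hom: "i \<le> n \<Longrightarrow> codegen n i \<in> Hom Delta (Suc n) n"
  by (rule Delta_HomI) (auto simp: codegen_def Let_def)

lemma coface_coface:
  assumes "i < j" "j \<le> Suc (Suc n)"
  shows "coface (Suc (Suc n)) j \<circ> coface (Suc n) i
    = coface (Suc (Suc n)) i \<circ> coface (Suc n) (j - 1)"
proof
  fix x
  consider "x < i" | "i \<le> x" "Suc x < j" | "j \<le> Suc x" "x \<le> n" | "n < x" by linarith
  then show "(coface (Suc (Suc n)) j \<circ> coface (Suc n) i) x
    = (coface (Suc (Suc n)) i \<circ> coface (Suc n) (j - 1)) x"
    using assms by cases (simp add: codegen_apply coface_apply min_def; arith)+
qed

lemma codegen_coface_Id:
  assumes "j = i \<or> j = Suc i" "i \<le> n"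
  shows "codegen n i \<circ> coface (Suc n) j = Id Delta n"
  using assms by (auto simp: coface_def codegen_def Let_def fun_eq_iff Delta_Id)

lemma codegen_coface:
  assumes "Suc i < j" "j \<le> Suc (Suc n)"
  shows "codegen (Suc n) i \<circ> coface (Suc (Suc n)) j = coface (Suc n) (j - 1) \<circ> codegen n i"
proof
  fix x
  consider "x \<le> i" | "i < x" "x < j" | "j \<le> x" "x \<le> Suc (n)" | "Suc n < x" by linarith
  then show "(codegen (Suc n) i \<circ> coface (Suc (Suc n)) j) x = (coface (Suc n) (j - 1) \<circ> codegen n i) x"
    using assms by cases (simp add: codegen_apply coface_apply min_def; arith)+
qed

lemma codegen_codegen:
  assumes "i < k" "k \<le> Suc n"
  shows "codegen n i \<circ> codegen (Suc n) k = codegen n (k - 1) \<circ> codegen (Suc n) i"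
proof
  fix x
  consider "x \<le> i" | "i < x" "x \<le> k" | "k < x" "x \<le> Suc (Suc n)" | "Suc (Suc n) < x" by linarith
  then show "(codegen n i \<circ> codegen (Suc n) k) x = (codegen n (k - 1) \<circ> codegen (Suc n) i) x"
    using assms by cases (simp add: codegen_apply min_def; arith)+
qed

lemma factor_coface:
  assumes \<rho>: "\<rho> \<in> Hom Delta l (Suc n)" and j: "j \<notin> range \<rho>" "j \<le> Suc n"
  obtains \<tau> where "\<tau> \<in> Hom Delta l n" "\<rho> = coface (Suc n) j \<circ> \<tau>"
proof
  define \<tau> where "\<tau> i = (if \<rho> i < j then \<rho> i else \<rho> i - 1)" for i
  have ne: "\<rho> i \<noteq> j" for i using j(1) by (metis rangeI)
  show "\<tau> \<in> Hom Delta l n"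
  proof (rule Delta_HomI)
    show "\<tau> i \<le> \<tau> i'" if "i \<le> i'" for i i'
      using Delta_mono[OF \<rho> that] ne[of i] ne[of i'] unfolding \<tau>_def by auto
    show "\<tau> i \<le> n" for i
      using Delta_le[OF \<rho>, of i] ne[of i] j(2) unfolding \<tau>_def by auto
    show "\<tau> i = \<tau> l" if "l \<le> i" for i using Delta_HomD(3)[OF \<rho> that] unfolding \<tau>_def by simp
  qed
  show "\<rho> = coface (Suc n) j \<circ> \<tau>"
  proof
    fix i show "\<rho> i = (coface (Suc n) j \<circ> \<tau>) i"
      using Delta_le[OF \<rho>, of i] ne[of i] j(2)
      unfolding \<tau>_def coface_def Let_def by (auto simp: min_def)
  qed
qed

lemma factor_codegen:
  assumes \<sigma>: "\<sigma> \<in> Hom Delta (Suc n) k" and i: "i \<le> n" "\<sigma> i = \<sigma> (Suc i)"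
  shows "\<sigma> = (\<sigma> \<circ> coface (Suc n) (Suc i)) \<circ> codegen n i"
proof
  fix x
  have "\<sigma> (min x (Suc n)) = \<sigma> x" using Delta_const[OF \<sigma>] .
  moreover have "coface (Suc n) (Suc i) (codegen n i x) =
      (if min x (Suc n) = Suc i then i else min x (Suc n))"
    using i(1) by (auto simp: coface_def codegen_def Let_def)
  ultimately show "\<sigma> x = ((\<sigma> \<circ> coface (Suc n) (Suc i)) \<circ> codegen n i) x"
    using i(2) by auto
qed

lemma collapsing_step:
  assumes \<sigma>: "\<sigma> \<in> Hom Delta (Suc n) k" and k: "k < Suc n"
  obtains i where "i \<le> n" "\<sigma> i = \<sigma> (Suc i)"
proof -
  have "\<exists>i \<le> n. \<sigma> i = \<sigma> (Suc i)"
  proof (rule ccontr)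
    assume "\<not> ?thesis"
    hence *: "\<sigma> i < \<sigma> (Suc i)" if "i \<le> n" for i
      using that Delta_mono[OF \<sigma>, of i "Suc i"] by fastforce
    have "i \<le> Suc n \<longrightarrow> i \<le> \<sigma> i" for i
    proof (induction i)
      case (Suc i) thus ?case using *[of i] by auto
    qed simp
    from this[of "Suc n"] show False using Delta_le[OF \<sigma>, of "Suc n"] k by simp
  qed
  thus ?thesis using that by blast
qed

text \<open>Since an operator is constant beyond its source, its range is the set of its genuine values.\<close>

definition Delta_surj :: "nat \<Rightarrow> nat \<Rightarrow> (nat \<Rightarrow> nat) set" where
  "Delta_surj n k = {\<sigma> \<in> Hom Delta n k. \<forall>j \<le> k. j \<in> range \<sigma>}"

lemma Delta_surj_Hom: "\<sigma> \<in> Delta_surj n k \<Longrightarrow> \<sigma> \<in> Hom Delta n k"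
  by (simp add: Delta_surj_def)

lemma range_Delta: "f \<in> Hom Delta m n \<Longrightarrow> range f = f ` {..m}"
  using Delta_const[of f m n] by (auto simp: image_iff) (metis atMost_iff min.cobounded2)

lemma Delta_surj_le:
  assumes "\<sigma> \<in> Delta_surj n k" shows "k \<le> n"
proof -
  have "{..k} \<subseteq> \<sigma> ` {..n}" using assms range_Delta[of \<sigma> n k] by (auto simp: Delta_surj_def)
  hence "card {..k} \<le> card {..n}" using surj_card_le[of "{..n}" "{..k}" \<sigma>] by simp
  thus ?thesis by simp
qed

text \<open>A surjection of \<open>[n]\<close> to itself is injective. Being monotone, it then satisfies \<open>i \<le> \<sigma> i\<close> by
  induction upwards and \<open>\<sigma> i \<le> i\<close> by induction downwards from \<open>n\<close>.\<close>

lemma Delta_surj_eq_Id: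
  assumes "\<sigma> \<in> Delta_surj n n" shows "\<sigma> = Id Delta n"
proof -
  have \<sigma>: "\<sigma> \<in> Hom Delta n n" using assms Delta_surj_Hom by blast
  have "{..n} \<subseteq> \<sigma> ` {..n}" using assms range_Delta[OF \<sigma>] by (auto simp: Delta_surj_def)
  hence inj: "inj_on \<sigma> {..n}"
    using eq_card_imp_inj_on[of "{..n}" \<sigma>] card_mono[of "\<sigma> ` {..n}" "{..n}"] card_image_le[of "{..n}" \<sigma>]
    by simp
  have "i \<le> n \<longrightarrow> i \<le> \<sigma> i" for i
  proof (induction i)
    case (Suc i)
    show ?case
    proof
      assume i: "Suc i \<le> n"
      have "\<sigma> i \<noteq> \<sigma> (Suc i)" using inj_onD[OF inj, of i "Suc i"] i by auto
      thus "Suc i \<le> \<sigma> (Suc i)" using Suc i Delta_mono[OF \<sigma>, of i "Suc i"] by auto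
    qed
  qed simp
  moreover have "i \<le> n \<Longrightarrow> \<sigma> (n - i) \<le> n - i" for i
  proof (induction i)
    case 0 thus ?case using Delta_le[OF \<sigma>] by simp
  next
    case (Suc i)
    have "\<sigma> (n - Suc i) \<noteq> \<sigma> (n - i)" using inj_onD[OF inj, of "n - Suc i" "n - i"] Suc(2) by auto
    moreover have "\<sigma> (n - Suc i) \<le> \<sigma> (n - i)" by (rule Delta_mono[OF \<sigma>]) simp
    ultimately show ?case using Suc by simp
  qed
  ultimately have "\<sigma> i = i" if "i \<le> n" for i
    using that by (metis diff_diff_cancel diff_le_self le_antisym)
  hence "\<sigma> i = min i n" for i using Delta_const[OF \<sigma>, of i] by (metis min.cobounded2)
  thus ?thesis by (auto simp: Delta_Id)
qed

lemma Id_Delta_surj: "Id Delta n \<in> Delta_surj n n"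
proof -
  have "j = Id Delta n j" if "j \<le> n" for j using that by (simp add: Delta_Id)
  hence "j \<in> range (Id Delta n)" if "j \<le> n" for j using that by (metis rangeI)
  thus ?thesis by (simp add: Delta_surj_def Delta_Id_Hom)
qed

text \<open>The three ways in which an operator can act on elements that are killed by all faces but \<open>d\<^sub>0\<close>: the
  epi-mono factorisation matters only when its injective part is the identity or omits just 0.\<close>

lemma Delta_cases:
  assumes \<rho>: "\<rho> \<in> Hom Delta l k"
  obtains (surj) "\<rho> \<in> Delta_surj l k"
  | (d0) k' \<nu> where "k = Suc k'" "\<nu> \<in> Delta_surj l k'" "\<rho> = coface (Suc k') 0 \<circ> \<nu>"
  | (miss) k' j where "k = Suc k'" "1 \<le> j" "j \<le> k" "j \<notin> range \<rho>"
proof (cases "\<exists>j. 1 \<le> j \<and> j \<le> k \<and> j \<notin> range \<rho>")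
  case True
  then obtain j where "1 \<le> j" "j \<le> k" "j \<notin> range \<rho>" by blast
  moreover then obtain k' where "k = Suc k'" by (cases k) auto
  ultimately show ?thesis using miss by blast
next
  case no: False
  show ?thesis
  proof (cases "0 \<in> range \<rho>")
    case True
    have "j \<in> range \<rho>" if "j \<le> k" for j using no True that by (cases j) auto
    thus ?thesis using surj \<rho> by (simp add: Delta_surj_def)
  next
    case False
    have "\<rho> 0 \<noteq> 0" using False by (metis rangeI)
    then obtain k' where k: "k = Suc k'" using Delta_le[OF \<rho>, of 0] by (cases k) auto
    obtain \<nu> where \<nu>: "\<nu> \<in> Hom Delta l k'" "\<rho> = coface (Suc k') 0 \<circ> \<nu>"
      using factor_coface[of \<rho> l k' 0] \<rho> False k by auto
    have "j \<in> range \<nu>" if j: "j \<le> k'" for j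
    proof -
      obtain i where i: "\<rho> i = Suc j" using no j k by (metis One_nat_def Suc_le_mono image_iff le0)
      have "coface (Suc k') 0 (\<nu> i) = Suc (\<nu> i)"
        using Delta_le[OF \<nu>(1), of i] by (simp add: coface_def)
      thus ?thesis using i \<nu>(2) by auto
    qed
    hence "\<nu> \<in> Delta_surj l k'" using \<nu>(1) by (simp add: Delta_surj_def)
    thus ?thesis using d0[OF k _ \<nu>(2)] by blast
  qed
qed

lemma Delta_surj_0:
  assumes "\<sigma> \<in> Delta_surj n k" shows "\<sigma> 0 = 0"
proof -
  obtain i where "\<sigma> i = 0" using assms unfolding Delta_surj_def by (metis (mono_tags, lifting) le0 mem_Collect_eq rangeE)
  thus ?thesis using Delta_mono[OF Delta_surj_Hom[OF assms], of 0 i] by simp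
qed

text \<open>The least section \<open>\<mu>\<close> of a surjection. It preserves 0 and satisfies \<open>\<mu> (\<sigma> i) \<le> i\<close>; these two properties
  make the coproduct decomposition of \<open>X\<^sub>n\<close> triangular.\<close>

definition Delta_section :: "(nat \<Rightarrow> nat) \<Rightarrow> nat \<Rightarrow> nat \<Rightarrow> nat" where
  "Delta_section \<sigma> k j = (LEAST i. \<sigma> i = min j k)"

lemma Delta_section:
  assumes \<sigma>: "\<sigma> \<in> Delta_surj n k"
  shows "Delta_section \<sigma> k \<in> Hom Delta k n" "\<sigma> (Delta_section \<sigma> k j) = min j k"
    "Delta_section \<sigma> k 0 = 0" "Delta_section \<sigma> k (\<sigma> i) \<le> i"
proof -
  have \<sigma>H: "\<sigma> \<in> Hom Delta n k" using Delta_surj_Hom[OF \<sigma>] .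
  have ex: "\<exists>i. i \<le> n \<and> \<sigma> i = min j k" for j
  proof -
    have "min j k \<in> range \<sigma>" using \<sigma> by (simp add: Delta_surj_def)
    thus ?thesis using range_Delta[OF \<sigma>H] by auto
  qed
  show eq: "\<sigma> (Delta_section \<sigma> k j) = min j k" for j
    unfolding Delta_section_def using ex[of j] by (metis (mono_tags, lifting) LeastI)
  have least: "Delta_section \<sigma> k j \<le> i" if "\<sigma> i = min j k" for i j
    unfolding Delta_section_def using that by (rule Least_le)
  have "\<sigma> 0 = 0"
  proof -
    obtain i where "\<sigma> i = 0" using ex[of 0] by auto
    thus ?thesis using Delta_mono[OF \<sigma>H, of 0 i] by simp
  qed
  thus "Delta_section \<sigma> k 0 = 0" using least[of 0 0] by simp
  show "Delta_section \<sigma> k (\<sigma> i) \<le> i" using least[of i "\<sigma> i"] Delta_le[OF \<sigma>H, of i] by simp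
  show "Delta_section \<sigma> k \<in> Hom Delta k n"
  proof (rule Delta_HomI)
    show "Delta_section \<sigma> k j \<le> n" for j using ex[of j] least order_trans by blast
    show "Delta_section \<sigma> k i = Delta_section \<sigma> k k" if "k \<le> i" for i
      using that by (simp add: Delta_section_def)
    show "Delta_section \<sigma> k i \<le> Delta_section \<sigma> k j" if ij: "i \<le> j" for i j
    proof (cases "min i k = min j k")
      case True thus ?thesis by (simp add: Delta_section_def)
    next
      case False
      show ?thesis
      proof (rule ccontr)
        assume "\<not> ?thesis"
        hence "\<sigma> (Delta_section \<sigma> k j) \<le> \<sigma> (Delta_section \<sigma> k i)" using Delta_mono[OF \<sigma>H] by simp
        thus False using eq False ij by simp
      qed
    qed
  qed
qed

lemma finite_Delta_Hom: "finite (Hom Delta m n)"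
proof -
  have "Hom Delta m n \<subseteq> (\<lambda>g i. g (min i m)) ` ({..m} \<rightarrow>\<^sub>E {..n})"
  proof
    fix f assume f: "f \<in> Hom Delta m n"
    have "f = (\<lambda>i. (restrict f {..m}) (min i m))" using Delta_const[OF f] by auto
    moreover have "restrict f {..m} \<in> {..m} \<rightarrow>\<^sub>E {..n}" using Delta_le[OF f] by auto
    ultimately show "f \<in> (\<lambda>g i. g (min i m)) ` ({..m} \<rightarrow>\<^sub>E {..n})" by blast
  qed
  thus ?thesis by (rule finite_subset) (simp add: finite_PiE)
qed

text \<open>The index set of the coproduct decomposition in degree \<open>n\<close>.\<close>

lemma finite_Delta_surj: "finite (SIGMA k:UNIV. Delta_surj n k)"
proof -
  have "(SIGMA k:UNIV. Delta_surj n k) \<subseteq> (SIGMA k:{..n}. Hom Delta n k)"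
    using Delta_surj_le Delta_surj_Hom by auto
  thus ?thesis by (rule finite_subset) (simp add: finite_Delta_Hom)
qed

section \<open>Normalised and degenerate elements\<close>

locale simplicial_object = abelian_category A + cat_functor "opposite Delta" A X
  for A :: "('o, 'a, 'z) addcat_scheme" (structure) and X :: "('o, 'a) simplicial_object"
begin

text \<open>The action of an operator \<open>[m] \<rightarrow> [n]\<close> on generalised elements of degree \<open>n\<close>.\<close>

definition pull :: "nat \<Rightarrow> nat \<Rightarrow> (nat \<Rightarrow> nat) \<Rightarrow> 'a \<Rightarrow> 'a" where
  "pull n m f x = Far X n m f \<cdot> x"

abbreviation El :: "'o \<Rightarrow> nat \<Rightarrow> 'a set" where "El T n \<equiv> Hom A T (Fob X n)"
abbreviation face_el :: "nat \<Rightarrow> nat \<Rightarrow> 'a \<Rightarrow> 'a" where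
  "face_el n j \<equiv> pull (Suc n) n (coface (Suc n) j)"
abbreviation degen_el :: "nat \<Rightarrow> nat \<Rightarrow> 'a \<Rightarrow> 'a" where
  "degen_el n i \<equiv> pull n (Suc n) (codegen n i)"
abbreviation zero_el :: "'o \<Rightarrow> nat \<Rightarrow> 'a" where "zero_el T n \<equiv> Zero A T (Fob X n)"
abbreviation add_el :: "'o \<Rightarrow> nat \<Rightarrow> 'a \<Rightarrow> 'a \<Rightarrow> 'a" where "add_el T n \<equiv> Add A T (Fob X n)"
abbreviation sub_el :: "'o \<Rightarrow> nat \<Rightarrow> 'a \<Rightarrow> 'a \<Rightarrow> 'a" where "sub_el T n \<equiv> Sub T (Fob X n)"

lemma X_Obj: "Fob X n \<in> Obj A"
  using Fob_Obj[of n] by simp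

lemma X_Hom: "f \<in> Hom Delta m n \<Longrightarrow> Far X n m f \<in> Hom A (Fob X n) (Fob X m)"
  using Far_Hom[of f n m] by simp

lemma X_comp:
  "f \<in> Hom Delta m n \<Longrightarrow> g \<in> Hom Delta l m \<Longrightarrow> Far X m l g \<cdot> Far X n m f = Far X n l (f \<circ> g)"
  using Far_Comp[of f n m g l] by simp

lemma pull_Hom:
  "x \<in> El T n \<Longrightarrow> f \<in> Hom Delta m n \<Longrightarrow> pull n m f x \<in> El T m"
  unfolding pull_def using Comp_Hom[OF _ X_Hom] .

lemma pull_pull:
  assumes "x \<in> El T n" "f \<in> Hom Delta m n" "g \<in> Hom Delta l m"
  shows "pull m l g (pull n m f x) = pull n l (f \<circ> g) x"
  unfolding pull_def using Comp_assoc[OF assms(1) X_Hom[OF assms(2)] X_Hom[OF assms(3)]]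
    X_comp[OF assms(2,3)] by simp

lemma pull_Id: "x \<in> El T n \<Longrightarrow> pull n n (Id Delta n) x = x"
  unfolding pull_def using Far_Id[of n] Id_Comp by simp

lemma pull_Comp:
  assumes "x \<in> El T n" "f \<in> Hom Delta m n" "t \<in> Hom A S T"
  shows "pull n m f x \<cdot> t = pull n m f (x \<cdot> t)"
  unfolding pull_def using Comp_assoc[OF assms(3,1) X_Hom[OF assms(2)]] .

lemma pull_Add:
  assumes "x \<in> El T n" "y \<in> El T n" "f \<in> Hom Delta m n"
  shows "pull n m f (add_el T n x y) = add_el T m (pull n m f x) (pull n m f y)"
  unfolding pull_def using Comp_Add[OF assms(1,2) X_Hom[OF assms(3)]] .

lemma pull_Sub:
  assumes "x \<in> El T n" "y \<in> El T n" "f \<in> Hom Delta m n"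
  shows "pull n m f (sub_el T n x y) = sub_el T m (pull n m f x) (pull n m f y)"
  unfolding pull_def using Comp_Sub[OF assms(1,2) X_Hom[OF assms(3)]] .

lemma pull_Neg:
  assumes "x \<in> El T n" "f \<in> Hom Delta m n"
  shows "pull n m f (Neg T (Fob X n) x) = Neg T (Fob X m) (pull n m f x)"
  unfolding pull_def using Comp_Neg[OF assms(1) X_Hom[OF assms(2)]] .

lemma pull_Zero: "T \<in> Obj A \<Longrightarrow> f \<in> Hom Delta m n \<Longrightarrow> pull n m f (zero_el T n) = zero_el T m"
  unfolding pull_def using Comp_Zero[OF X_Hom] .

definition normalized :: "'o \<Rightarrow> nat \<Rightarrow> 'a set" where
  "normalized T n = {x \<in> El T n.
     \<forall>j. 1 \<le> j \<and> j \<le> n \<longrightarrow> pull n (n - 1) (coface n j) x = zero_el T (n - 1)}"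

text \<open>All operators that lower the dimension are admitted, not only codegeneracies, so that reversing
  the order of the vertices visibly preserves the set.\<close>

inductive_set degenerate :: "'o \<Rightarrow> nat \<Rightarrow> 'a set" for T n where
  zero: "zero_el T n \<in> degenerate T n"
| add: "\<lbrakk>z \<in> degenerate T n; k < n; \<sigma> \<in> Hom Delta n k; y \<in> El T k\<rbrakk>
    \<Longrightarrow> add_el T n z (pull k n \<sigma> y) \<in> degenerate T n"

lemma normalized_Hom: "x \<in> normalized T n \<Longrightarrow> x \<in> El T n"
  by (simp add: normalized_def)

lemma normalized_face:
  assumes "x \<in> normalized T (Suc n)" "1 \<le> j" "j \<le> Suc n"
  shows "face_el n j x = zero_el T n"
proof -
  have "\<forall>j. 1 \<le> j \<and> j \<le> Suc n \<longrightarrow> pull (Suc n) (Suc n - 1) (coface (Suc n) j) x = zero_el T (Suc n - 1)"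
    using assms(1) unfolding normalized_def by blast
  from this[rule_format, of j] assms(2,3) show ?thesis by simp
qed

lemma normalizedI:
  assumes "x \<in> El T n"
    and "\<And>n' j. n = Suc n' \<Longrightarrow> 1 \<le> j \<Longrightarrow> j \<le> n \<Longrightarrow> face_el n' j x = zero_el T n'"
  shows "x \<in> normalized T n"
proof -
  have "pull n (n - 1) (coface n j) x = zero_el T (n - 1)" if "1 \<le> j \<and> j \<le> n" for j
    using assms(2)[of "n - 1" j] that by (cases n) auto
  thus ?thesis unfolding normalized_def using assms(1) by blast
qed

lemma normalized_Comp:
  assumes x: "x \<in> normalized T n" and t: "t \<in> Hom A S T" shows "x \<cdot> t \<in> normalized S n"
proof (rule normalizedI)
  show "x \<cdot> t \<in> El S n" using Comp_Hom[OF t normalized_Hom[OF x]] .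
  fix n' j assume n: "n = Suc n'" and j: "1 \<le> j" "j \<le> n"
  show "face_el n' j (x \<cdot> t) = zero_el S n'"
    using pull_Comp[OF normalized_Hom[OF x] _ t, of "coface n j" n'] coface_Hom[of j n'] n j
      normalized_face[of x T n' j] x Zero_Comp[OF t X_Obj] by simp
qed

lemma normalized_Sub:
  assumes x: "x \<in> normalized T n" and y: "y \<in> normalized T n"
  shows "sub_el T n x y \<in> normalized T n"
proof (rule normalizedI)
  note h = normalized_Hom[OF x] normalized_Hom[OF y]
  show "sub_el T n x y \<in> El T n" using Sub_Hom[OF h] .
  fix n' j assume n: "n = Suc n'" and j: "1 \<le> j" "j \<le> n"
  have "T \<in> Obj A" using Hom_Obj[OF h(1)] by simp
  thus "face_el n' j (sub_el T n x y) = zero_el T n'"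
    using pull_Sub[OF h, of "coface n j" n'] coface_Hom[of j n'] n j
      normalized_face[of x T n' j] normalized_face[of y T n' j] x y
      Sub_self[OF Zero_Hom[OF _ X_Obj]] by simp
qed

lemma degenerate_Hom:
  assumes "x \<in> degenerate T n" "T \<in> Obj A" shows "x \<in> El T n"
  using assms by induction (auto intro: Zero_Hom[OF _ X_Obj] Add_Hom pull_Hom)

lemma degenerate_pull:
  assumes "k < n" "\<sigma> \<in> Hom Delta n k" "y \<in> El T k"
  shows "pull k n \<sigma> y \<in> degenerate T n"
  using degenerate.add[OF degenerate.zero assms] Add_Zero(2)[OF pull_Hom[OF assms(3,2)]] by simp

lemma degenerate_Add:
  assumes x: "x \<in> degenerate T n" and y: "y \<in> degenerate T n" and T: "T \<in> Obj A"
  shows "add_el T n x y \<in> degenerate T n"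
  using y
proof induction
  case zero thus ?case using Add_Zero[OF degenerate_Hom[OF x T]] x by simp
next
  case (add z k \<sigma> y)
  show ?case
    using degenerate.add[OF add(5,2-4)]
      Add_assoc[OF degenerate_Hom[OF x T] degenerate_Hom[OF add(1) T] pull_Hom[OF add(4,3)]] by simp
qed

lemma degenerate_Neg:
  assumes x: "x \<in> degenerate T n" and T: "T \<in> Obj A"
  shows "Neg T (Fob X n) x \<in> degenerate T n"
  using x
proof induction
  case zero thus ?case using Neg_Zero[OF T X_Obj] degenerate.zero by simp
next
  case (add z k \<sigma> y)
  show ?case
    using degenerate.add[OF add(5,2,3) Neg_Hom[OF add(4)]] pull_Neg[OF add(4,3)]
      Neg_Add[OF degenerate_Hom[OF add(1) T] pull_Hom[OF add(4,3)]] by simp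
qed

lemma degenerate_Sub:
  "x \<in> degenerate T n \<Longrightarrow> y \<in> degenerate T n \<Longrightarrow> T \<in> Obj A \<Longrightarrow> sub_el T n x y \<in> degenerate T n"
  unfolding Sub_def by (intro degenerate_Add degenerate_Neg)

lemma degenerate_Comp:
  assumes x: "x \<in> degenerate T n" and t: "t \<in> Hom A S T" shows "x \<cdot> t \<in> degenerate S n"
  using x
proof induction
  case zero thus ?case using Zero_Comp[OF t X_Obj] degenerate.zero by simp
next
  case (add z k \<sigma> y)
  have T: "T \<in> Obj A" using Hom_Obj[OF t] by simp
  show ?case
    using degenerate.add[OF add(5,2,3) Comp_Hom[OF t add(4)]]
      Add_Comp[OF t degenerate_Hom[OF add(1) T] pull_Hom[OF add(4,3)]] pull_Comp[OF add(4,3) t]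
    by simp
qed

text \<open>Moore's filler. The faces are corrected in the order \<open>n + 1, n, \<dots>, 1\<close>: if \<open>x\<close> already has the faces
  above \<open>m\<close>, then adding \<open>s\<^bsub>m-1\<^esub> (y\<^sub>m - d\<^sub>m x)\<close> repairs the face \<open>m\<close>, and keeps a face \<open>j > m\<close> because
  \<open>d\<^sub>j s\<^bsub>m-1\<^esub> = s\<^bsub>m-1\<^esub> d\<^bsub>j-1\<^esub>\<close> and \<open>d\<^bsub>j-1\<^esub>\<close> kills the correction, by compatibility. Since the start is 0, the
  result is degenerate.\<close>

lemma horn_filler:
  assumes T: "T \<in> Obj A"
    and y: "\<And>j. 1 \<le> j \<Longrightarrow> j \<le> Suc n \<Longrightarrow> y j \<in> El T n"
    and match: "\<And>n' i j. n = Suc n' \<Longrightarrow> 1 \<le> i \<Longrightarrow> i < j \<Longrightarrow> j \<le> Suc n \<Longrightarrow>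
      face_el n' i (y j) = face_el n' (j - 1) (y i)"
  shows "\<exists>x \<in> degenerate T (Suc n). \<forall>j. 1 \<le> j \<and> j \<le> Suc n \<longrightarrow>
    face_el n j x = y j"
proof -
  let ?d = "\<lambda>j. face_el n j"
  have "k \<le> Suc n \<Longrightarrow> \<exists>x \<in> degenerate T (Suc n). \<forall>j. Suc n - k < j \<and> j \<le> Suc n \<longrightarrow> ?d j x = y j" for k
  proof (induction k)
    case 0 show ?case using degenerate.zero by (intro bexI[of _ "zero_el T (Suc n)"]) auto
  next
    case (Suc k)
    then obtain x where x: "x \<in> degenerate T (Suc n)"
        and xy: "\<And>j. Suc n - k < j \<Longrightarrow> j \<le> Suc n \<Longrightarrow> ?d j x = y j" by auto
    \<comment> \<open>The next face to be corrected.\<close>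
    define m where "m = Suc n - k"
    have m: "1 \<le> m" "m \<le> Suc n" using Suc(2) unfolding m_def by auto
    have xH: "x \<in> El T (Suc n)" using degenerate_Hom[OF x T] .
    have dx: "?d j x \<in> El T n" if "j \<le> Suc n" for j
      using pull_Hom[OF xH coface_Hom[OF that]] .
    define u where "u = sub_el T n (y m) (?d m x)"
    have u: "u \<in> El T n" unfolding u_def using Sub_Hom[OF y[OF m] dx[OF m(2)]] .
    have sH: "codegen n (m - 1) \<in> Hom Delta (Suc n) n" using codegen_Hom m by simp
    define s where "s = degen_el n (m - 1) u"
    have s: "s \<in> El T (Suc n)" unfolding s_def using pull_Hom[OF u sH] .
    have ds: "?d j s = pull n n (codegen n (m - 1) \<circ> coface (Suc n) j) u" if "j \<le> Suc n" for j
      unfolding s_def using pull_pull[OF u sH coface_Hom[OF that]] .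
    have dadd: "?d j (add_el T (Suc n) x s) = add_el T n (?d j x) (?d j s)" if "j \<le> Suc n" for j
      using pull_Add[OF xH s coface_Hom[OF that]] .
    have "?d j (add_el T (Suc n) x s) = y j" if j: "Suc n - Suc k < j" "j \<le> Suc n" for j
    proof (cases "j = m")
      case True
      have "codegen n (m - 1) \<circ> coface (Suc n) m = Id Delta n" using codegen_coface_Id m by simp
      hence "?d m s = u" using ds[OF m(2)] pull_Id[OF u] by simp
      thus ?thesis unfolding True using dadd[OF m(2)] Add_Sub[OF y[OF m] dx[OF m(2)]]
        by (simp add: u_def)
    next
      case False
      hence mj: "m < j" using j unfolding m_def by simp
      then obtain n' where n: "n = Suc n'" using m j by (cases n) auto
      have xj: "?d j x = y j" using xy[of j] mj j unfolding m_def by simp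
      have cH: "coface (Suc n') (j - 1) \<in> Hom Delta n' (Suc n')" "coface (Suc n') m \<in> Hom Delta n' (Suc n')"
        using coface_Hom[of "j - 1" n'] coface_Hom[of m n'] mj j n by auto
      have "pull n n' (coface n (j - 1)) u
          = sub_el T n' (pull n n' (coface n (j - 1)) (y m)) (pull n n' (coface n (j - 1)) (?d m x))"
        unfolding u_def using pull_Sub[OF y[OF m] dx[OF m(2)]] cH n by simp
      also have "pull n n' (coface n (j - 1)) (?d m x) = pull n n' (coface n m) (?d j x)"
        using pull_pull[OF xH coface_Hom[OF m(2)], of "coface n (j - 1)" n']
          pull_pull[OF xH coface_Hom[OF j(2)], of "coface n m" n']
          coface_coface[of m j n'] mj j cH n by simp
      also have "\<dots> = pull n n' (coface n (j - 1)) (y m)"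
        unfolding xj using match[of n' m j] n m mj j by simp
      also have "sub_el T n' (pull n n' (coface n (j - 1)) (y m)) (pull n n' (coface n (j - 1)) (y m))
          = zero_el T n'"
        using Sub_self[OF pull_Hom[OF y[OF m]]] cH n by simp
      finally have 0: "pull n n' (coface n (j - 1)) u = zero_el T n'" .
      have cod: "codegen n' (m - 1) \<in> Hom Delta (Suc n') n'" using codegen_Hom[of "m - 1" n'] mj j n by simp
      have "?d j s = pull n' n (codegen n' (m - 1)) (pull n n' (coface n (j - 1)) u)"
        using ds[OF j(2)] codegen_coface[of "m - 1" j n'] m mj j n
          pull_pull[OF u, of "coface n (j - 1)" n' "codegen n' (m - 1)" n] cH cod by simp
      hence "?d j s = zero_el T n" using 0 pull_Zero[OF T cod] n by simp
      thus ?thesis using dadd[OF j(2)] xj Add_Zero[OF y[of j]] m mj j by simp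
    qed
    moreover have "add_el T (Suc n) x s \<in> degenerate T (Suc n)"
      unfolding s_def using degenerate.add[OF x _ sH u] by simp
    ultimately show ?case by blast
  qed
  from this[of "Suc n"] show ?thesis by (simp add: Suc_le_eq)
qed

text \<open>Sums of degeneracies \<open>s\<^sub>i\<close> with \<open>i < k\<close>, each occurring once. This filtration of the degenerate elements
  is the induction measure for their disjointness from the normalised ones.\<close>

primrec ordered_degenerate :: "'o \<Rightarrow> nat \<Rightarrow> nat \<Rightarrow> 'a set" where
  "ordered_degenerate T n 0 = {zero_el T (Suc n)}"
| "ordered_degenerate T n (Suc k) = {add_el T (Suc n) z (degen_el n k y) | z y.
     z \<in> ordered_degenerate T n k \<and> y \<in> El T n}"

lemma ordered_degenerate_Hom:
  assumes T: "T \<in> Obj A" shows "k \<le> Suc n \<Longrightarrow> x \<in> ordered_degenerate T n k \<Longrightarrow> x \<in> El T (Suc n)"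
  by (induction k arbitrary: x)
    (auto intro!: Zero_Hom[OF T X_Obj] Add_Hom pull_Hom codegen_Hom)

lemma ordered_degenerate_zero:
  assumes T: "T \<in> Obj A" shows "k \<le> Suc n \<Longrightarrow> zero_el T (Suc n) \<in> ordered_degenerate T n k"
proof (induction k)
  case (Suc k)
  have "zero_el T (Suc n) = add_el T (Suc n) (zero_el T (Suc n)) (degen_el n k (zero_el T n))"
    using pull_Zero[OF T codegen_Hom] Suc Add_Zero[OF Zero_Hom[OF T X_Obj]] by simp
  moreover have "zero_el T n \<in> El T n" using Zero_Hom[OF T X_Obj] .
  ultimately show ?case using Suc by auto
qed simp

lemma ordered_degenerate_add:
  assumes T: "T \<in> Obj A" and y: "y \<in> El T n"
  shows "k \<le> Suc n \<Longrightarrow> i < k \<Longrightarrow> z \<in> ordered_degenerate T n k \<Longrightarrow>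
    add_el T (Suc n) z (degen_el n i y) \<in> ordered_degenerate T n k"
proof (induction k arbitrary: z)
  case (Suc k)
  from Suc(4) obtain z' w where z: "z = add_el T (Suc n) z' (degen_el n k w)"
      and z': "z' \<in> ordered_degenerate T n k" and w: "w \<in> El T n" by auto
  have k: "k \<le> n" "i \<le> n" using Suc by auto
  have z'H: "z' \<in> El T (Suc n)" using ordered_degenerate_Hom[OF T _ z'] Suc by simp
  note sw = pull_Hom[OF w codegen_Hom[OF k(1)]] and sy = pull_Hom[OF y codegen_Hom[OF k(2)]]
  show ?case
  proof (cases "i = k")
    case True
    have "add_el T (Suc n) z (degen_el n i y)
        = add_el T (Suc n) z' (degen_el n k (add_el T n w y))"
      unfolding z True using Add_assoc[OF z'H sw sy] pull_Add[OF w y codegen_Hom[OF k(1)]] True by simp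
    thus ?thesis using z' Add_Hom[OF w y] by auto
  next
    case False
    have "add_el T (Suc n) z (degen_el n i y)
        = add_el T (Suc n) (add_el T (Suc n) z' (degen_el n i y)) (degen_el n k w)"
      unfolding z using Add_assoc[OF z'H sw sy] Add_assoc[OF z'H sy sw] Add_commute[OF sw sy] by simp
    moreover have "add_el T (Suc n) z' (degen_el n i y) \<in> ordered_degenerate T n k"
      using Suc.IH[OF _ _ z'] Suc(2,3) False by simp
    ultimately show ?thesis using w by auto
  qed
qed simp

text \<open>An operator that lowers the dimension is constant on two consecutive vertices, hence factors through a
  codegeneracy.\<close>

lemma degenerate_ordered:
  assumes T: "T \<in> Obj A" and x: "x \<in> degenerate T (Suc n)"
  shows "x \<in> ordered_degenerate T n (Suc n)"
  using x
proof induction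
  case zero show ?case by (rule ordered_degenerate_zero[OF T]) simp
next
  case (add z k \<sigma> y)
  obtain i where i: "i \<le> n" "\<sigma> i = \<sigma> (Suc i)" using collapsing_step[OF add(3,2)] .
  have c: "coface (Suc n) (Suc i) \<in> Hom Delta n (Suc n)" using coface_Hom i by simp
  note \<tau> = Delta_comp[OF c add(3)]
  have "pull k (Suc n) \<sigma> y
      = degen_el n i (pull k n (\<sigma> \<circ> coface (Suc n) (Suc i)) y)"
    using pull_pull[OF add(4) \<tau> codegen_Hom[OF i(1)]] factor_codegen[OF add(3) i] by simp
  thus ?case using ordered_degenerate_add[OF T pull_Hom[OF add(4) \<tau>] _ _ add(5), of i] i by simp
qed

text \<open>For \<open>i < k\<close> the identities \<open>d\<^bsub>k+1\<^esub> s\<^sub>i = s\<^sub>i d\<^sub>k\<close> and \<open>s\<^sub>k s\<^sub>i = s\<^sub>i s\<^bsub>k-1\<^esub>\<close> move \<open>s\<^sub>i\<close> to the left of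
  \<open>s\<^sub>k d\<^bsub>k+1\<^esub>\<close>, so \<open>1 - s\<^sub>k d\<^bsub>k+1\<^esub>\<close> preserves each stage of the filtration up to \<open>k\<close>.\<close>

lemma ordered_degenerate_step:
  assumes T: "T \<in> Obj A" and k: "k \<le> n"
  shows "i \<le> k \<Longrightarrow> z \<in> ordered_degenerate T n i \<Longrightarrow>
    sub_el T (Suc n) z (degen_el n k (face_el n (Suc k) z))
      \<in> ordered_degenerate T n i"
proof (induction i arbitrary: z)
  case 0
  have z: "z = zero_el T (Suc n)" using 0 by simp
  have c: "coface (Suc n) (Suc k) \<in> Hom Delta n (Suc n)" using coface_Hom k by simp
  show ?case unfolding z using pull_Zero[OF T c] pull_Zero[OF T codegen_Hom[OF k]]
      Sub_self[OF Zero_Hom[OF T X_Obj]] by simp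
next
  case (Suc i)
  let ?d = "face_el n (Suc k)" and ?s = "\<lambda>i. degen_el n i"
  from Suc(3) obtain z' y where z: "z = add_el T (Suc n) z' (?s i y)"
      and z': "z' \<in> ordered_degenerate T n i" and y: "y \<in> El T n" by auto
  have i: "i < k" "i \<le> n" using Suc k by auto
  then obtain n' where n: "n = Suc n'" using k by (cases n) auto
  have c: "coface (Suc n) (Suc k) \<in> Hom Delta n (Suc n)" using coface_Hom k by simp
  have c': "coface (Suc n') k \<in> Hom Delta n' (Suc n')" using coface_Hom k n by simp
  have z'H: "z' \<in> El T (Suc n)" using ordered_degenerate_Hom[OF T _ z'] i by simp
  have sy: "?s i y \<in> El T (Suc n)" using pull_Hom[OF y codegen_Hom[OF i(2)]] .
  define v where "v = pull n' n (codegen n' (k - 1)) (pull n n' (coface n k) y)"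
  have co: "codegen n' i \<in> Hom Delta (Suc n') n'" "codegen n' (k - 1) \<in> Hom Delta (Suc n') n'"
    using codegen_Hom i k n by auto
  have dy: "pull n n' (coface n k) y \<in> El T n'" using pull_Hom[OF y] c' n by simp
  have v: "v \<in> El T n" unfolding v_def using pull_Hom[OF dy] co n by simp
  have "?d (?s i y) = pull n' n (codegen n' i) (pull n n' (coface n k) y)"
    using pull_pull[OF y codegen_Hom[OF i(2)] c] codegen_coface[of i "Suc k" n'] i k n
      pull_pull[OF y, of "coface n k" n' "codegen n' i" n] c' co by simp
  hence "?s k (?d (?s i y)) = pull n' (Suc n) (codegen n' i \<circ> codegen n k) (pull n n' (coface n k) y)"
    using pull_pull[OF dy, of "codegen n' i" n "codegen n k" "Suc n"] co codegen_Hom[OF k] n by simp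
  also have "\<dots> = ?s i v"
    unfolding v_def using pull_pull[OF dy, of "codegen n' (k - 1)" n "codegen n i" "Suc n"] co
      codegen_Hom[OF i(2)] n codegen_codegen[of i k n'] i k by simp
  finally have R: "?s k (?d (?s i y)) = ?s i v" .
  have dz': "?d z' \<in> El T n" and dsy: "?d (?s i y) \<in> El T n"
    using pull_Hom[OF z'H c] pull_Hom[OF sy c] .
  have "?s k (?d z) = add_el T (Suc n) (?s k (?d z')) (?s i v)"
    unfolding z using pull_Add[OF z'H sy c] pull_Add[OF dz' dsy codegen_Hom[OF k]] R by simp
  hence "sub_el T (Suc n) z (?s k (?d z))
      = add_el T (Suc n) (sub_el T (Suc n) z' (?s k (?d z'))) (?s i (sub_el T n y v))"
    unfolding z using Sub_Add_Add[OF z'H sy pull_Hom[OF dz' codegen_Hom[OF k]] pull_Hom[OF v codegen_Hom[OF i(2)]]]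
      pull_Sub[OF y v codegen_Hom[OF i(2)]] by simp
  thus ?case using Suc.IH[OF _ z'] Suc(2) Sub_Hom[OF y v] by auto
qed

text \<open>Let \<open>x = z + s\<^sub>k y\<close>, with \<open>z\<close> in stage \<open>k\<close> of the filtration, be normalised. Applying \<open>d\<^bsub>k+1\<^esub>\<close> gives
  \<open>0 = d\<^bsub>k+1\<^esub> z + y\<close>. Substituting for \<open>y\<close> turns \<open>x\<close> into \<open>z - s\<^sub>k d\<^bsub>k+1\<^esub> z\<close>, which is again in stage \<open>k\<close>. So the
  stage can be lowered to 0.\<close>

lemma normalized_degenerate_zero:
  assumes c: "x \<in> normalized T n" and d: "x \<in> degenerate T n" shows "x = zero_el T n"
proof (cases n)
  case 0
  show ?thesis using d unfolding 0 by cases auto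
next
  case n: (Suc m)
  have T: "T \<in> Obj A" using Hom_Obj[OF normalized_Hom[OF c]] by simp
  have "k \<le> Suc m \<Longrightarrow> x \<in> ordered_degenerate T m k \<Longrightarrow> x = zero_el T (Suc m)" for k
  proof (induction k)
    case (Suc k)
    let ?d = "face_el m (Suc k)" and ?s = "degen_el m k"
    from Suc(3) obtain z y where x: "x = add_el T (Suc m) z (?s y)"
        and z: "z \<in> ordered_degenerate T m k" and y: "y \<in> El T m" by auto
    have k: "k \<le> m" using Suc by simp
    have cH: "coface (Suc m) (Suc k) \<in> Hom Delta m (Suc m)" using coface_Hom k by simp
    have zH: "z \<in> El T (Suc m)" using ordered_degenerate_Hom[OF T _ z] k by simp
    note sy = pull_Hom[OF y codegen_Hom[OF k]] and dz = pull_Hom[OF zH cH]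
    have "?d (?s y) = y"
      using pull_pull[OF y codegen_Hom[OF k] cH] codegen_coface_Id[of "Suc k" k m] k pull_Id[OF y] by simp
    hence "zero_el T m = add_el T m (?d z) y"
      using normalized_face[of x T m "Suc k"] c n k pull_Add[OF zH sy cH] x by simp
    hence "y = Neg T (Fob X m) (?d z)" using Neg_unique[OF dz y] by simp
    hence "x = sub_el T (Suc m) z (?s (?d z))"
      unfolding x Sub_def using pull_Neg[OF dz codegen_Hom[OF k]] by simp
    hence "x \<in> ordered_degenerate T m k" using ordered_degenerate_step[OF T k _ z] by simp
    thus ?case using Suc by simp
  qed simp
  from this[of "Suc m"] degenerate_ordered[OF T, of x m] d n show ?thesis by simp
qed

text \<open>The faces \<open>d\<^sub>1 x, \<dots>, d\<^sub>n x\<close> form a horn; \<open>x\<close> minus its degenerate filler is normalised.\<close>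

lemma normalized_degenerate_decomposition:
  assumes x: "x \<in> El T n"
  shows "\<exists>c \<in> normalized T n. \<exists>z \<in> degenerate T n. x = add_el T n c z"
proof (cases n)
  case 0
  have "x \<in> normalized T n" using x 0 by (auto simp: normalized_def)
  thus ?thesis using degenerate.zero Add_Zero(1)[OF x] by metis
next
  case (Suc m)
  have T: "T \<in> Obj A" using Hom_Obj[OF x] by simp
  let ?d = "\<lambda>j. face_el m j"
  have xS: "x \<in> El T (Suc m)" using x Suc by simp
  have "\<exists>z \<in> degenerate T (Suc m). \<forall>j. 1 \<le> j \<and> j \<le> Suc m \<longrightarrow> ?d j z = ?d j x"
  proof (rule horn_filler[OF T])
    show "?d j x \<in> El T m" if "1 \<le> j" "j \<le> Suc m" for j
      using pull_Hom[OF xS coface_Hom] that by blast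
    show "face_el n' i (?d j x) = face_el n' (j - 1) (?d i x)"
      if m: "m = Suc n'" and ij: "1 \<le> i" "i < j" "j \<le> Suc m" for n' i j
      using pull_pull[OF xS coface_Hom[of j m], of "coface m i" n']
        pull_pull[OF xS coface_Hom[of i m], of "coface m (j - 1)" n']
        coface_coface[of i j n'] coface_Hom[of i n'] coface_Hom[of "j - 1" n'] m ij by simp
  qed
  then obtain z where z: "z \<in> degenerate T (Suc m)"
      and zx: "\<And>j. 1 \<le> j \<Longrightarrow> j \<le> Suc m \<Longrightarrow> ?d j z = ?d j x" by blast
  have zH: "z \<in> El T (Suc m)" using degenerate_Hom[OF z T] .
  let ?c = "sub_el T (Suc m) x z"
  have "?c \<in> normalized T (Suc m)"
  proof (rule normalizedI)
    show "?c \<in> El T (Suc m)" using Sub_Hom[OF xS zH] .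
    show "face_el n' j ?c = zero_el T n'"
      if "Suc m = Suc n'" "1 \<le> j" "j \<le> Suc m" for n' j
      using pull_Sub[OF xS zH coface_Hom[of j m]] zx[of j] Sub_self[OF pull_Hom[OF xS coface_Hom[of j m]]] that
      by simp
  qed
  moreover have "x = add_el T (Suc m) ?c z"
    using Add_Sub[OF xS zH] Add_commute[OF Sub_Hom[OF xS zH] zH] by simp
  ultimately show ?thesis using z Suc by blast
qed

text \<open>The normalised part of the universal element, the identity of \<open>X\<^sub>n\<close>. Composing with it extracts the
  normalised part of any element.\<close>

definition normal_proj :: "nat \<Rightarrow> 'a" where
  "normal_proj n = (SOME p. p \<in> normalized (Fob X n) n \<and>
     (\<exists>z \<in> degenerate (Fob X n) n. Id A (Fob X n) = add_el (Fob X n) n p z))"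

lemma normal_proj:
  shows normal_proj_normalized: "normal_proj n \<in> normalized (Fob X n) n"
    and normal_proj_complement:
      "\<exists>z \<in> degenerate (Fob X n) n. Id A (Fob X n) = add_el (Fob X n) n (normal_proj n) z"
proof -
  have "\<exists>p. p \<in> normalized (Fob X n) n \<and>
     (\<exists>z \<in> degenerate (Fob X n) n. Id A (Fob X n) = add_el (Fob X n) n p z)"
    using normalized_degenerate_decomposition[OF Id_Hom[OF X_Obj]] by blast
  from someI_ex[OF this] show "normal_proj n \<in> normalized (Fob X n) n"
    "\<exists>z \<in> degenerate (Fob X n) n. Id A (Fob X n) = add_el (Fob X n) n (normal_proj n) z"
    unfolding normal_proj_def by blast+
qed

lemma normal_proj_Hom: "normal_proj n \<in> Hom A (Fob X n) (Fob X n)"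
  using normalized_Hom[OF normal_proj_normalized] .

lemma normal_proj_Sub:
  assumes x: "x \<in> El T n"
  shows "sub_el T n x (normal_proj n \<cdot> x) \<in> degenerate T n"
proof -
  obtain z where z: "z \<in> degenerate (Fob X n) n"
      "Id A (Fob X n) = add_el (Fob X n) n (normal_proj n) z"
    using normal_proj_complement by blast
  have zH: "z \<in> Hom A (Fob X n) (Fob X n)" using degenerate_Hom[OF z(1) X_Obj] .
  have xe: "x = add_el T n (normal_proj n \<cdot> x) (z \<cdot> x)"
    using Id_Comp[OF x] z(2) Add_Comp[OF x normal_proj_Hom zH] by simp
  have px: "normal_proj n \<cdot> x \<in> El T n" "z \<cdot> x \<in> El T n"
    using Comp_Hom[OF x normal_proj_Hom] Comp_Hom[OF x zH] .
  have "sub_el T n x (normal_proj n \<cdot> x) = z \<cdot> x"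
    using Sub_Add_cancel[OF px] xe by simp
  thus ?thesis using degenerate_Comp[OF z(1) x] by simp
qed

lemma normal_proj_normalized_id:
  assumes c: "c \<in> normalized T n" shows "normal_proj n \<cdot> c = c"
proof -
  note cH = normalized_Hom[OF c]
  have pc: "normal_proj n \<cdot> c \<in> normalized T n" using normalized_Comp[OF normal_proj_normalized cH] .
  have "sub_el T n c (normal_proj n \<cdot> c) = zero_el T n"
    using normalized_degenerate_zero[OF normalized_Sub[OF c pc] normal_proj_Sub[OF cH]] .
  thus ?thesis using Sub_eq_Zero[OF cH normalized_Hom[OF pc]] by simp
qed

text \<open>The element \<open>p z = z - (z - p z)\<close> is normalised, and it is a difference of two degenerate elements.\<close>

lemma normal_proj_degenerate:
  assumes z: "z \<in> degenerate T n" and T: "T \<in> Obj A" shows "normal_proj n \<cdot> z = zero_el T n"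
proof -
  note zH = degenerate_Hom[OF z T]
  have pz: "normal_proj n \<cdot> z \<in> normalized T n" using normalized_Comp[OF normal_proj_normalized zH] .
  note pzH = normalized_Hom[OF pz]
  note s = normal_proj_Sub[OF zH]
  have "sub_el T n z (sub_el T n z (normal_proj n \<cdot> z)) \<in> degenerate T n"
    using degenerate_Sub[OF z s T] .
  moreover have "sub_el T n z (sub_el T n z (normal_proj n \<cdot> z)) = normal_proj n \<cdot> z"
    using Sub_Add_cancel[OF Sub_Hom[OF zH pzH] pzH] Add_Sub[OF zH pzH]
      Add_commute[OF pzH Sub_Hom[OF zH pzH]] by simp
  ultimately show ?thesis using normalized_degenerate_zero[OF pz] by simp
qed

end

section \<open>The normalised Moore complex as a functor\<close>

context simplicial_object
begin

lemma kernel_face_factor: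
  assumes x: "x \<in> El T n" and j: "1 \<le> j" "j \<le> n"
    and k: "kernel A (Fob X n) (Fob X (n - 1)) (face X n j) = (U, u)"
  shows "(\<exists>s \<in> Hom A T U. u \<cdot> s = x) \<longleftrightarrow> pull n (n - 1) (coface n j) x = zero_el T (n - 1)"
proof -
  obtain m where n: "n = Suc m" using j by (cases n) auto
  have d: "face X n j \<in> Hom A (Fob X n) (Fob X (n - 1))"
    unfolding face_def using X_Hom[OF coface_Hom[of j m]] j n by simp
  have ker: "is_kernel A (Fob X n) (Fob X (n - 1)) (face X n j) U u"
    using kernel_is_kernel[OF d] k by simp
  hence u: "u \<in> El U n" "face X n j \<cdot> u = Zero A U (Fob X (n - 1))"
    unfolding is_kernel_def by blast+
  show ?thesis
  proof
    assume "\<exists>s \<in> Hom A T U. u \<cdot> s = x"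
    then obtain s where s: "s \<in> Hom A T U" "u \<cdot> s = x" by blast
    show "pull n (n - 1) (coface n j) x = zero_el T (n - 1)"
      unfolding pull_def using s u Comp_assoc[OF s(1) u(1) d] Zero_Comp[OF s(1) X_Obj]
      by (simp add: face_def)
  next
    assume "pull n (n - 1) (coface n j) x = zero_el T (n - 1)"
    thus "\<exists>s \<in> Hom A T U. u \<cdot> s = x"
      using ker x unfolding is_kernel_def pull_def face_def by blast
  qed
qed

lemma factors_through_kernels_iff:
  assumes x: "x \<in> El T n"
  shows "(\<forall>(U, u) \<in> (\<lambda>i. kernel A (Fob X n) (Fob X (n - 1)) (face X n i)) ` {1..n}.
      \<exists>s \<in> Hom A T U. u \<cdot> s = x) \<longleftrightarrow> x \<in> normalized T n"
proof -
  have "(case kernel A (Fob X n) (Fob X (n - 1)) (face X n i) of (U, u) \<Rightarrow> \<exists>s \<in> Hom A T U. u \<cdot> s = x)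
      \<longleftrightarrow> pull n (n - 1) (coface n i) x = zero_el T (n - 1)" if "i \<in> {1..n}" for i
    using kernel_face_factor[OF x, of i] that
    by (cases "kernel A (Fob X n) (Fob X (n - 1)) (face X n i)") simp
  thus ?thesis using x by (auto simp: normalized_def)
qed

text \<open>The intersection of the kernels of the faces is the kernel of \<open>1 - p\<close>, where \<open>p\<close> projects to the
  normalised part: an element is normalised exactly if \<open>p\<close> fixes it. This also covers the empty intersection
  in degree 0, where \<open>p\<close> is the identity.\<close>

lemma moore_intersection:
  "is_intersection A (Fob X n)
     ((\<lambda>i. kernel A (Fob X n) (Fob X (n - 1)) (face X n i)) ` {1..n}) (moore_ob A X n) (moore_incl A X n)"
proof -
  let ?p = "normal_proj n" and ?x = "Fob X n"
  let ?q = "Sub ?x ?x (Id A ?x) ?p"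
  have q: "?q \<in> Hom A ?x ?x" using Sub_Hom[OF Id_Hom[OF X_Obj] normal_proj_Hom] .
  have qx: "?q \<cdot> x = sub_el T n x (?p \<cdot> x)" if "x \<in> Hom A T ?x" for x T
    using Sub_Comp[OF that Id_Hom[OF X_Obj] normal_proj_Hom] Id_Comp[OF that] by simp
  obtain K k where ker: "is_kernel A ?x ?x ?q K k" using ex_kernel[OF q] by blast
  hence k: "k \<in> Hom A K ?x" "?q \<cdot> k = Zero A K ?x" unfolding is_kernel_def by blast+
  have "k = ?p \<cdot> k" using Sub_eq_Zero[OF k(1) Comp_Hom[OF k(1) normal_proj_Hom]] qx[OF k(1)] k(2) by simp
  hence kn: "k \<in> normalized K n" using normalized_Comp[OF normal_proj_normalized k(1)] by simp
  have "\<exists>!v. v \<in> Hom A t K \<and> k \<cdot> v = g" if "g \<in> normalized t n" for t g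
  proof -
    note g = normalized_Hom[OF that]
    have "?q \<cdot> g = Zero A t ?x" using qx[OF g] normal_proj_normalized_id[OF that] Sub_self[OF g] by simp
    thus ?thesis using ker g unfolding is_kernel_def by blast
  qed
  hence "is_intersection A ?x ((\<lambda>i. kernel A ?x (Fob X (n - 1)) (face X n i)) ` {1..n}) K k"
    unfolding is_intersection_def
    using k(1) kn factors_through_kernels_iff[OF k(1)] factors_through_kernels_iff[of _ _ n] by simp
  thus ?thesis unfolding moore_sub_def intersection_def by (rule some_pair)
qed

abbreviation moore_X :: "nat \<Rightarrow> 'o" where "moore_X n \<equiv> moore_ob A X n"
abbreviation incl :: "nat \<Rightarrow> 'a" where "incl n \<equiv> moore_incl A X n"

lemma incl_normalized: "incl n \<in> normalized (moore_X n) n"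
  using moore_intersection[of n] factors_through_kernels_iff[of "incl n" "moore_X n" n]
  unfolding is_intersection_def by blast

lemma incl_Hom: "incl n \<in> Hom A (moore_X n) (Fob X n)"
  using normalized_Hom[OF incl_normalized] .

lemma moore_Obj: "moore_X n \<in> Obj A"
  using Hom_Obj[OF incl_Hom] by blast

text \<open>The Moore object represents normalised elements. Together with \<open>incl_normalized\<close> this is all that is
  used about it from here on.\<close>

lemma normalized_factor: "x \<in> normalized T n \<Longrightarrow> \<exists>!v. v \<in> Hom A T (moore_X n) \<and> incl n \<cdot> v = x"
  using moore_intersection[of n] factors_through_kernels_iff[of x T n] normalized_Hom[of x T n]
  unfolding is_intersection_def by blast

lemma incl_monic:
  assumes "v \<in> Hom A T (moore_X n)" "w \<in> Hom A T (moore_X n)" "incl n \<cdot> v = incl n \<cdot> w"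
  shows "v = w"
  using normalized_factor[OF normalized_Comp[OF incl_normalized assms(1)]] assms by metis

lemma normalized_d0:
  assumes x: "x \<in> normalized T (Suc n)"
  shows "face_el n 0 x \<in> normalized T n"
proof (rule normalizedI)
  note xH = normalized_Hom[OF x]
  have T: "T \<in> Obj A" using Hom_Obj[OF xH] by simp
  have c0: "coface (Suc n) 0 \<in> Hom Delta n (Suc n)" using coface_Hom by simp
  show "face_el n 0 x \<in> El T n" using pull_Hom[OF xH c0] .
  fix m j assume n: "n = Suc m" and j: "1 \<le> j" "j \<le> n"
  have c: "coface (Suc m) j \<in> Hom Delta m (Suc m)" "coface (Suc m) 0 \<in> Hom Delta m (Suc m)"
    "coface (Suc (Suc m)) (Suc j) \<in> Hom Delta (Suc m) (Suc (Suc m))"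
    using coface_Hom[of j m] coface_Hom[of 0 m] coface_Hom[of "Suc j" "Suc m"] j n by auto
  have "face_el m j (face_el n 0 x)
      = face_el m 0 (face_el n (Suc j) x)"
    using pull_pull[OF xH c0, of "coface (Suc m) j" m] pull_pull[OF xH, of "coface (Suc n) (Suc j)" n "coface (Suc m) 0" m]
      coface_coface[of 0 "Suc j" m] c n j by simp
  also have "\<dots> = zero_el T m"
    using normalized_face[OF x, of "Suc j"] j n pull_Zero[OF T c(2)] by simp
  finally show "face_el m j (face_el n 0 x) = zero_el T m" .
qed

lemma moore_diff:
  shows moore_diff_Hom: "moore_diff A X n \<in> Hom A (moore_X (Suc n)) (moore_X n)"
    and incl_moore_diff: "incl n \<cdot> moore_diff A X n = face_el n 0 (incl (Suc n))"
  using theI'[OF normalized_factor[OF normalized_d0[OF incl_normalized]], of n]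
  unfolding moore_diff_def pull_def face_def by simp_all

lemma moore_is_chain_complex: "is_chain_complex A (Fob (moore A) X)"
proof -
  have "moore_diff A X n \<cdot> moore_diff A X (Suc n) = Zero A (moore_X (Suc (Suc n))) (moore_X n)" for n
  proof (rule incl_monic)
    let ?d = "moore_diff A X"
    show "?d n \<cdot> ?d (Suc n) \<in> Hom A (moore_X (Suc (Suc n))) (moore_X n)"
      using Comp_Hom[OF moore_diff_Hom moore_diff_Hom] .
    show "Zero A (moore_X (Suc (Suc n))) (moore_X n) \<in> Hom A (moore_X (Suc (Suc n))) (moore_X n)"
      using Zero_Hom[OF moore_Obj moore_Obj] .
    have c: "coface (Suc n) 0 \<in> Hom Delta n (Suc n)"
      "coface (Suc (Suc n)) 0 \<in> Hom Delta (Suc n) (Suc (Suc n))"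
      "coface (Suc (Suc n)) 1 \<in> Hom Delta (Suc n) (Suc (Suc n))" using coface_Hom by auto
    have "incl n \<cdot> (?d n \<cdot> ?d (Suc n)) = face_el n 0 (incl (Suc n)) \<cdot> ?d (Suc n)"
      using Comp_assoc[OF moore_diff_Hom moore_diff_Hom incl_Hom] incl_moore_diff by simp
    also have "\<dots> = face_el n 0
        (pull (Suc (Suc n)) (Suc n) (coface (Suc (Suc n)) 0) (incl (Suc (Suc n))))"
      using pull_Comp[OF incl_Hom c(1) moore_diff_Hom] incl_moore_diff by simp
    also have "\<dots> = face_el n 0
        (pull (Suc (Suc n)) (Suc n) (coface (Suc (Suc n)) 1) (incl (Suc (Suc n))))"
      using pull_pull[OF incl_Hom c(2) c(1)] pull_pull[OF incl_Hom c(3) c(1)] coface_coface[of 0 1 n] by simp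
    also have "\<dots> = zero_el (moore_X (Suc (Suc n))) n"
      using normalized_face[OF incl_normalized, of 1 "Suc n"] pull_Zero[OF moore_Obj c(1)] by simp
    finally show "incl n \<cdot> (?d n \<cdot> ?d (Suc n)) = incl n \<cdot> Zero A (moore_X (Suc (Suc n))) (moore_X n)"
      using Comp_Zero[OF incl_Hom moore_Obj] by simp
  qed
  thus ?thesis unfolding is_chain_complex_def moore_def
    using moore_Obj moore_diff_Hom by simp
qed

lemma pull_miss_normalized:
  assumes x: "x \<in> normalized T k" and \<rho>: "\<rho> \<in> Hom Delta l k"
    and j: "1 \<le> j" "j \<le> k" "j \<notin> range \<rho>"
  shows "pull k l \<rho> x = zero_el T l"
proof -
  obtain k' where k: "k = Suc k'" using j by (cases k) auto
  obtain \<tau> where \<tau>: "\<tau> \<in> Hom Delta l k'" "\<rho> = coface (Suc k') j \<circ> \<tau>"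
    using factor_coface[of \<rho> l k' j] \<rho> j k by auto
  have T: "T \<in> Obj A" using Hom_Obj[OF normalized_Hom[OF x]] by simp
  have c: "coface (Suc k') j \<in> Hom Delta k' (Suc k')" using coface_Hom j k by simp
  have "pull k l \<rho> x = pull k' l \<tau> (face_el k' j x)"
    using pull_pull[of x T "Suc k'" "coface (Suc k') j" k' \<tau> l] normalized_Hom[OF x] c \<tau> k by simp
  thus ?thesis using normalized_face[of x T k' j] x k j pull_Zero[OF T \<tau>(1)] by simp
qed

end

lemma (in abelian_category) simplicial_object_Obj:
  "X \<in> Obj (simplicial_category A) \<Longrightarrow> simplicial_object A X"
  unfolding simplicial_category_def functor_category_def simplicial_object_def Let_def
  using abelian_category_axioms by simp

lemma (in abelian_category) simplicial_Hom_iff: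
  "f \<in> Hom (simplicial_category A) X X' \<longleftrightarrow>
     X \<in> Obj (simplicial_category A) \<and> X' \<in> Obj (simplicial_category A) \<and>
     (\<forall>n. f n \<in> Hom A (Fob X n) (Fob X' n)) \<and>
     (\<forall>m n. \<forall>\<alpha> \<in> Hom Delta m n. f m \<cdot> Far X n m \<alpha> = Far X' n m \<alpha> \<cdot> f n)"
  unfolding simplicial_category_def functor_category_def Let_def nat_trans_def
  by (auto simp: extensional_def)

lemma (in abelian_category) simplicial_category_simps:
  "Id (simplicial_category A) X n = Id A (Fob X n)"
  "Comp (simplicial_category A) g f n = g n \<cdot> f n"
  unfolding simplicial_category_def functor_category_def Let_def by simp_all

lemma (in abelian_category) category_simplicial_category: "category (simplicial_category A)"
proof
  let ?S = "simplicial_category A"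
  show "a \<in> Obj ?S \<and> b \<in> Obj ?S" if "f \<in> Hom ?S a b" for f a b using that simplicial_Hom_iff by blast
  show "Id ?S a \<in> Hom ?S a a" if a: "a \<in> Obj ?S" for a
  proof -
    interpret a: simplicial_object A a using simplicial_object_Obj[OF a] .
    show ?thesis unfolding simplicial_Hom_iff simplicial_category_simps
      using a Id_Hom[OF a.X_Obj] Id_Comp[OF a.X_Hom] Comp_Id[OF a.X_Hom] by simp
  qed
  show "Comp ?S g f \<in> Hom ?S a c" if f: "f \<in> Hom ?S a b" and g: "g \<in> Hom ?S b c" for f a b g c
  proof -
    have ob: "a \<in> Obj ?S" "b \<in> Obj ?S" "c \<in> Obj ?S" using f g simplicial_Hom_iff by blast+
    interpret a: simplicial_object A a using simplicial_object_Obj[OF ob(1)] .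
    interpret b: simplicial_object A b using simplicial_object_Obj[OF ob(2)] .
    interpret c: simplicial_object A c using simplicial_object_Obj[OF ob(3)] .
    have fH: "f n \<in> Hom A (Fob a n) (Fob b n)" and gH: "g n \<in> Hom A (Fob b n) (Fob c n)" for n
      using f g simplicial_Hom_iff by blast+
    have "(g m \<cdot> f m) \<cdot> Far a n m \<alpha> = Far c n m \<alpha> \<cdot> (g n \<cdot> f n)" if \<alpha>: "\<alpha> \<in> Hom Delta m n" for m n \<alpha>
    proof -
      have "f m \<cdot> Far a n m \<alpha> = Far b n m \<alpha> \<cdot> f n" "g m \<cdot> Far b n m \<alpha> = Far c n m \<alpha> \<cdot> g n"
        using f g \<alpha> simplicial_Hom_iff by blast+
      thus ?thesis using Comp_assoc[OF a.X_Hom[OF \<alpha>] fH gH] Comp_assoc[OF fH b.X_Hom[OF \<alpha>] gH]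
          Comp_assoc[OF fH gH c.X_Hom[OF \<alpha>]] by simp
    qed
    thus ?thesis unfolding simplicial_Hom_iff[of "Comp ?S g f"] simplicial_category_simps
      using ob Comp_Hom[OF fH gH] by simp
  qed
  show "Comp ?S f (Id ?S a) = f" if "f \<in> Hom ?S a b" for f a b
    using that Comp_Id by (auto simp: simplicial_Hom_iff simplicial_category_simps fun_eq_iff)
  show "Comp ?S (Id ?S b) f = f" if "f \<in> Hom ?S a b" for f a b
    using that Id_Comp by (auto simp: simplicial_Hom_iff simplicial_category_simps fun_eq_iff)
  show "Comp ?S (Comp ?S h g) f = Comp ?S h (Comp ?S g f)"
    if "f \<in> Hom ?S a b" "g \<in> Hom ?S b c" "h \<in> Hom ?S c d" for f a b g c h d
  proof
    fix n
    have "f n \<in> Hom A (Fob a n) (Fob b n)" "g n \<in> Hom A (Fob b n) (Fob c n)" "h n \<in> Hom A (Fob c n) (Fob d n)"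
      using that simplicial_Hom_iff by blast+
    from Comp_assoc[OF this] show "Comp ?S (Comp ?S h g) f n = Comp ?S h (Comp ?S g f) n"
      by (simp add: simplicial_category_simps)
  qed
qed

lemma chain_Hom_iff:
  "f \<in> Hom (chain_category A) Y Z \<longleftrightarrow> is_chain_complex A Y \<and> is_chain_complex A Z \<and>
     (\<forall>n. f n \<in> Hom A (Deg Y n) (Deg Z n)) \<and>
     (\<forall>n. f n \<cdot>\<^bsub>A\<^esub> Diff Y n = Diff Z n \<cdot>\<^bsub>A\<^esub> f (Suc n))"
  by (simp add: chain_category_def)

lemma chain_category_simps:
  "Obj (chain_category A) = {Y. is_chain_complex A Y}"
  "Id (chain_category A) Y n = Id A (Deg Y n)"
  "Comp (chain_category A) g f n = g n \<cdot>\<^bsub>A\<^esub> f n"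
  by (simp_all add: chain_category_def)

lemma (in preadditive_category) category_chain_category: "category (chain_category A)"
proof
  let ?S = "chain_category A"
  show "a \<in> Obj ?S \<and> b \<in> Obj ?S" if "f \<in> Hom ?S a b" for f a b
    using that by (simp add: chain_Hom_iff chain_category_simps)
  show "Id ?S a \<in> Hom ?S a a" if a: "a \<in> Obj ?S" for a
  proof -
    have "is_chain_complex A a" using a by (simp add: chain_category_simps)
    moreover from this have ob: "Deg a n \<in> Obj A" and d: "Diff a n \<in> Hom A (Deg a (Suc n)) (Deg a n)" for n
      unfolding is_chain_complex_def by blast+
    ultimately show ?thesis unfolding chain_Hom_iff chain_category_simps
      using Id_Hom[OF ob] Id_Comp[OF d] Comp_Id[OF d] by simp
  qed
  show "Comp ?S g f \<in> Hom ?S a c" if f: "f \<in> Hom ?S a b" and g: "g \<in> Hom ?S b c" for f a b g c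
  proof -
    have fH: "f n \<in> Hom A (Deg a n) (Deg b n)" and gH: "g n \<in> Hom A (Deg b n) (Deg c n)" for n
      using f g by (simp_all add: chain_Hom_iff)
    have cc: "is_chain_complex A a" "is_chain_complex A b" "is_chain_complex A c"
      using f g by (simp_all add: chain_Hom_iff)
    have da: "Diff a n \<in> Hom A (Deg a (Suc n)) (Deg a n)" and db: "Diff b n \<in> Hom A (Deg b (Suc n)) (Deg b n)"
      and dc: "Diff c n \<in> Hom A (Deg c (Suc n)) (Deg c n)" for n
      using cc unfolding is_chain_complex_def by blast+
    have "(g n \<cdot> f n) \<cdot> Diff a n = Diff c n \<cdot> (g (Suc n) \<cdot> f (Suc n))" for n
    proof -
      have "f n \<cdot> Diff a n = Diff b n \<cdot> f (Suc n)" "g n \<cdot> Diff b n = Diff c n \<cdot> g (Suc n)"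
        using f g by (simp_all add: chain_Hom_iff)
      thus ?thesis using Comp_assoc[OF da fH gH] Comp_assoc[OF fH db gH, symmetric] Comp_assoc[OF fH gH dc, symmetric] by simp
    qed
    thus ?thesis unfolding chain_Hom_iff chain_category_simps using cc Comp_Hom[OF fH gH] by simp
  qed
  show "Comp ?S f (Id ?S a) = f" if "f \<in> Hom ?S a b" for f a b
    using that Comp_Id by (auto simp: chain_Hom_iff chain_category_simps fun_eq_iff)
  show "Comp ?S (Id ?S b) f = f" if "f \<in> Hom ?S a b" for f a b
    using that Id_Comp by (auto simp: chain_Hom_iff chain_category_simps fun_eq_iff)
  show "Comp ?S (Comp ?S h g) f = Comp ?S h (Comp ?S g f)"
    if "f \<in> Hom ?S a b" "g \<in> Hom ?S b c" "h \<in> Hom ?S c d" for f a b g c h d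
  proof
    fix n
    have "f n \<in> Hom A (Deg a n) (Deg b n)" "g n \<in> Hom A (Deg b n) (Deg c n)" "h n \<in> Hom A (Deg c n) (Deg d n)"
      using that by (simp_all add: chain_Hom_iff)
    from Comp_assoc[OF this] show "Comp ?S (Comp ?S h g) f n = Comp ?S h (Comp ?S g f) n"
      by (simp add: chain_category_simps)
  qed
qed

context abelian_category
begin

lemma moore_map:
  assumes f: "f \<in> Hom (simplicial_category A) X X'"
  shows moore_map_Hom: "moore_map A X X' f n \<in> Hom A (moore_ob A X n) (moore_ob A X' n)"
    and incl_moore_map: "moore_incl A X' n \<cdot> moore_map A X X' f n = f n \<cdot> moore_incl A X n"
proof -
  have ob: "X \<in> Obj (simplicial_category A)" "X' \<in> Obj (simplicial_category A)"
    and fH: "f n \<in> Hom A (Fob X n) (Fob X' n)"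
    and nat: "\<And>m n \<alpha>. \<alpha> \<in> Hom Delta m n \<Longrightarrow> f m \<cdot> Far X n m \<alpha> = Far X' n m \<alpha> \<cdot> f n" for n
    using f simplicial_Hom_iff by blast+
  interpret X: simplicial_object A X using simplicial_object_Obj[OF ob(1)] .
  interpret X': simplicial_object A X' using simplicial_object_Obj[OF ob(2)] .
  have "f n \<cdot> X.incl n \<in> X'.normalized (X.moore_X n) n"
  proof (rule X'.normalizedI)
    show "f n \<cdot> X.incl n \<in> Hom A (X.moore_X n) (Fob X' n)" using Comp_Hom[OF X.incl_Hom fH] .
    fix m j assume n: "n = Suc m" and j: "1 \<le> j" "j \<le> n"
    have c: "coface (Suc m) j \<in> Hom Delta m (Suc m)" using coface_Hom j n by simp
    have "X'.face_el m j (f n \<cdot> X.incl n)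
        = f m \<cdot> X.face_el m j (X.incl n)"
      unfolding X.pull_def X'.pull_def n
      using Comp_assoc[OF X.incl_Hom fH X'.X_Hom[OF c]] Comp_assoc[OF X.incl_Hom X.X_Hom[OF c] fH] nat[OF c]
      by simp
    also have "\<dots> = Zero A (X.moore_X n) (Fob X' m)"
      using X.normalized_face[OF X.incl_normalized, of j m] j n Comp_Zero[OF fH X.moore_Obj] by simp
    finally show "X'.face_el m j (f n \<cdot> X.incl n) = Zero A (X.moore_X n) (Fob X' m)" .
  qed
  from theI'[OF X'.normalized_factor[OF this]]
  show "moore_map A X X' f n \<in> Hom A (moore_ob A X n) (moore_ob A X' n)"
    "moore_incl A X' n \<cdot> moore_map A X X' f n = f n \<cdot> moore_incl A X n"
    unfolding moore_map_def by blast+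
qed

lemma moore_simps: "Deg (Fob (moore A) X) = moore_ob A X" "Diff (Fob (moore A) X) = moore_diff A X"
  "Far (moore A) = moore_map A"
  by (simp_all add: moore_def)

lemma moore_functor: "cat_functor (simplicial_category A) (chain_category A) (moore A)"
  unfolding cat_functor_def cat_functor_axioms_def
proof (intro conjI allI impI)
  let ?S = "simplicial_category A" and ?C = "chain_category A"
  show "category ?S" "category ?C" using category_simplicial_category category_chain_category .
  show "Fob (moore A) X \<in> Obj ?C" if X: "X \<in> Obj ?S" for X
  proof -
    interpret X: simplicial_object A X using simplicial_object_Obj[OF X] .
    show ?thesis using X.moore_is_chain_complex by (simp add: chain_category_simps)
  qed
  show "Far (moore A) X X' f \<in> Hom ?C (Fob (moore A) X) (Fob (moore A) X')"
    if f: "f \<in> Hom ?S X X'" for f X X'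
  proof -
    have ob: "X \<in> Obj ?S" "X' \<in> Obj ?S" and fH: "f n \<in> Hom A (Fob X n) (Fob X' n)"
      and nat: "\<And>m n \<alpha>. \<alpha> \<in> Hom Delta m n \<Longrightarrow> f m \<cdot> Far X n m \<alpha> = Far X' n m \<alpha> \<cdot> f n" for n
      using f simplicial_Hom_iff by blast+
    interpret X: simplicial_object A X using simplicial_object_Obj[OF ob(1)] .
    interpret X': simplicial_object A X' using simplicial_object_Obj[OF ob(2)] .
    note mH = moore_map_Hom[OF f] and im = incl_moore_map[OF f]
    have "moore_map A X X' f n \<cdot> moore_diff A X n = moore_diff A X' n \<cdot> moore_map A X X' f (Suc n)" for n
    proof (rule X'.incl_monic)
      show "moore_map A X X' f n \<cdot> moore_diff A X n \<in> Hom A (X.moore_X (Suc n)) (X'.moore_X n)"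
        using Comp_Hom[OF X.moore_diff_Hom mH] .
      show "moore_diff A X' n \<cdot> moore_map A X X' f (Suc n) \<in> Hom A (X.moore_X (Suc n)) (X'.moore_X n)"
        using Comp_Hom[OF mH X'.moore_diff_Hom] .
      have c: "coface (Suc n) 0 \<in> Hom Delta n (Suc n)" using coface_Hom by simp
      have "X'.incl n \<cdot> (moore_map A X X' f n \<cdot> moore_diff A X n) = f n \<cdot> (X.incl n \<cdot> moore_diff A X n)"
        using Comp_assoc[OF X.moore_diff_Hom mH X'.incl_Hom] Comp_assoc[OF X.moore_diff_Hom X.incl_Hom fH] im
        by simp
      also have "\<dots> = Far X' (Suc n) n (coface (Suc n) 0) \<cdot> (f (Suc n) \<cdot> X.incl (Suc n))"
        unfolding X.incl_moore_diff X.pull_def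
        using Comp_assoc[OF X.incl_Hom X.X_Hom[OF c] fH] nat[OF c] Comp_assoc[OF X.incl_Hom fH X'.X_Hom[OF c]]
        by simp
      also have "\<dots> = X'.incl n \<cdot> (moore_diff A X' n \<cdot> moore_map A X X' f (Suc n))"
        using Comp_assoc[OF mH X'.moore_diff_Hom X'.incl_Hom, symmetric] X'.incl_moore_diff[of n] im[of "Suc n"]
          Comp_assoc[OF mH X'.incl_Hom X'.X_Hom[OF c]] by (simp add: X'.pull_def)
      finally show "X'.incl n \<cdot> (moore_map A X X' f n \<cdot> moore_diff A X n)
          = X'.incl n \<cdot> (moore_diff A X' n \<cdot> moore_map A X X' f (Suc n))" .
    qed
    thus ?thesis unfolding chain_Hom_iff moore_simps
      using mH X.moore_is_chain_complex X'.moore_is_chain_complex by simp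
  qed
  show "Far (moore A) X X (Id ?S X) = Id ?C (Fob (moore A) X)" if X: "X \<in> Obj ?S" for X
  proof
    fix n
    interpret X: simplicial_object A X using simplicial_object_Obj[OF X] .
    have i: "Id ?S X \<in> Hom ?S X X" using category.Id_Hom[OF category_simplicial_category X] .
    have "moore_map A X X (Id ?S X) n = Id A (X.moore_X n)"
      by (rule X.incl_monic[OF moore_map_Hom[OF i] Id_Hom[OF X.moore_Obj]])
        (use incl_moore_map[OF i, of n] Id_Comp[OF X.incl_Hom] Comp_Id[OF X.incl_Hom] in
          \<open>simp add: simplicial_category_simps\<close>)
    thus "Far (moore A) X X (Id ?S X) n = Id ?C (Fob (moore A) X) n"
      by (simp add: moore_simps chain_category_simps)
  qed
  show "Far (moore A) X Z (Comp ?S g f) = Comp ?C (Far (moore A) Y Z g) (Far (moore A) X Y f)"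
    if f: "f \<in> Hom ?S X Y" and g: "g \<in> Hom ?S Y Z" for f g X Y Z
  proof
    fix n
    have ob: "X \<in> Obj ?S" "Y \<in> Obj ?S" "Z \<in> Obj ?S" and fH: "f n \<in> Hom A (Fob X n) (Fob Y n)"
      and gH: "g n \<in> Hom A (Fob Y n) (Fob Z n)"
      using f g simplicial_Hom_iff by blast+
    interpret X: simplicial_object A X using simplicial_object_Obj[OF ob(1)] .
    interpret Y: simplicial_object A Y using simplicial_object_Obj[OF ob(2)] .
    interpret Z: simplicial_object A Z using simplicial_object_Obj[OF ob(3)] .
    have gf: "Comp ?S g f \<in> Hom ?S X Z" using category.Comp_Hom[OF category_simplicial_category f g] .
    have "moore_map A X Z (Comp ?S g f) n = moore_map A Y Z g n \<cdot> moore_map A X Y f n"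
      by (rule Z.incl_monic[OF moore_map_Hom[OF gf] Comp_Hom[OF moore_map_Hom[OF f] moore_map_Hom[OF g]]])
        (use incl_moore_map[OF gf, of n] incl_moore_map[OF g, of n] incl_moore_map[OF f, of n]
          Comp_assoc[OF moore_map_Hom[OF f] moore_map_Hom[OF g] Z.incl_Hom, symmetric]
          Comp_assoc[OF moore_map_Hom[OF f] Y.incl_Hom gH] Comp_assoc[OF X.incl_Hom fH gH]
          in \<open>simp add: simplicial_category_simps\<close>)
    thus "Far (moore A) X Z (Comp ?S g f) n = Comp ?C (Far (moore A) Y Z g) (Far (moore A) X Y f) n"
      by (simp add: moore_simps chain_category_simps)
  qed
qed

end

section \<open>The Moore functor is fully faithful\<close>

context simplicial_object
begin

lemma pull_incl_d0:
  assumes \<nu>: "\<nu> \<in> Hom Delta l k"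
  shows "pull (Suc k) l (coface (Suc k) 0 \<circ> \<nu>) (incl (Suc k)) = pull k l \<nu> (incl k) \<cdot> moore_diff A X k"
proof -
  have c: "coface (Suc k) 0 \<in> Hom Delta k (Suc k)" using coface_Hom by simp
  show ?thesis
    using pull_pull[OF incl_Hom c \<nu>] pull_Comp[OF incl_Hom \<nu> moore_diff_Hom] incl_moore_diff by simp
qed

lemma pull_incl_Hom: "\<rho> \<in> Hom Delta l k \<Longrightarrow> pull k l \<rho> (incl k) \<in> Hom A (moore_X k) (Fob X l)"
  using pull_Hom[OF incl_Hom] .

lemma pull_incl_pull:
  assumes "f \<in> Hom A (Fob X m) B" "\<alpha> \<in> Hom Delta m n" "\<rho> \<in> Hom Delta n k"
  shows "f \<cdot> pull k m (\<rho> \<circ> \<alpha>) (incl k) = (f \<cdot> Far X n m \<alpha>) \<cdot> pull k n \<rho> (incl k)"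
  using pull_pull[OF incl_Hom assms(3,2)] Comp_assoc[OF pull_incl_Hom[OF assms(3)] X_Hom[OF assms(2)] assms(1)]
  by (simp add: pull_def)

text \<open>Agreement on the summands \<open>X(\<sigma>) C(X)\<^sub>k\<close> for surjective \<open>\<sigma>\<close> gives agreement for all operators, since the other
  operators act on normalised elements through the boundary or by zero.\<close>

lemma eq_on_operators:
  assumes f: "f \<in> Hom A (Fob X n) B" and g: "g \<in> Hom A (Fob X n) B"
    and eq: "\<And>k \<sigma>. \<sigma> \<in> Delta_surj n k \<Longrightarrow> f \<cdot> pull k n \<sigma> (incl k) = g \<cdot> pull k n \<sigma> (incl k)"
    and \<rho>: "\<rho> \<in> Hom Delta n k"
  shows "f \<cdot> pull k n \<rho> (incl k) = g \<cdot> pull k n \<rho> (incl k)"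
  using \<rho>
proof (cases rule: Delta_cases)
  case surj thus ?thesis by (rule eq)
next
  case (d0 k' \<nu>)
  note \<nu> = Delta_surj_Hom[OF d0(2)]
  have "pull k n \<rho> (incl k) = pull k' n \<nu> (incl k') \<cdot> moore_diff A X k'"
    using pull_incl_d0[OF \<nu>] d0 by simp
  thus ?thesis
    using Comp_assoc[OF moore_diff_Hom pull_incl_Hom[OF \<nu>] f, symmetric]
      Comp_assoc[OF moore_diff_Hom pull_incl_Hom[OF \<nu>] g, symmetric] eq[OF d0(2)] by simp
next
  case (miss k' j)
  thus ?thesis using pull_miss_normalized[OF incl_normalized \<rho> miss(2,3,4)] Comp_Zero[OF f moore_Obj]
      Comp_Zero[OF g moore_Obj] by simp
qed

text \<open>By induction on the degree: the normalised part of the identity is covered by the summand of the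
  identity operator, and its degenerate part by summands in lower degrees.\<close>

lemma generated_by_normalized:
  assumes "f \<in> Hom A (Fob X n) B" "g \<in> Hom A (Fob X n) B"
    and "\<And>k \<sigma>. \<sigma> \<in> Delta_surj n k \<Longrightarrow> f \<cdot> pull k n \<sigma> (incl k) = g \<cdot> pull k n \<sigma> (incl k)"
  shows "f = g"
  using assms
proof (induction n arbitrary: f g rule: less_induct)
  case (less n)
  note f = less.prems(1) and g = less.prems(2)
  \<comment> \<open>In a pullback along \<open>[n] \<rightarrow> [k]\<close> with \<open>k < n\<close> the induction hypothesis applies to \<open>f\<close> and \<open>g\<close> composed with
    the operator \<open>X\<^sub>k \<rightarrow> X\<^sub>n\<close>.\<close>
  have deg: "f \<cdot> z = g \<cdot> z" if T: "T \<in> Obj A" and z: "z \<in> degenerate T n" for T z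
    using z
  proof induction
    case zero show ?case using Comp_Zero[OF f T] Comp_Zero[OF g T] by simp
  next
    case (add z k \<sigma> y)
    have "f \<cdot> Far X k n \<sigma> = g \<cdot> Far X k n \<sigma>"
    proof (rule less.IH[OF add(2)])
      show "f \<cdot> Far X k n \<sigma> \<in> Hom A (Fob X k) B" "g \<cdot> Far X k n \<sigma> \<in> Hom A (Fob X k) B"
        using Comp_Hom[OF X_Hom[OF add(3)] f] Comp_Hom[OF X_Hom[OF add(3)] g] .
      show "(f \<cdot> Far X k n \<sigma>) \<cdot> pull l k \<tau> (incl l) = (g \<cdot> Far X k n \<sigma>) \<cdot> pull l k \<tau> (incl l)"
        if "\<tau> \<in> Delta_surj k l" for l \<tau>
      proof -
        note \<tau> = Delta_surj_Hom[OF that]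
        show ?thesis using pull_incl_pull[OF f add(3) \<tau>] pull_incl_pull[OF g add(3) \<tau>]
            eq_on_operators[OF f g less.prems(3) Delta_comp[OF add(3) \<tau>]] by simp
      qed
    qed
    hence "f \<cdot> pull k n \<sigma> y = g \<cdot> pull k n \<sigma> y"
      using Comp_assoc[OF add(4) X_Hom[OF add(3)] f] Comp_assoc[OF add(4) X_Hom[OF add(3)] g]
      by (simp add: pull_def)
    thus ?case
      using Comp_Add[OF degenerate_Hom[OF add(1) T] pull_Hom[OF add(4,3)] f] add(5)
        Comp_Add[OF degenerate_Hom[OF add(1) T] pull_Hom[OF add(4,3)] g] by simp
  qed
  obtain c z where c: "c \<in> normalized (Fob X n) n" and z: "z \<in> degenerate (Fob X n) n"
    and cz: "Id A (Fob X n) = add_el (Fob X n) n c z"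
    using normalized_degenerate_decomposition[OF Id_Hom[OF X_Obj]] by blast
  obtain v where v: "v \<in> Hom A (Fob X n) (moore_X n)" "incl n \<cdot> v = c"
    using normalized_factor[OF c] by blast
  have "f \<cdot> incl n = g \<cdot> incl n"
    using less.prems(3)[OF Id_Delta_surj] pull_Id[OF incl_Hom] by simp
  hence "f \<cdot> c = g \<cdot> c"
    using Comp_assoc[OF v(1) incl_Hom f] Comp_assoc[OF v(1) incl_Hom g] v(2) by simp
  hence "f \<cdot> Id A (Fob X n) = g \<cdot> Id A (Fob X n)"
    unfolding cz using deg[OF X_Obj z] Comp_Add[OF normalized_Hom[OF c] degenerate_Hom[OF z X_Obj] f]
      Comp_Add[OF normalized_Hom[OF c] degenerate_Hom[OF z X_Obj] g] by simp
  thus ?case using Comp_Id[OF f] Comp_Id[OF g] by simp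
qed

definition moore_proj :: "nat \<Rightarrow> 'a" where
  "moore_proj n = (THE r. r \<in> Hom A (Fob X n) (moore_X n) \<and> incl n \<cdot> r = normal_proj n)"

lemma moore_proj:
  shows moore_proj_Hom: "moore_proj n \<in> Hom A (Fob X n) (moore_X n)"
    and incl_moore_proj: "incl n \<cdot> moore_proj n = normal_proj n"
  using theI'[OF normalized_factor[OF normal_proj_normalized], of n]
  unfolding moore_proj_def by blast+

lemma moore_proj_incl: "moore_proj n \<cdot> incl n = Id A (moore_X n)"
  by (rule incl_monic[OF Comp_Hom[OF incl_Hom moore_proj_Hom] Id_Hom[OF moore_Obj]])
    (use Comp_assoc[OF incl_Hom moore_proj_Hom incl_Hom] incl_moore_proj Comp_Id[OF incl_Hom]
      normal_proj_normalized_id[OF incl_normalized] in simp)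

lemma moore_proj_degenerate:
  assumes "z \<in> degenerate T n" "T \<in> Obj A" shows "moore_proj n \<cdot> z = Zero A T (moore_X n)"
proof (rule incl_monic)
  note z = degenerate_Hom[OF assms]
  show "moore_proj n \<cdot> z \<in> Hom A T (moore_X n)" using Comp_Hom[OF z moore_proj_Hom] .
  show "Zero A T (moore_X n) \<in> Hom A T (moore_X n)" using Zero_Hom[OF assms(2) moore_Obj] .
  show "incl n \<cdot> (moore_proj n \<cdot> z) = incl n \<cdot> Zero A T (moore_X n)"
    using Comp_assoc[OF z moore_proj_Hom incl_Hom] incl_moore_proj normal_proj_degenerate[OF assms]
      Comp_Zero[OF incl_Hom assms(2)] by simp
qed

text \<open>A left inverse of the summand of \<open>\<sigma>\<close>: pull back along a section of \<open>\<sigma>\<close>, then take the normalised part.\<close>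

definition summand_proj :: "nat \<Rightarrow> nat \<Rightarrow> (nat \<Rightarrow> nat) \<Rightarrow> 'a" where
  "summand_proj n k \<sigma> = moore_proj k \<cdot> Far X n k (Delta_section \<sigma> k)"

lemma summand_proj_Hom:
  "\<sigma> \<in> Delta_surj n k \<Longrightarrow> summand_proj n k \<sigma> \<in> Hom A (Fob X n) (moore_X k)"
  unfolding summand_proj_def using Comp_Hom[OF X_Hom[OF Delta_section(1)] moore_proj_Hom] .

lemma summand_proj_pull:
  assumes \<sigma>: "\<sigma> \<in> Delta_surj n k" and \<tau>: "\<tau> \<in> Hom Delta n l"
  shows "summand_proj n k \<sigma> \<cdot> pull l n \<tau> (incl l)
    = moore_proj k \<cdot> pull l k (\<tau> \<circ> Delta_section \<sigma> k) (incl l)"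
  unfolding summand_proj_def
  using pull_incl_pull[OF moore_proj_Hom Delta_section(1)[OF \<sigma>] \<tau>] by simp

lemma summand_proj_same:
  assumes \<sigma>: "\<sigma> \<in> Delta_surj n k"
  shows "summand_proj n k \<sigma> \<cdot> pull k n \<sigma> (incl k) = Id A (moore_X k)"
proof -
  have "\<sigma> \<circ> Delta_section \<sigma> k = Id Delta k"
    using Delta_section(2)[OF \<sigma>] by (auto simp: Delta_Id)
  thus ?thesis using summand_proj_pull[OF \<sigma> Delta_surj_Hom[OF \<sigma>]] pull_Id[OF incl_Hom] moore_proj_incl
    by simp
qed

text \<open>Let \<open>\<mu>\<close> be the least section of \<open>\<sigma>\<close>. The operator \<open>\<tau> \<mu>\<close> preserves 0, so on normalised elements it
  acts by zero unless it is surjective. If it then lowers the dimension, the projection kills the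
  degenerate result. Otherwise \<open>\<tau> \<mu>\<close> is the identity, and \<open>\<tau> \<ge> \<sigma>\<close> pointwise because \<open>\<mu> (\<sigma> i) \<le> i\<close>; the sum of
  values then forces \<open>\<tau> = \<sigma>\<close>.\<close>

lemma summand_proj_smaller:
  assumes \<sigma>: "\<sigma> \<in> Delta_surj n k" and \<tau>: "\<tau> \<in> Delta_surj n l"
    and ne: "(l, \<tau>) \<noteq> (k, \<sigma>)" and le: "(\<Sum>i\<le>n. \<tau> i) \<le> (\<Sum>i\<le>n. \<sigma> i)"
  shows "summand_proj n k \<sigma> \<cdot> pull l n \<tau> (incl l) = Zero A (moore_X l) (moore_X k)"
proof -
  let ?\<mu> = "Delta_section \<sigma> k"
  note \<tau>H = Delta_surj_Hom[OF \<tau>] and \<sigma>H = Delta_surj_Hom[OF \<sigma>]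
  note \<rho> = Delta_comp[OF Delta_section(1)[OF \<sigma>] \<tau>H]
  have "moore_proj k \<cdot> pull l k (\<tau> \<circ> ?\<mu>) (incl l) = Zero A (moore_X l) (moore_X k)"
    using \<rho>
  proof (cases rule: Delta_cases)
    case surj
    show ?thesis
    proof (cases "l = k")
      case True
      have "\<tau> \<circ> ?\<mu> = Id Delta k" using Delta_surj_eq_Id surj True by blast
      hence id: "\<tau> (?\<mu> j) = min j k" for j by (metis comp_apply Delta_Id)
      have ge: "\<sigma> i \<le> \<tau> i" for i
      proof -
        have "\<sigma> i = \<tau> (?\<mu> (\<sigma> i))" using id[of "\<sigma> i"] Delta_le[OF \<sigma>H, of i] by simp
        also have "\<dots> \<le> \<tau> i" using Delta_mono[OF \<tau>H Delta_section(4)[OF \<sigma>]] .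
        finally show ?thesis .
      qed
      have "\<tau> i = \<sigma> i" if "i \<le> n" for i
      proof (rule ccontr)
        assume "\<tau> i \<noteq> \<sigma> i"
        hence "\<sigma> i < \<tau> i" using ge[of i] by simp
        hence "(\<Sum>i\<le>n. \<sigma> i) < (\<Sum>i\<le>n. \<tau> i)"
          by (intro sum_strict_mono_ex1) (use ge that in auto)
        thus False using le by simp
      qed
      hence "\<tau> (min i n) = \<sigma> (min i n)" for i by simp
      hence "\<tau> = \<sigma>" using Delta_const[OF \<tau>H] Delta_const[OF \<sigma>H] by auto
      thus ?thesis using ne True by simp
    next
      case False
      hence "l < k" using Delta_surj_le[OF surj] by simp
      thus ?thesis using moore_proj_degenerate[OF degenerate_pull[OF _ \<rho> incl_Hom] moore_Obj] by simp
    qed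
  next
    case (d0 k' \<nu>)
    have "(\<tau> \<circ> ?\<mu>) 0 = 0" using Delta_section(3)[OF \<sigma>] Delta_surj_0[OF \<tau>] by simp
    moreover have "(coface (Suc k') 0 \<circ> \<nu>) 0 \<noteq> 0" by (simp add: coface_apply)
    ultimately show ?thesis using d0(3) by metis
  next
    case (miss k' j)
    thus ?thesis using pull_miss_normalized[OF incl_normalized \<rho> miss(2,3,4)]
        Comp_Zero[OF moore_proj_Hom moore_Obj] by simp
  qed
  thus ?thesis using summand_proj_pull[OF \<sigma> \<tau>H] by simp
qed

text \<open>The summands are treated in the order of increasing sum of values of \<open>\<sigma>\<close>. By triangularity the correction
  that repairs the value on the newest summand vanishes on the earlier ones.\<close>

lemma extend_from_normalized:
  assumes B: "B \<in> Obj A"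
    and \<phi>: "\<And>k \<sigma>. \<sigma> \<in> Delta_surj n k \<Longrightarrow> \<phi> k \<sigma> \<in> Hom A (moore_X k) B"
  shows "\<exists>f \<in> Hom A (Fob X n) B. \<forall>k. \<forall>\<sigma> \<in> Delta_surj n k. f \<cdot> pull k n \<sigma> (incl k) = \<phi> k \<sigma>"
proof -
  define I where "I = (SIGMA k:UNIV. Delta_surj n k)"
  have fin: "finite I" unfolding I_def by (rule finite_Delta_surj)
  define w where "w = (\<lambda>(k :: nat, \<sigma>). \<Sum>i\<le>n. (\<sigma> i :: nat))"
  define good where "good f S \<longleftrightarrow> (\<forall>k \<sigma>. (k, \<sigma>) \<in> S \<longrightarrow> f \<cdot> pull k n \<sigma> (incl k) = \<phi> k \<sigma>)" for f S
  have "S \<subseteq> I \<longrightarrow> (\<exists>f \<in> Hom A (Fob X n) B. good f S)" if "finite S" for S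
    using that
  proof (induction S rule: finite_ranking_induct[where f = w])
    case empty show ?case using Zero_Hom[OF X_Obj B] by (auto simp: good_def)
  next
    case (insert x S)
    show ?case
    proof
      assume sub: "insert x S \<subseteq> I"
      then obtain f where f: "f \<in> Hom A (Fob X n) B" "good f S" using insert by blast
      obtain k \<sigma> where x: "x = (k, \<sigma>)" by (cases x)
      have \<sigma>: "\<sigma> \<in> Delta_surj n k" using sub x by (auto simp: I_def)
      let ?q = "summand_proj n k \<sigma>" and ?s = "pull k n \<sigma> (incl k)"
      note qH = summand_proj_Hom[OF \<sigma>] and sH = pull_incl_Hom[OF Delta_surj_Hom[OF \<sigma>]]
      define u where "u = Sub (moore_X k) B (\<phi> k \<sigma>) (f \<cdot> ?s)"
      have u: "u \<in> Hom A (moore_X k) B" unfolding u_def using Sub_Hom[OF \<phi>[OF \<sigma>] Comp_Hom[OF sH f(1)]] .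
      let ?f = "Add A (Fob X n) B f (u \<cdot> ?q)"
      have uq: "u \<cdot> ?q \<in> Hom A (Fob X n) B" using Comp_Hom[OF qH u] .
      have "?f \<cdot> pull l n \<tau> (incl l) = \<phi> l \<tau>" if l\<tau>: "(l, \<tau>) \<in> insert x S" for l \<tau>
      proof -
        have \<tau>: "\<tau> \<in> Delta_surj n l" using sub l\<tau> by (auto simp: I_def)
        note tH = pull_incl_Hom[OF Delta_surj_Hom[OF \<tau>]]
        have e: "?f \<cdot> pull l n \<tau> (incl l)
            = Add A (moore_X l) B (f \<cdot> pull l n \<tau> (incl l)) (u \<cdot> (?q \<cdot> pull l n \<tau> (incl l)))"
          using Add_Comp[OF tH f(1) uq] Comp_assoc[OF tH qH u] by simp
        show ?thesis
        proof (cases "(l, \<tau>) = (k, \<sigma>)")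
          case True
          hence "u \<cdot> (?q \<cdot> pull l n \<tau> (incl l)) = u" using summand_proj_same[OF \<sigma>] Comp_Id[OF u] by simp
          thus ?thesis using e True Add_Sub[OF \<phi>[OF \<sigma>] Comp_Hom[OF sH f(1)]] by (simp add: u_def)
        next
          case False
          hence S: "(l, \<tau>) \<in> S" using l\<tau> x by auto
          hence "w (l, \<tau>) \<le> w (k, \<sigma>)" using insert(2) x by blast
          hence "?q \<cdot> pull l n \<tau> (incl l) = Zero A (moore_X l) (moore_X k)"
            using summand_proj_smaller[OF \<sigma> \<tau> False] by (simp add: w_def)
          thus ?thesis using e Comp_Zero[OF u moore_Obj] f(2) S Add_Zero(1)[OF \<phi>[OF \<tau>]]
            by (simp add: good_def)
        qed
      qed
      thus "\<exists>f \<in> Hom A (Fob X n) B. good f (insert x S)"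
        using Add_Hom[OF f(1) uq] unfolding good_def by blast
    qed
  qed
  from this[OF fin] show ?thesis by (auto simp: I_def good_def)
qed

end

lemma (in abelian_category) moore_fully_faithful:
  assumes X: "X \<in> Obj (simplicial_category A)" and X': "X' \<in> Obj (simplicial_category A)"
    and h: "h \<in> Hom (chain_category A) (Fob (moore A) X) (Fob (moore A) X')"
  shows "\<exists>!f. f \<in> Hom (simplicial_category A) X X' \<and> Far (moore A) X X' f = h"
proof -
  interpret X: simplicial_object A X using simplicial_object_Obj[OF X] .
  interpret X': simplicial_object A X' using simplicial_object_Obj[OF X'] .
  have hH: "h n \<in> Hom A (X.moore_X n) (X'.moore_X n)"
    and hd: "h n \<cdot> moore_diff A X n = moore_diff A X' n \<cdot> h (Suc n)" for n
    using h by (simp_all add: chain_Hom_iff moore_simps)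
  have "\<exists>f \<in> Hom A (Fob X n) (Fob X' n). \<forall>k. \<forall>\<sigma> \<in> Delta_surj n k.
      f \<cdot> X.pull k n \<sigma> (X.incl k) = X'.pull k n \<sigma> (X'.incl k) \<cdot> h k" for n
    by (rule X.extend_from_normalized[OF X'.X_Obj])
      (rule Comp_Hom[OF hH X'.pull_incl_Hom[OF Delta_surj_Hom]])
  then obtain f where fH: "\<And>n. f n \<in> Hom A (Fob X n) (Fob X' n)"
    and fs: "\<And>n k \<sigma>. \<sigma> \<in> Delta_surj n k \<Longrightarrow>
      f n \<cdot> X.pull k n \<sigma> (X.incl k) = X'.pull k n \<sigma> (X'.incl k) \<cdot> h k"
    by metis
  have f\<rho>: "f n \<cdot> X.pull k n \<rho> (X.incl k) = X'.pull k n \<rho> (X'.incl k) \<cdot> h k"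
    if \<rho>: "\<rho> \<in> Hom Delta n k" for n k \<rho>
    using \<rho>
  proof (cases rule: Delta_cases)
    case surj thus ?thesis by (rule fs)
  next
    case (d0 k' \<nu>)
    note \<nu> = Delta_surj_Hom[OF d0(2)]
    have "f n \<cdot> X.pull k n \<rho> (X.incl k) = (f n \<cdot> X.pull k' n \<nu> (X.incl k')) \<cdot> moore_diff A X k'"
      using X.pull_incl_d0[OF \<nu>] d0 Comp_assoc[OF X.moore_diff_Hom X.pull_incl_Hom[OF \<nu>] fH] by simp
    also have "\<dots> = X'.pull k' n \<nu> (X'.incl k') \<cdot> (moore_diff A X' k' \<cdot> h (Suc k'))"
      using fs[OF d0(2)] Comp_assoc[OF X.moore_diff_Hom hH X'.pull_incl_Hom[OF \<nu>]] hd by simp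
    also have "\<dots> = X'.pull k n \<rho> (X'.incl k) \<cdot> h k"
      using X'.pull_incl_d0[OF \<nu>] d0 Comp_assoc[OF hH X'.moore_diff_Hom X'.pull_incl_Hom[OF \<nu>]] by simp
    finally show ?thesis .
  next
    case (miss k' j)
    show ?thesis
      using X.pull_miss_normalized[OF X.incl_normalized \<rho> miss(2,3,4)]
        X'.pull_miss_normalized[OF X'.incl_normalized \<rho> miss(2,3,4)]
        Comp_Zero[OF fH X.moore_Obj] Zero_Comp[OF hH X'.X_Obj] by simp
  qed
  have nat: "f m \<cdot> Far X n m \<alpha> = Far X' n m \<alpha> \<cdot> f n" if \<alpha>: "\<alpha> \<in> Hom Delta m n" for m n \<alpha>
  proof (rule X.generated_by_normalized)
    show "f m \<cdot> Far X n m \<alpha> \<in> Hom A (Fob X n) (Fob X' m)" using Comp_Hom[OF X.X_Hom[OF \<alpha>] fH] .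
    show "Far X' n m \<alpha> \<cdot> f n \<in> Hom A (Fob X n) (Fob X' m)" using Comp_Hom[OF fH X'.X_Hom[OF \<alpha>]] .
    fix k \<sigma> assume s: "\<sigma> \<in> Delta_surj n k"
    note \<sigma> = Delta_surj_Hom[OF s]
    have "(f m \<cdot> Far X n m \<alpha>) \<cdot> X.pull k n \<sigma> (X.incl k) = X'.pull k m (\<sigma> \<circ> \<alpha>) (X'.incl k) \<cdot> h k"
      using X.pull_incl_pull[OF fH \<alpha> \<sigma>] f\<rho>[OF Delta_comp[OF \<alpha> \<sigma>]] by simp
    also have "\<dots> = Far X' n m \<alpha> \<cdot> (X'.pull k n \<sigma> (X'.incl k) \<cdot> h k)"
      using X'.pull_pull[OF X'.incl_Hom \<sigma> \<alpha>] Comp_assoc[OF hH X'.pull_incl_Hom[OF \<sigma>] X'.X_Hom[OF \<alpha>]]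
      by (simp add: X'.pull_def[of n m])
    also have "\<dots> = (Far X' n m \<alpha> \<cdot> f n) \<cdot> X.pull k n \<sigma> (X.incl k)"
      using f\<rho>[OF \<sigma>] Comp_assoc[OF X.pull_incl_Hom[OF \<sigma>] fH X'.X_Hom[OF \<alpha>]] by simp
    finally show "(f m \<cdot> Far X n m \<alpha>) \<cdot> X.pull k n \<sigma> (X.incl k)
        = (Far X' n m \<alpha> \<cdot> f n) \<cdot> X.pull k n \<sigma> (X.incl k)" .
  qed
  have f: "f \<in> Hom (simplicial_category A) X X'" unfolding simplicial_Hom_iff using X X' fH nat by blast
  have "moore_map A X X' f n = h n" for n
  proof (rule X'.incl_monic[OF moore_map_Hom[OF f] hH])
    show "X'.incl n \<cdot> moore_map A X X' f n = X'.incl n \<cdot> h n"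
      using incl_moore_map[OF f] fs[OF Id_Delta_surj] X.pull_Id[OF X.incl_Hom] X'.pull_Id[OF X'.incl_Hom]
      by simp
  qed
  hence "Far (moore A) X X' f = h" by (auto simp: moore_simps)
  moreover have "g = f" if g: "g \<in> Hom (simplicial_category A) X X'" and gh: "Far (moore A) X X' g = h" for g
  proof
    fix n
    have gH: "g n \<in> Hom A (Fob X n) (Fob X' n)"
      and gnat: "\<And>m n \<alpha>. \<alpha> \<in> Hom Delta m n \<Longrightarrow> g m \<cdot> Far X n m \<alpha> = Far X' n m \<alpha> \<cdot> g n" for n
      using g simplicial_Hom_iff by blast+
    show "g n = f n"
    proof (rule X.generated_by_normalized[OF gH fH])
      fix k \<sigma> assume s: "\<sigma> \<in> Delta_surj n k"
      note \<sigma> = Delta_surj_Hom[OF s]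
      have "g n \<cdot> X.pull k n \<sigma> (X.incl k) = Far X' k n \<sigma> \<cdot> (g k \<cdot> X.incl k)"
        unfolding X.pull_def using Comp_assoc[OF X.incl_Hom X.X_Hom[OF \<sigma>] gH, symmetric] gnat[OF \<sigma>]
          Comp_assoc[OF X.incl_Hom gH X'.X_Hom[OF \<sigma>]] by simp
      also have "\<dots> = X'.pull k n \<sigma> (X'.incl k) \<cdot> h k"
        using incl_moore_map[OF g, of k] gh Comp_assoc[OF hH X'.incl_Hom X'.X_Hom[OF \<sigma>]]
        by (simp add: moore_simps X'.pull_def)
      finally show "g n \<cdot> X.pull k n \<sigma> (X.incl k) = f n \<cdot> X.pull k n \<sigma> (X.incl k)" using fs[OF s] by simp
    qed
  qed
  ultimately show ?thesis using f by blast
qed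

section \<open>The Dold-Kan nerve\<close>

text \<open>Finite coproducts suffice to build the nerve: using their universal property only, the operators and
  their composites never have to be written as matrices.\<close>

definition is_coproduct :: "('o, 'a, 'z) cat_scheme \<Rightarrow> 'i set \<Rightarrow> ('i \<Rightarrow> 'o) \<Rightarrow> 'o \<Rightarrow> ('i \<Rightarrow> 'a) \<Rightarrow> bool" where
  "is_coproduct C I Y S \<iota> \<longleftrightarrow> S \<in> Obj C \<and> (\<forall>i \<in> I. \<iota> i \<in> Hom C (Y i) S) \<and>
     (\<forall>B \<phi>. B \<in> Obj C \<and> (\<forall>i \<in> I. \<phi> i \<in> Hom C (Y i) B) \<longrightarrow>
        (\<exists>!f. f \<in> Hom C S B \<and> (\<forall>i \<in> I. f \<cdot>\<^bsub>C\<^esub> \<iota> i = \<phi> i)))"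

context abelian_category
begin

lemma finite_coproduct_exists:
  assumes "finite I" "\<And>i. i \<in> I \<Longrightarrow> Y i \<in> Obj A"
  shows "\<exists>S \<iota>. is_coproduct A I Y S \<iota>"
  using assms
proof (induction I)
  case empty
  obtain z where "zero_object A z" using ex_zero_object by blast
  hence "is_coproduct A {} Y z (\<lambda>_. undefined)" unfolding is_coproduct_def zero_object_def by simp
  thus ?case by blast
next
  case (insert x I)
  then obtain S \<iota> where S: "is_coproduct A I Y S \<iota>" by auto
  hence SO: "S \<in> Obj A" and \<iota>: "\<And>i. i \<in> I \<Longrightarrow> \<iota> i \<in> Hom A (Y i) S" unfolding is_coproduct_def by blast+
  have x: "Y x \<in> Obj A" using insert by simp
  obtain s p q i j where "is_biproduct A S (Y x) s p q i j" using ex_biproduct[OF SO x] by blast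
  hence p: "p \<in> Hom A s S" and q: "q \<in> Hom A s (Y x)" and i: "i \<in> Hom A S s" and j: "j \<in> Hom A (Y x) s"
    and pi: "p \<cdot> i = Id A S" and qj: "q \<cdot> j = Id A (Y x)"
    and pj: "p \<cdot> j = Zero A (Y x) S" and qi: "q \<cdot> i = Zero A S (Y x)"
    and sum: "Add A s s (i \<cdot> p) (j \<cdot> q) = Id A s" unfolding is_biproduct_def by blast+
  define \<kappa> where "\<kappa> y = (if y = x then j else i \<cdot> \<iota> y)" for y
  have sO: "s \<in> Obj A" using Hom_Obj[OF i] by simp
  have \<kappa>H: "\<kappa> y \<in> Hom A (Y y) s" if "y \<in> insert x I" for y
    using that j Comp_Hom[OF \<iota> i] unfolding \<kappa>_def by auto
  have "\<exists>!f. f \<in> Hom A s B \<and> (\<forall>y \<in> insert x I. f \<cdot> \<kappa> y = \<phi> y)"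
    if B: "B \<in> Obj A" and \<phi>: "\<forall>y \<in> insert x I. \<phi> y \<in> Hom A (Y y) B" for B \<phi>
  proof -
    have ex1: "\<exists>!f. f \<in> Hom A S B \<and> (\<forall>y \<in> I. f \<cdot> \<iota> y = \<phi> y)"
      using S B \<phi> unfolding is_coproduct_def by simp
    then obtain g where g: "g \<in> Hom A S B" "\<And>y. y \<in> I \<Longrightarrow> g \<cdot> \<iota> y = \<phi> y" by blast
    have \<phi>x: "\<phi> x \<in> Hom A (Y x) B" using \<phi> by simp
    let ?f = "Add A s B (g \<cdot> p) (\<phi> x \<cdot> q)"
    note gp = Comp_Hom[OF p g(1)] and \<phi>q = Comp_Hom[OF q \<phi>x]
    have f: "?f \<in> Hom A s B" using Add_Hom[OF gp \<phi>q] .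
    have fi: "?f \<cdot> i = g"
      using Add_Comp[OF i gp \<phi>q] Comp_assoc[OF i p g(1)] Comp_assoc[OF i q \<phi>x] pi qi
        Comp_Id[OF g(1)] Comp_Zero[OF \<phi>x SO] Add_Zero[OF g(1)] by simp
    have fj: "?f \<cdot> j = \<phi> x"
      using Add_Comp[OF j gp \<phi>q] Comp_assoc[OF j p g(1)] Comp_assoc[OF j q \<phi>x] pj qj
        Comp_Id[OF \<phi>x] Comp_Zero[OF g(1) x] Add_Zero[OF \<phi>x] by simp
    have "?f \<cdot> \<kappa> y = \<phi> y" if y: "y \<in> insert x I" for y
    proof (cases "y = x")
      case True thus ?thesis using fj by (simp add: \<kappa>_def)
    next
      case False
      hence "y \<in> I" using y by simp
      thus ?thesis using False Comp_assoc[OF \<iota> i f] fi g(2) by (simp add: \<kappa>_def)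
    qed
    moreover have "h = ?f" if h: "h \<in> Hom A s B" "\<forall>y \<in> insert x I. h \<cdot> \<kappa> y = \<phi> y" for h
    proof -
      have hi: "h \<cdot> i \<in> Hom A S B" using Comp_Hom[OF i h(1)] .
      have "(h \<cdot> i) \<cdot> \<iota> y = \<phi> y" if y: "y \<in> I" for y
      proof -
        have "y \<noteq> x" using y insert(2) by auto
        thus ?thesis using h(2) y Comp_assoc[OF \<iota>[OF y] i h(1)] by (auto simp: \<kappa>_def)
      qed
      hence "h \<cdot> i = g" using ex1 g hi by blast
      moreover have "h \<cdot> j = \<phi> x" using h(2) by (simp add: \<kappa>_def)
      ultimately have "h \<cdot> Id A s = ?f"
        unfolding sum[symmetric]
        using Comp_Add[OF Comp_Hom[OF p i] Comp_Hom[OF q j] h(1)] Comp_assoc[OF p i h(1)]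
          Comp_assoc[OF q j h(1)] by simp
      thus ?thesis using Comp_Id[OF h(1)] by simp
    qed
    ultimately show ?thesis using f by blast
  qed
  from this[OF conjunct1 conjunct2] have "is_coproduct A (insert x I) Y s \<kappa>"
    unfolding is_coproduct_def using sO \<kappa>H by (intro conjI ballI allI impI)
  thus ?case by blast
qed

end

locale connective_complex = abelian_category A
  for A :: "('o, 'a, 'z) addcat_scheme" (structure) +
  fixes Y :: "('o, 'a) chain_complex"
  assumes chain_complex: "is_chain_complex A Y"
begin

lemma Deg_Obj: "Deg Y n \<in> Obj A"
  and Diff_Hom: "Diff Y n \<in> Hom A (Deg Y (Suc n)) (Deg Y n)"
  and Diff_Diff: "Diff Y n \<cdot> Diff Y (Suc n) = Zero A (Deg Y (Suc (Suc n))) (Deg Y n)"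
  using chain_complex unfolding is_chain_complex_def by simp_all

definition nerve_coproduct :: "nat \<Rightarrow> 'o \<times> (nat \<times> (nat \<Rightarrow> nat) \<Rightarrow> 'a)" where
  "nerve_coproduct n =
     (SOME (S, \<iota>). is_coproduct A (SIGMA k:UNIV. Delta_surj n k) (\<lambda>(k, \<sigma>). Deg Y k) S \<iota>)"

definition nerve_ob :: "nat \<Rightarrow> 'o" where
  "nerve_ob n = fst (nerve_coproduct n)"

definition coproj :: "nat \<Rightarrow> nat \<Rightarrow> (nat \<Rightarrow> nat) \<Rightarrow> 'a" where
  "coproj n k \<sigma> = snd (nerve_coproduct n) (k, \<sigma>)"

lemma nerve_is_coproduct:
  "is_coproduct A (SIGMA k:UNIV. Delta_surj n k) (\<lambda>(k, \<sigma>). Deg Y k) (nerve_ob n) (snd (nerve_coproduct n))"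
proof -
  have "\<exists>S \<iota>. is_coproduct A (SIGMA k:UNIV. Delta_surj n k) (\<lambda>(k, \<sigma>). Deg Y k) S \<iota>"
    by (rule finite_coproduct_exists[OF finite_Delta_surj]) (auto simp: Deg_Obj)
  then obtain S \<iota> where "is_coproduct A (SIGMA k:UNIV. Delta_surj n k) (\<lambda>(k, \<sigma>). Deg Y k) S \<iota>" by blast
  thus ?thesis unfolding nerve_ob_def nerve_coproduct_def
    by (rule some_pair[where P = "is_coproduct A (SIGMA k:UNIV. Delta_surj n k) (\<lambda>(k, \<sigma>). Deg Y k)"])
qed

lemma nerve_ob_Obj: "nerve_ob n \<in> Obj A"
  using nerve_is_coproduct[of n] unfolding is_coproduct_def by blast

lemma coproj_Hom: "\<sigma> \<in> Delta_surj n k \<Longrightarrow> coproj n k \<sigma> \<in> Hom A (Deg Y k) (nerve_ob n)"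
  using nerve_is_coproduct[of n] unfolding is_coproduct_def coproj_def by auto

lemma copair:
  assumes B: "B \<in> Obj A" and \<phi>: "\<And>k \<sigma>. \<sigma> \<in> Delta_surj n k \<Longrightarrow> \<phi> k \<sigma> \<in> Hom A (Deg Y k) B"
  shows "\<exists>!f. f \<in> Hom A (nerve_ob n) B \<and> (\<forall>k. \<forall>\<sigma> \<in> Delta_surj n k. f \<cdot> coproj n k \<sigma> = \<phi> k \<sigma>)"
proof -
  have 1: "\<forall>B \<phi>. B \<in> Obj A \<and> (\<forall>i \<in> SIGMA k:UNIV. Delta_surj n k. \<phi> i \<in> Hom A (case i of (k, \<sigma>) \<Rightarrow> Deg Y k) B) \<longrightarrow>
      (\<exists>!f. f \<in> Hom A (nerve_ob n) B \<and>
        (\<forall>i \<in> SIGMA k:UNIV. Delta_surj n k. f \<cdot> snd (nerve_coproduct n) i = \<phi> i))"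
    using nerve_is_coproduct[of n] unfolding is_coproduct_def by blast
  have 2: "\<forall>i \<in> SIGMA k:UNIV. Delta_surj n k. (case i of (k, \<sigma>) \<Rightarrow> \<phi> k \<sigma>) \<in> Hom A (case i of (k, \<sigma>) \<Rightarrow> Deg Y k) B"
    using \<phi> by auto
  have 3: "(\<forall>i \<in> SIGMA k:UNIV. Delta_surj n k. f \<cdot> snd (nerve_coproduct n) i = (case i of (k, \<sigma>) \<Rightarrow> \<phi> k \<sigma>))
      \<longleftrightarrow> (\<forall>k. \<forall>\<sigma> \<in> Delta_surj n k. f \<cdot> coproj n k \<sigma> = \<phi> k \<sigma>)" for f
    unfolding coproj_def by auto
  show ?thesis using 1[rule_format, OF conjI[OF B 2]] unfolding 3 .
qed

lemma copair_eq:
  assumes f: "f \<in> Hom A (nerve_ob n) B" and g: "g \<in> Hom A (nerve_ob n) B"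
    and eq: "\<And>k \<sigma>. \<sigma> \<in> Delta_surj n k \<Longrightarrow> f \<cdot> coproj n k \<sigma> = g \<cdot> coproj n k \<sigma>"
  shows "f = g"
proof -
  have "B \<in> Obj A" using Hom_Obj[OF f] by simp
  moreover have "g \<cdot> coproj n k \<sigma> \<in> Hom A (Deg Y k) B" if "\<sigma> \<in> Delta_surj n k" for k \<sigma>
    using Comp_Hom[OF coproj_Hom[OF that] g] .
  ultimately have "\<exists>!f. f \<in> Hom A (nerve_ob n) B \<and>
      (\<forall>k. \<forall>\<sigma> \<in> Delta_surj n k. f \<cdot> coproj n k \<sigma> = g \<cdot> coproj n k \<sigma>)" by (rule copair)
  thus ?thesis using f g eq by blast
qed

text \<open>The prospective arrow \<open>Y\<^sub>k \<rightarrow> (N Y)\<^sub>n\<close> by which an operator \<open>\<rho> : [n] \<rightarrow> [k]\<close> acts on the top summand \<open>Y\<^sub>k\<close> of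
  \<open>(N Y)\<^sub>k\<close>, following the trichotomy of \<open>Delta_cases\<close>: a coprojection, the differential followed by one, or 0.
  In the second case subtracting 1 recovers the surjection.\<close>

definition component :: "nat \<Rightarrow> nat \<Rightarrow> (nat \<Rightarrow> nat) \<Rightarrow> 'a" where
  "component n k \<rho> =
     (if \<rho> \<in> Delta_surj n k then coproj n k \<rho>
      else if \<exists>k' \<nu>. k = Suc k' \<and> \<nu> \<in> Delta_surj n k' \<and> \<rho> = coface (Suc k') 0 \<circ> \<nu>
      then coproj n (k - 1) (\<lambda>i. \<rho> i - 1) \<cdot> Diff Y (k - 1)
      else Zero A (Deg Y k) (nerve_ob n))"

lemma component_surj: "\<sigma> \<in> Delta_surj n k \<Longrightarrow> component n k \<sigma> = coproj n k \<sigma>"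
  by (simp add: component_def)

lemma coface_0_apply: "\<nu> \<in> Hom Delta n k \<Longrightarrow> (coface (Suc k) 0 \<circ> \<nu>) i = Suc (\<nu> i)"
  using Delta_le[of \<nu> n k i] by (simp add: coface_apply)

lemma component_d0:
  assumes \<nu>: "\<nu> \<in> Delta_surj n k"
  shows "component n (Suc k) (coface (Suc k) 0 \<circ> \<nu>) = coproj n k \<nu> \<cdot> Diff Y k"
proof -
  let ?\<rho> = "coface (Suc k) 0 \<circ> \<nu>"
  have \<rho>: "?\<rho> i = Suc (\<nu> i)" for i using coface_0_apply[OF Delta_surj_Hom[OF \<nu>]] .
  have "?\<rho> \<notin> Delta_surj n (Suc k)" using Delta_surj_0[of ?\<rho> n "Suc k"] \<rho>[of 0] by auto
  moreover have "(\<lambda>i. ?\<rho> i - 1) = \<nu>" using \<rho> by auto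
  moreover have "\<exists>k' \<nu>'. Suc k = Suc k' \<and> \<nu>' \<in> Delta_surj n k' \<and> ?\<rho> = coface (Suc k') 0 \<circ> \<nu>'"
    using \<nu> by blast
  ultimately show ?thesis unfolding component_def by simp
qed

lemma component_miss:
  assumes j: "1 \<le> j" "j \<le> k" "j \<notin> range \<rho>"
  shows "component n k \<rho> = Zero A (Deg Y k) (nerve_ob n)"
proof -
  have "\<rho> \<notin> Delta_surj n k" using j by (auto simp: Delta_surj_def)
  moreover have "\<not> (\<exists>k' \<nu>. k = Suc k' \<and> \<nu> \<in> Delta_surj n k' \<and> \<rho> = coface (Suc k') 0 \<circ> \<nu>)"
  proof
    assume "\<exists>k' \<nu>. k = Suc k' \<and> \<nu> \<in> Delta_surj n k' \<and> \<rho> = coface (Suc k') 0 \<circ> \<nu>"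
    then obtain k' \<nu> where k: "k = Suc k'" and \<nu>: "\<nu> \<in> Delta_surj n k'" and \<rho>: "\<rho> = coface (Suc k') 0 \<circ> \<nu>"
      by blast
    have "j - 1 \<in> range \<nu>" using \<nu> j k by (simp add: Delta_surj_def)
    then obtain i where "\<nu> i = j - 1" by auto
    hence "\<rho> i = j" using coface_0_apply[OF Delta_surj_Hom[OF \<nu>], of i] \<rho> j by simp
    thus False using j(3) by blast
  qed
  ultimately show ?thesis unfolding component_def by (simp only: if_False)
qed

lemma component_Hom:
  assumes \<rho>: "\<rho> \<in> Hom Delta n k" shows "component n k \<rho> \<in> Hom A (Deg Y k) (nerve_ob n)"
  using \<rho>
proof (cases rule: Delta_cases)
  case surj thus ?thesis using component_surj coproj_Hom by simp
next
  case (d0 k' \<nu>) thus ?thesis using component_d0 Comp_Hom[OF Diff_Hom coproj_Hom] by simp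
next
  case (miss k' j) thus ?thesis using component_miss Zero_Hom[OF Deg_Obj nerve_ob_Obj] by simp
qed

text \<open>The middle case is the place where the square of the differential has to vanish: there the operator
  omits both 0 and 1.\<close>

lemma component_coface_0:
  assumes \<nu>: "\<nu> \<in> Hom Delta n k"
  shows "component n (Suc k) (coface (Suc k) 0 \<circ> \<nu>) = component n k \<nu> \<cdot> Diff Y k"
  using \<nu>
proof (cases rule: Delta_cases)
  case surj thus ?thesis using component_d0 component_surj by simp
next
  case (d0 k' \<nu>')
  have "(coface (Suc k) 0 \<circ> \<nu>) i = Suc (Suc (\<nu>' i))" for i
    using coface_0_apply[OF \<nu>, of i] coface_0_apply[OF Delta_surj_Hom[OF d0(2)], of i] d0(3) by simp
  hence "1 \<notin> range (coface (Suc k) 0 \<circ> \<nu>)" by (metis One_nat_def Suc_inject nat.distinct(1) rangeE)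
  hence "component n (Suc k) (coface (Suc k) 0 \<circ> \<nu>) = Zero A (Deg Y (Suc k)) (nerve_ob n)"
    by (intro component_miss[of 1]) auto
  moreover have "component n k \<nu> \<cdot> Diff Y k = Zero A (Deg Y (Suc k)) (nerve_ob n)"
    using component_d0[OF d0(2)] d0 Comp_assoc[OF Diff_Hom Diff_Hom coproj_Hom[OF d0(2)]] Diff_Diff
      Comp_Zero[OF coproj_Hom[OF d0(2)] Deg_Obj] by simp
  ultimately show ?thesis by simp
next
  case (miss k' j)
  have "Suc j \<notin> range (coface (Suc k) 0 \<circ> \<nu>)"
  proof
    assume "Suc j \<in> range (coface (Suc k) 0 \<circ> \<nu>)"
    then obtain i where "Suc j = (coface (Suc k) 0 \<circ> \<nu>) i" by blast
    hence "\<nu> i = j" using coface_0_apply[OF \<nu>, of i] by simp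
    thus False using miss(4) by blast
  qed
  hence "component n (Suc k) (coface (Suc k) 0 \<circ> \<nu>) = Zero A (Deg Y (Suc k)) (nerve_ob n)"
    using miss by (intro component_miss[of "Suc j"]) auto
  thus ?thesis using component_miss[OF miss(2-4)] Zero_Comp[OF Diff_Hom nerve_ob_Obj] by simp
qed

definition nerve_map :: "nat \<Rightarrow> nat \<Rightarrow> (nat \<Rightarrow> nat) \<Rightarrow> 'a" where
  "nerve_map n m \<alpha> = (THE f. f \<in> Hom A (nerve_ob n) (nerve_ob m) \<and>
     (\<forall>k. \<forall>\<sigma> \<in> Delta_surj n k. f \<cdot> coproj n k \<sigma> = component m k (\<sigma> \<circ> \<alpha>)))"

lemma nerve_map:
  assumes \<alpha>: "\<alpha> \<in> Hom Delta m n"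
  shows nerve_map_Hom: "nerve_map n m \<alpha> \<in> Hom A (nerve_ob n) (nerve_ob m)"
    and nerve_map_coproj: "\<sigma> \<in> Delta_surj n k \<Longrightarrow> nerve_map n m \<alpha> \<cdot> coproj n k \<sigma> = component m k (\<sigma> \<circ> \<alpha>)"
proof -
  have "\<exists>!f. f \<in> Hom A (nerve_ob n) (nerve_ob m) \<and>
      (\<forall>k. \<forall>\<sigma> \<in> Delta_surj n k. f \<cdot> coproj n k \<sigma> = component m k (\<sigma> \<circ> \<alpha>))"
    by (rule copair[OF nerve_ob_Obj]) (rule component_Hom[OF Delta_comp[OF \<alpha> Delta_surj_Hom]])
  from theI'[OF this]
  show "nerve_map n m \<alpha> \<in> Hom A (nerve_ob n) (nerve_ob m)"
    "\<sigma> \<in> Delta_surj n k \<Longrightarrow> nerve_map n m \<alpha> \<cdot> coproj n k \<sigma> = component m k (\<sigma> \<circ> \<alpha>)"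
    unfolding nerve_map_def by blast+
qed

text \<open>The defining property of the operators of the nerve for surjective \<open>\<rho>\<close> extends to all \<open>\<rho>\<close>; functoriality of
  the nerve is an instance.\<close>

lemma nerve_map_component:
  assumes \<alpha>: "\<alpha> \<in> Hom Delta m n" and \<rho>: "\<rho> \<in> Hom Delta n k"
  shows "nerve_map n m \<alpha> \<cdot> component n k \<rho> = component m k (\<rho> \<circ> \<alpha>)"
  using \<rho>
proof (cases rule: Delta_cases)
  case surj thus ?thesis using component_surj nerve_map_coproj[OF \<alpha>] by simp
next
  case (d0 k' \<nu>)
  note \<nu> = Delta_surj_Hom[OF d0(2)]
  have "nerve_map n m \<alpha> \<cdot> component n k \<rho> = (nerve_map n m \<alpha> \<cdot> coproj n k' \<nu>) \<cdot> Diff Y k'"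
    using component_d0[OF d0(2)] d0 Comp_assoc[OF Diff_Hom coproj_Hom[OF d0(2)] nerve_map_Hom[OF \<alpha>]] by simp
  also have "\<dots> = component m k (\<rho> \<circ> \<alpha>)"
    using nerve_map_coproj[OF \<alpha> d0(2)] component_coface_0[OF Delta_comp[OF \<alpha> \<nu>]] d0 by (simp add: comp_assoc)
  finally show ?thesis .
next
  case (miss k' j)
  hence "j \<notin> range (\<rho> \<circ> \<alpha>)" by auto
  thus ?thesis using component_miss miss Comp_Zero[OF nerve_map_Hom[OF \<alpha>] Deg_Obj] by simp
qed

definition nerve :: "('o, 'a) simplicial_object" where
  "nerve = \<lparr>Fob = nerve_ob, Far = (\<lambda>n m. \<lambda>\<alpha> \<in> Hom Delta m n. nerve_map n m \<alpha>)\<rparr>"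

lemma nerve_simps: "Fob nerve = nerve_ob" "\<alpha> \<in> Hom Delta m n \<Longrightarrow> Far nerve n m \<alpha> = nerve_map n m \<alpha>"
  by (simp_all add: nerve_def)

lemma nerve_Obj: "nerve \<in> Obj (simplicial_category A)"
proof -
  have "cat_functor (opposite Delta) A nerve"
    unfolding cat_functor_def cat_functor_axioms_def
  proof (intro conjI allI impI)
    show "category (opposite Delta)" by (rule category_opposite_Delta)
    show "category A" by (rule category_axioms)
    show "Fob nerve n \<in> Obj A" for n using nerve_ob_Obj by (simp add: nerve_simps)
    show "Far nerve n m \<alpha> \<in> Hom A (Fob nerve n) (Fob nerve m)" if "\<alpha> \<in> Hom (opposite Delta) n m" for \<alpha> n m
      using that nerve_map_Hom by (simp add: nerve_simps)
    show "Far nerve n n (Id (opposite Delta) n) = Id A (Fob nerve n)" for n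
    proof -
      have "nerve_map n n (Id Delta n) = Id A (nerve_ob n)"
      proof (rule copair_eq[OF nerve_map_Hom[OF Delta_Id_Hom] Id_Hom[OF nerve_ob_Obj]])
        fix k \<sigma> assume s: "\<sigma> \<in> Delta_surj n k"
        show "nerve_map n n (Id Delta n) \<cdot> coproj n k \<sigma> = Id A (nerve_ob n) \<cdot> coproj n k \<sigma>"
          using nerve_map_coproj[OF Delta_Id_Hom s] Delta_comp_Id[OF Delta_surj_Hom[OF s]] component_surj[OF s]
            Id_Comp[OF coproj_Hom[OF s]] by simp
      qed
      thus ?thesis by (simp add: nerve_simps Delta_Id_Hom)
    qed
    show "Far nerve n l (\<beta> \<cdot>\<^bsub>opposite Delta\<^esub> \<alpha>) = Far nerve m l \<beta> \<cdot> Far nerve n m \<alpha>"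
      if "\<alpha> \<in> Hom (opposite Delta) n m" "\<beta> \<in> Hom (opposite Delta) m l" for \<alpha> \<beta> n m l
    proof -
      have \<alpha>: "\<alpha> \<in> Hom Delta m n" and \<beta>: "\<beta> \<in> Hom Delta l m" using that by simp_all
      note \<alpha>\<beta> = Delta_comp[OF \<beta> \<alpha>]
      have "nerve_map n l (\<alpha> \<circ> \<beta>) = nerve_map m l \<beta> \<cdot> nerve_map n m \<alpha>"
      proof (rule copair_eq[OF nerve_map_Hom[OF \<alpha>\<beta>] Comp_Hom[OF nerve_map_Hom[OF \<alpha>] nerve_map_Hom[OF \<beta>]]])
        fix k \<sigma> assume s: "\<sigma> \<in> Delta_surj n k"
        show "nerve_map n l (\<alpha> \<circ> \<beta>) \<cdot> coproj n k \<sigma> = (nerve_map m l \<beta> \<cdot> nerve_map n m \<alpha>) \<cdot> coproj n k \<sigma>"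
          using Comp_assoc[OF coproj_Hom[OF s] nerve_map_Hom[OF \<alpha>] nerve_map_Hom[OF \<beta>]]
            nerve_map_coproj[OF \<alpha>\<beta> s] nerve_map_coproj[OF \<alpha> s]
            nerve_map_component[OF \<beta> Delta_comp[OF \<alpha> Delta_surj_Hom[OF s]]] by (simp add: comp_assoc)
      qed
      thus ?thesis using \<alpha> \<beta> \<alpha>\<beta> by (simp add: nerve_simps)
    qed
  qed
  moreover have "Far nerve a b \<in> extensional (Hom (opposite Delta) a b)" for a b
    by (simp add: nerve_def)
  ultimately show ?thesis unfolding simplicial_category_def functor_category_def Let_def
    by (simp add: extensional_def)
qed

sublocale N: simplicial_object A nerve
  using simplicial_object_Obj[OF nerve_Obj] .

text \<open>The summand of the identity operator, which turns out to be the normalised part.\<close>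

abbreviation top_coproj :: "nat \<Rightarrow> 'a" where "top_coproj n \<equiv> coproj n n (Id Delta n)"

lemma top_Hom: "top_coproj n \<in> Hom A (Deg Y n) (Fob nerve n)"
  using coproj_Hom[OF Id_Delta_surj] by (simp add: nerve_simps)

lemma pull_top: "\<rho> \<in> Hom Delta n k \<Longrightarrow> N.pull k n \<rho> (top_coproj k) = component n k \<rho>"
  using nerve_map_coproj[OF _ Id_Delta_surj] Delta_Id_comp by (simp add: N.pull_def nerve_simps)

lemma top_normalized: "top_coproj n \<in> N.normalized (Deg Y n) n"
proof (rule N.normalizedI[OF top_Hom])
  fix m j assume n: "n = Suc m" and j: "1 \<le> j" "j \<le> n"
  have c: "coface (Suc m) j \<in> Hom Delta m (Suc m)" using coface_Hom j n by simp
  have "j \<notin> range (coface (Suc m) j)" by (auto simp: coface_apply)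
  thus "N.face_el m j (top_coproj n) = N.zero_el (Deg Y n) m"
    using pull_top[OF c] component_miss[of j "Suc m"] j n by (simp add: nerve_simps)
qed

lemma top_d0: "N.face_el n 0 (top_coproj (Suc n)) = top_coproj n \<cdot> Diff Y n"
proof -
  have c: "coface (Suc n) 0 \<in> Hom Delta n (Suc n)" using coface_Hom by simp
  show ?thesis
    using pull_top[OF c] component_coface_0[OF Delta_Id_Hom, of n] Delta_comp_Id[OF c] component_surj[OF Id_Delta_surj] by simp
qed

text \<open>The other summands are degenerate, hence killed by the projection to the normalised part, while the
  top summand is normalised and fixed. So the projection factors through the top summand.\<close>

lemma top_retraction:
  obtains \<pi> where "\<pi> \<in> Hom A (nerve_ob n) (Deg Y n)" "\<pi> \<cdot> top_coproj n = Id A (Deg Y n)"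
    "N.normal_proj n = top_coproj n \<cdot> \<pi>"
proof -
  \<comment> \<open>The only surjection of \<open>[n]\<close> to itself is the identity, so \<open>k = n\<close> singles out the top summand.\<close>
  define \<phi> where "\<phi> k (\<sigma> :: nat \<Rightarrow> nat) = (if k = n then Id A (Deg Y n) else Zero A (Deg Y k) (Deg Y n))" for k \<sigma>
  have \<phi>: "\<phi> k \<sigma> \<in> Hom A (Deg Y k) (Deg Y n)" for k \<sigma>
    unfolding \<phi>_def using Id_Hom[OF Deg_Obj] Zero_Hom[OF Deg_Obj Deg_Obj] by simp
  obtain \<pi> where \<pi>: "\<pi> \<in> Hom A (nerve_ob n) (Deg Y n)"
    and \<pi>\<phi>: "\<And>k \<sigma>. \<sigma> \<in> Delta_surj n k \<Longrightarrow> \<pi> \<cdot> coproj n k \<sigma> = \<phi> k \<sigma>"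
    using copair[OF Deg_Obj, of n \<phi>] \<phi> by blast
  have topH: "top_coproj n \<in> Hom A (Deg Y n) (nerve_ob n)" using top_Hom by (simp add: nerve_simps)
  have pH: "N.normal_proj n \<in> Hom A (nerve_ob n) (nerve_ob n)"
    using N.normal_proj_Hom by (simp add: nerve_simps)
  have "N.normal_proj n = top_coproj n \<cdot> \<pi>"
  proof (rule copair_eq[OF pH Comp_Hom[OF \<pi> topH]])
    fix k \<sigma> assume s: "\<sigma> \<in> Delta_surj n k"
    have r: "(top_coproj n \<cdot> \<pi>) \<cdot> coproj n k \<sigma> = top_coproj n \<cdot> \<phi> k \<sigma>"
      using Comp_assoc[OF coproj_Hom[OF s] \<pi> topH] \<pi>\<phi>[OF s] by simp
    show "N.normal_proj n \<cdot> coproj n k \<sigma> = (top_coproj n \<cdot> \<pi>) \<cdot> coproj n k \<sigma>"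
    proof (cases "k = n")
      case True
      hence "\<sigma> = Id Delta n" using Delta_surj_eq_Id s by simp
      thus ?thesis using r True N.normal_proj_normalized_id[OF top_normalized] Comp_Id[OF topH]
        by (simp add: \<phi>_def)
    next
      case False
      hence "k < n" using Delta_surj_le[OF s] by simp
      from N.degenerate_pull[OF this Delta_surj_Hom[OF s] top_Hom]
      have "coproj n k \<sigma> \<in> N.degenerate (Deg Y k) n"
        using pull_top[OF Delta_surj_Hom[OF s]] component_surj[OF s] by simp
      thus ?thesis using r False N.normal_proj_degenerate[OF _ Deg_Obj] Comp_Zero[OF topH Deg_Obj]
        by (simp add: \<phi>_def nerve_simps)
    qed
  qed
  moreover have "\<pi> \<cdot> top_coproj n = Id A (Deg Y n)" using \<pi>\<phi>[OF Id_Delta_surj] by (simp add: \<phi>_def)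
  ultimately show ?thesis using that \<pi> by blast
qed

text \<open>Both the Moore object and the top summand represent the normalised elements of the nerve.\<close>

lemma moore_nerve_iso: "\<exists>e. is_iso (chain_category A) (Fob (moore A) nerve) Y e"
proof -
  have "\<forall>n. \<exists>\<pi>. \<pi> \<in> Hom A (nerve_ob n) (Deg Y n) \<and> \<pi> \<cdot> top_coproj n = Id A (Deg Y n) \<and>
      N.normal_proj n = top_coproj n \<cdot> \<pi>"
    using top_retraction by metis
  then obtain \<pi> where \<pi>: "\<And>n. \<pi> n \<in> Hom A (nerve_ob n) (Deg Y n)" "\<And>n. \<pi> n \<cdot> top_coproj n = Id A (Deg Y n)"
    "\<And>n. N.normal_proj n = top_coproj n \<cdot> \<pi> n" by metis
  have "\<forall>n. \<exists>v. v \<in> Hom A (Deg Y n) (N.moore_X n) \<and> N.incl n \<cdot> v = top_coproj n"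
    using N.normalized_factor[OF top_normalized] by blast
  then obtain u where u: "\<And>n. u n \<in> Hom A (Deg Y n) (N.moore_X n)" "\<And>n. N.incl n \<cdot> u n = top_coproj n" by metis
  have \<pi>H: "\<pi> n \<in> Hom A (Fob nerve n) (Deg Y n)" for n using \<pi>(1) by (simp add: nerve_simps)
  define v where "v n = \<pi> n \<cdot> N.incl n" for n
  have v: "v n \<in> Hom A (N.moore_X n) (Deg Y n)" for n unfolding v_def using Comp_Hom[OF N.incl_Hom \<pi>H] .
  have vu: "v n \<cdot> u n = Id A (Deg Y n)" for n
    unfolding v_def using Comp_assoc[OF u(1) N.incl_Hom \<pi>H] u(2) \<pi>(2) by simp
  have uv: "u n \<cdot> v n = Id A (N.moore_X n)" for n
  proof (rule N.incl_monic[OF Comp_Hom[OF v u(1)] Id_Hom[OF N.moore_Obj]])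
    have "N.incl n \<cdot> (u n \<cdot> v n) = top_coproj n \<cdot> v n" using Comp_assoc[OF v u(1) N.incl_Hom] u(2) by simp
    also have "\<dots> = N.incl n"
      unfolding v_def using Comp_assoc[OF N.incl_Hom \<pi>H top_Hom, symmetric] \<pi>(3)[symmetric]
        N.normal_proj_normalized_id[OF N.incl_normalized] by simp
    finally show "N.incl n \<cdot> (u n \<cdot> v n) = N.incl n \<cdot> Id A (N.moore_X n)" using Comp_Id[OF N.incl_Hom] by simp
  qed
  have c: "coface (Suc n) 0 \<in> Hom Delta n (Suc n)" for n using coface_Hom by simp
  let ?D = "moore_diff A nerve"
  have ud: "u n \<cdot> Diff Y n = ?D n \<cdot> u (Suc n)" for n
  proof (rule N.incl_monic[OF Comp_Hom[OF Diff_Hom u(1)] Comp_Hom[OF u(1) N.moore_diff_Hom]])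
    have "N.incl n \<cdot> (u n \<cdot> Diff Y n) = N.face_el n 0 (N.incl (Suc n) \<cdot> u (Suc n))"
      using Comp_assoc[OF Diff_Hom u(1) N.incl_Hom] u(2) top_d0 by simp
    also have "\<dots> = N.incl n \<cdot> (?D n \<cdot> u (Suc n))"
      using N.pull_Comp[OF N.incl_Hom c u(1)] N.incl_moore_diff
        Comp_assoc[OF u(1) N.moore_diff_Hom N.incl_Hom] by simp
    finally show "N.incl n \<cdot> (u n \<cdot> Diff Y n) = N.incl n \<cdot> (?D n \<cdot> u (Suc n))" .
  qed
  have vd: "v n \<cdot> ?D n = Diff Y n \<cdot> v (Suc n)" for n
  proof -
    have "v n \<cdot> ?D n = v n \<cdot> (?D n \<cdot> (u (Suc n) \<cdot> v (Suc n)))"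
      using uv Comp_Id[OF N.moore_diff_Hom] by simp
    also have "\<dots> = v n \<cdot> (u n \<cdot> (Diff Y n \<cdot> v (Suc n)))"
      using Comp_assoc[OF v u(1) N.moore_diff_Hom, symmetric] ud[symmetric] Comp_assoc[OF v Diff_Hom u(1)] by simp
    also have "\<dots> = Diff Y n \<cdot> v (Suc n)"
      using Comp_assoc[OF Comp_Hom[OF v Diff_Hom] u(1) v, symmetric] vu Id_Comp[OF Comp_Hom[OF v Diff_Hom]] by simp
    finally show ?thesis .
  qed
  have "v \<in> Hom (chain_category A) (Fob (moore A) nerve) Y" "u \<in> Hom (chain_category A) Y (Fob (moore A) nerve)"
    unfolding chain_Hom_iff moore_simps
    using N.moore_is_chain_complex chain_complex v vd u(1) ud by simp_all
  moreover have "Comp (chain_category A) u v = Id (chain_category A) (Fob (moore A) nerve)"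
    "Comp (chain_category A) v u = Id (chain_category A) Y"
    using uv vu by (auto simp: chain_category_simps moore_simps)
  ultimately show ?thesis unfolding is_iso_def by blast
qed

end

lemma (in abelian_category) moore_equivalence_functor:
  "equivalence_functor (simplicial_category A) (chain_category A) (moore A)"
proof -
  interpret cat_functor "simplicial_category A" "chain_category A" "moore A" by (rule moore_functor)
  show ?thesis
  proof
    show "\<exists>!f. f \<in> Hom (simplicial_category A) a b \<and> Far (moore A) a b f = g"
      if "a \<in> Obj (simplicial_category A)" "b \<in> Obj (simplicial_category A)"
        "g \<in> Hom (chain_category A) (Fob (moore A) a) (Fob (moore A) b)" for a b g
      using moore_fully_faithful that .
    show "\<exists>a \<in> Obj (simplicial_category A). \<exists>e. is_iso (chain_category A) (Fob (moore A) a) Y e"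
      if "Y \<in> Obj (chain_category A)" for Y
    proof -
      interpret connective_complex A Y
        using that abelian_category_axioms
        by (simp add: connective_complex_def connective_complex_axioms_def chain_category_simps)
      show ?thesis using nerve_Obj moore_nerve_iso by blast
    qed
  qed
qed

section \<open>Fillers of outer horns\<close>

text \<open>Conjugation of an operator with the order reversals \<open>i \<mapsto> m - i\<close> of \<open>[m]\<close> and \<open>i \<mapsto> n - i\<close> of \<open>[n]\<close>. Truncated
  subtraction makes the result constant beyond \<open>m\<close>.\<close>

definition reverse_op :: "nat \<Rightarrow> nat \<Rightarrow> (nat \<Rightarrow> nat) \<Rightarrow> nat \<Rightarrow> nat" where
  "reverse_op m n f = (\<lambda>i. n - f (m - i))"

lemma reverse_op_Hom:
  assumes "f \<in> Hom Delta m n" shows "reverse_op m n f \<in> Hom Delta m n"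
  by (rule Delta_HomI) (auto simp: reverse_op_def intro!: diff_le_mono2 Delta_mono[OF assms])

lemma reverse_op_comp:
  assumes "f \<in> Hom Delta l m" "g \<in> Hom Delta m n"
  shows "reverse_op l n (g \<circ> f) = reverse_op m n g \<circ> reverse_op l m f"
  using Delta_le[OF assms(1)] by (auto simp: reverse_op_def)

lemma reverse_op_Id: "reverse_op n n (Id Delta n) = Id Delta n"
  by (auto simp: reverse_op_def Delta_Id)

lemma reverse_op_reverse_op:
  assumes "f \<in> Hom Delta m n" shows "reverse_op m n (reverse_op m n f) = f"
proof
  fix i
  have "m - (m - i) = min i m" by simp
  thus "reverse_op m n (reverse_op m n f) i = f i"
    using Delta_const[OF assms, of i] Delta_le[OF assms, of i] by (simp add: reverse_op_def)
qed

lemma reverse_op_coface: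
  assumes "j \<le> Suc m"
  shows "reverse_op m (Suc m) (coface (Suc m) j) = coface (Suc m) (Suc m - j)"
proof
  fix i
  show "reverse_op m (Suc m) (coface (Suc m) j) i = coface (Suc m) (Suc m - j) i"
  proof (cases "m - i < j")
    case True
    hence "\<not> min i m < Suc m - j" using assms by linarith
    thus ?thesis using True by (simp add: reverse_op_def coface_apply)
  next
    case False
    hence "min i m < Suc m - j" by linarith
    thus ?thesis using False by (simp add: reverse_op_def coface_apply)
  qed
qed

context simplicial_object
begin

definition reversed :: "('o, 'a) simplicial_object" where
  "reversed = \<lparr>Fob = Fob X, Far = (\<lambda>n m f. Far X n m (reverse_op m n f))\<rparr>"

lemma reversed_simplicial_object: "simplicial_object A reversed"
proof -
  have "cat_functor (opposite Delta) A reversed"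
    unfolding cat_functor_def cat_functor_axioms_def
    using category_opposite_Delta category_axioms X_Obj X_Hom reverse_op_Hom reverse_op_comp reverse_op_Id
      X_comp[OF reverse_op_Hom reverse_op_Hom] Far_Id
    by (simp add: reversed_def)
  thus ?thesis unfolding simplicial_object_def using abelian_category_axioms by simp
qed

lemma reversed_simps: "Fob reversed = Fob X" "Far reversed n m f = Far X n m (reverse_op m n f)"
  by (simp_all add: reversed_def)

lemma reversed_pull: "simplicial_object.pull A reversed n m f x = pull n m (reverse_op m n f) x"
  unfolding simplicial_object.pull_def[OF reversed_simplicial_object] pull_def reversed_simps ..

lemma reversed_degenerate: "simplicial_object.degenerate A reversed T n = degenerate T n"
proof
  interpret R: simplicial_object A reversed by (rule reversed_simplicial_object)
  show "R.degenerate T n \<subseteq> degenerate T n"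
  proof
    fix x assume "x \<in> R.degenerate T n" thus "x \<in> degenerate T n"
    proof induction
      case zero show ?case using degenerate.zero by (simp add: reversed_simps)
    next
      case (add z k \<sigma> y)
      thus ?case using degenerate.add[OF add(5,2) reverse_op_Hom[OF add(3)]]
        by (simp add: reversed_simps reversed_pull)
    qed
  qed
  show "degenerate T n \<subseteq> R.degenerate T n"
  proof
    fix x assume "x \<in> degenerate T n" thus "x \<in> R.degenerate T n"
    proof induction
      case zero show ?case using R.degenerate.zero by (simp add: reversed_simps)
    next
      case (add z k \<sigma> y)
      thus ?case using R.degenerate.add[OF add(5,2) reverse_op_Hom[OF add(3)], of y]
        by (simp add: reversed_simps reversed_pull reverse_op_reverse_op)
    qed
  qed
qed

text \<open>The faces around the last vertex of \<open>X\<close> are the faces around 0 of the reversed object, and the filler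
  obtained there is degenerate in either sense.\<close>

lemma outer_horn_filler:
  assumes T: "T \<in> Obj A" and i: "i = 0 \<or> i = Suc n"
    and y: "\<And>j. j \<le> Suc n \<Longrightarrow> j \<noteq> i \<Longrightarrow> y j \<in> El T n"
    and match: "\<And>n' a b. n = Suc n' \<Longrightarrow> a < b \<Longrightarrow> b \<le> Suc n \<Longrightarrow> a \<noteq> i \<Longrightarrow> b \<noteq> i \<Longrightarrow>
      face_el n' a (y b) = face_el n' (b - 1) (y a)"
  shows "\<exists>x \<in> degenerate T (Suc n). \<forall>j. j \<le> Suc n \<and> j \<noteq> i \<longrightarrow>
    face_el n j x = y j"
proof (cases "i = 0")
  case True
  have "\<exists>x \<in> degenerate T (Suc n). \<forall>j. 1 \<le> j \<and> j \<le> Suc n \<longrightarrow> face_el n j x = y j"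
    by (rule horn_filler[OF T]) (use y match True in auto)
  thus ?thesis using True by (simp add: Suc_le_eq conj_commute)
next
  case False
  hence i: "i = Suc n" using i by simp
  interpret R: simplicial_object A reversed by (rule reversed_simplicial_object)
  have "\<exists>x \<in> R.degenerate T (Suc n). \<forall>j. 1 \<le> j \<and> j \<le> Suc n \<longrightarrow>
      R.face_el n j x = y (Suc n - j)"
  proof (rule R.horn_filler[OF T])
    show "y (Suc n - j) \<in> Hom A T (Fob reversed n)" if "1 \<le> j" "j \<le> Suc n" for j
      using y[of "Suc n - j"] that i by (simp add: reversed_simps)
    fix n' a b assume n: "n = Suc n'" and ab: "1 \<le> a" "a < b" "b \<le> Suc n"
    have "face_el n' (Suc n - b) (y (Suc n - a))
        = face_el n' (Suc n - a - 1) (y (Suc n - b))"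
      using match[of n' "Suc n - b" "Suc n - a"] n ab i by simp
    moreover have "reverse_op n' (Suc n') (coface (Suc n') a) = coface (Suc n') (Suc n - a - 1)"
      using reverse_op_coface[of a n'] n ab by simp
    moreover have "reverse_op n' (Suc n') (coface (Suc n') (b - 1)) = coface (Suc n') (Suc n - b)"
      using reverse_op_coface[of "b - 1" n'] n ab by simp
    ultimately show "R.face_el n' a (y (Suc n - b))
        = R.face_el n' (b - 1) (y (Suc n - a))"
      by (simp only: reversed_pull)
  qed
  then obtain x where x: "x \<in> degenerate T (Suc n)"
    and xy: "\<And>j. 1 \<le> j \<Longrightarrow> j \<le> Suc n \<Longrightarrow> R.face_el n j x = y (Suc n - j)"
    unfolding reversed_degenerate by blast
  have "face_el n j x = y j" if "j \<le> Suc n" "j \<noteq> i" for j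
    using xy[of "Suc n - j"] that i reverse_op_coface[of "Suc n - j" n] by (simp add: reversed_pull)
  thus ?thesis using x by blast
qed

lemma outer_faces_degenerate_zero:
  assumes i: "i = 0 \<or> i = Suc n" and d: "x \<in> degenerate T (Suc n)" and T: "T \<in> Obj A"
    and 0: "\<And>j. j \<le> Suc n \<Longrightarrow> j \<noteq> i \<Longrightarrow> face_el n j x = zero_el T n"
  shows "x = zero_el T (Suc n)"
proof (cases "i = 0")
  case True
  have "x \<in> normalized T (Suc n)"
    by (rule normalizedI[OF degenerate_Hom[OF d T]]) (use 0 True in auto)
  thus ?thesis using normalized_degenerate_zero d by blast
next
  case False
  hence i: "i = Suc n" using i by simp
  interpret R: simplicial_object A reversed by (rule reversed_simplicial_object)
  have "x \<in> R.normalized T (Suc n)"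
  proof (rule R.normalizedI)
    show "x \<in> Hom A T (Fob reversed (Suc n))" using degenerate_Hom[OF d T] by (simp add: reversed_simps)
    show "R.face_el n' j x = Zero A T (Fob reversed n')"
      if "Suc n = Suc n'" "1 \<le> j" "j \<le> Suc n" for n' j
      using 0[of "Suc n - j"] that i by (simp add: reversed_simps reversed_pull reverse_op_coface)
  qed
  thus ?thesis using R.normalized_degenerate_zero d by (simp add: reversed_degenerate reversed_simps)
qed

text \<open>A facet contains a vertex exactly if it is not the one opposite to it.\<close>

lemma mem_horn_iff:
  assumes "i \<le> Suc m"
  shows "\<sigma> \<in> horn (Suc m) i k \<longleftrightarrow>
    (\<exists>j \<tau>. j \<le> Suc m \<and> j \<noteq> i \<and> \<tau> \<in> Hom Delta k m \<and> \<sigma> = coface (Suc m) j \<circ> \<tau>)"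
proof -
  have "vertex i \<in> facet (Suc m) j 0 \<longleftrightarrow> j \<noteq> i" if j: "j \<le> Suc m" for j
  proof
    assume "vertex i \<in> facet (Suc m) j 0"
    then obtain \<tau> where "vertex i = coface (Suc m) j \<circ> \<tau>" by (auto simp: facet_def)
    hence "i = coface (Suc m) j (\<tau> 0)" by (simp add: vertex_def fun_eq_iff)
    thus "j \<noteq> i" by (auto simp: coface_apply split: if_splits)
  next
    assume ne: "j \<noteq> i"
    have v: "vertex i \<in> Hom Delta 0 (Suc m)" by (rule Delta_HomI) (use assms in \<open>auto simp: vertex_def\<close>)
    have "j \<notin> range (vertex i)" using ne by (auto simp: vertex_def)
    then obtain \<tau> where "\<tau> \<in> Hom Delta 0 m" "vertex i = coface (Suc m) j \<circ> \<tau>"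
      using factor_coface[OF v _ j] by blast
    thus "vertex i \<in> facet (Suc m) j 0" by (auto simp: facet_def)
  qed
  thus ?thesis by (auto simp: horn_def facet_def)
qed

abbreviation diagram :: "(nat \<times> (nat \<Rightarrow> nat), nat \<Rightarrow> nat, 'o, 'a) ftor" where
  "diagram \<equiv> comp_ftor X (opposite_ftor simplices_proj)"

abbreviation "cone_over K \<equiv> is_cone (opposite (simplices K)) A diagram"
abbreviation "limit_over K \<equiv> is_limit (opposite (simplices K)) A diagram"

lemma cone_over_iff:
  "cone_over K M \<rho> \<longleftrightarrow> M \<in> Obj A \<and>
     (\<forall>k. \<forall>\<sigma> \<in> K k. \<rho> (k, \<sigma>) \<in> El M k) \<and>
     (\<forall>k l \<theta>. \<forall>\<sigma> \<in> K k. \<theta> \<in> Hom Delta l k \<longrightarrow> \<sigma> \<circ> \<theta> \<in> K l \<longrightarrow>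
        pull k l \<theta> (\<rho> (k, \<sigma>)) = \<rho> (l, \<sigma> \<circ> \<theta>))"
  unfolding is_cone_def pull_def
  by (auto simp: opposite_def simplices_def comp_ftor_def opposite_ftor_def simplices_proj_def)

lemma operators_cone:
  assumes K: "\<And>k \<sigma>. \<sigma> \<in> K k \<Longrightarrow> \<sigma> \<in> Hom Delta k n" and x: "x \<in> El M n"
  shows "cone_over K M (\<lambda>(k, \<sigma>). pull n k \<sigma> x)"
  unfolding cone_over_iff using Hom_Obj[OF x] pull_Hom[OF x K] pull_pull[OF x K] by auto

lemma horn_Hom:
  assumes "i \<le> Suc m" "\<sigma> \<in> horn (Suc m) i k" shows "\<sigma> \<in> Hom Delta k (Suc m)"
  using assms mem_horn_iff[OF assms(1)] Delta_comp[OF _ coface_Hom] by auto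

lemma horn_cone_filler:
  assumes i: "i = 0 \<or> i = Suc m"
    and cone: "cone_over (horn (Suc m) i) M \<rho>"
  shows "\<exists>x \<in> degenerate M (Suc m). \<forall>k. \<forall>\<sigma> \<in> horn (Suc m) i k. pull (Suc m) k \<sigma> x = \<rho> (k, \<sigma>)"
proof -
  let ?K = "horn (Suc m) i"
  have iSm: "i \<le> Suc m" using i by auto
  have M: "M \<in> Obj A" and \<rho>H: "\<And>k \<sigma>. \<sigma> \<in> ?K k \<Longrightarrow> \<rho> (k, \<sigma>) \<in> El M k"
    and \<rho>p: "\<And>k l \<theta> \<sigma>. \<sigma> \<in> ?K k \<Longrightarrow> \<theta> \<in> Hom Delta l k \<Longrightarrow> \<sigma> \<circ> \<theta> \<in> ?K l \<Longrightarrow>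
      pull k l \<theta> (\<rho> (k, \<sigma>)) = \<rho> (l, \<sigma> \<circ> \<theta>)"
    using cone unfolding cone_over_iff by simp_all
  have mem: "coface (Suc m) j \<circ> \<tau> \<in> ?K k" if "j \<le> Suc m" "j \<noteq> i" "\<tau> \<in> Hom Delta k m" for j \<tau> k
    using mem_horn_iff[OF iSm] that by blast
  have memf: "coface (Suc m) j \<in> ?K m" if "j \<le> Suc m" "j \<noteq> i" for j
    using mem[OF that Delta_Id_Hom] Delta_comp_Id[OF coface_Hom[OF that(1)]] by simp
  have \<rho>\<tau>: "pull m k \<tau> (\<rho> (m, coface (Suc m) j)) = \<rho> (k, coface (Suc m) j \<circ> \<tau>)"
    if "j \<le> Suc m" "j \<noteq> i" "\<tau> \<in> Hom Delta k m" for j k \<tau>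
    using \<rho>p[OF memf[OF that(1,2)] that(3) mem[OF that]] .
  have "\<exists>x \<in> degenerate M (Suc m). \<forall>j. j \<le> Suc m \<and> j \<noteq> i \<longrightarrow>
      face_el m j x = \<rho> (m, coface (Suc m) j)"
  proof (rule outer_horn_filler[OF M i])
    show "\<rho> (m, coface (Suc m) j) \<in> El M m" if "j \<le> Suc m" "j \<noteq> i" for j
      using \<rho>H[OF memf[OF that]] .
    fix m' a b assume m: "m = Suc m'" and ab: "a < b" "b \<le> Suc m" "a \<noteq> i" "b \<noteq> i"
    show "face_el m' a (\<rho> (m, coface (Suc m) b))
        = face_el m' (b - 1) (\<rho> (m, coface (Suc m) a))"
      using \<rho>\<tau>[of b "coface m a" m'] \<rho>\<tau>[of a "coface m (b - 1)" m'] m ab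
        coface_Hom[of a m'] coface_Hom[of "b - 1" m'] coface_coface[of a b m'] by simp
  qed
  then obtain x where x: "x \<in> degenerate M (Suc m)" and xj: "\<And>j. j \<le> Suc m \<Longrightarrow> j \<noteq> i \<Longrightarrow>
      face_el m j x = \<rho> (m, coface (Suc m) j)" by blast
  have "pull (Suc m) k \<sigma> x = \<rho> (k, \<sigma>)" if s: "\<sigma> \<in> ?K k" for k \<sigma>
  proof -
    obtain j \<tau> where j: "j \<le> Suc m" "j \<noteq> i" and \<tau>: "\<tau> \<in> Hom Delta k m" "\<sigma> = coface (Suc m) j \<circ> \<tau>"
      using iffD1[OF mem_horn_iff[OF iSm] s] by blast
    show ?thesis
      using pull_pull[OF degenerate_Hom[OF x M] coface_Hom[OF j(1)] \<tau>(1)] xj[OF j] \<rho>\<tau>[OF j \<tau>(1)] \<tau>(2) by simp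
  qed
  thus ?thesis using x by blast
qed

lemma horn_faces_zero:
  assumes i: "i \<le> Suc m" and x: "x \<in> El T (Suc m)"
    and 0: "\<And>j. j \<le> Suc m \<Longrightarrow> j \<noteq> i \<Longrightarrow> face_el m j x = zero_el T m"
    and \<sigma>: "\<sigma> \<in> horn (Suc m) i k"
  shows "pull (Suc m) k \<sigma> x = zero_el T k"
proof -
  obtain j \<tau> where j: "j \<le> Suc m" "j \<noteq> i" and \<tau>: "\<tau> \<in> Hom Delta k m" "\<sigma> = coface (Suc m) j \<circ> \<tau>"
    using iffD1[OF mem_horn_iff[OF i] \<sigma>] by blast
  have "T \<in> Obj A" using Hom_Obj[OF x] by simp
  thus ?thesis using pull_pull[OF x coface_Hom[OF j(1)] \<tau>(1)] 0[OF j] \<tau>(2) pull_Zero[OF _ \<tau>(1)] by simp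
qed

lemma coface_mem_horn:
  assumes "i \<le> Suc m" "j \<le> Suc m" "j \<noteq> i" shows "coface (Suc m) j \<in> horn (Suc m) i m"
  unfolding mem_horn_iff[OF assms(1)]
  using assms(2,3) Delta_Id_Hom Delta_comp_Id[OF coface_Hom[OF assms(2)]] by metis

text \<open>Fillers of a cone exist, and the difference of two fillers is degenerate with vanishing faces, hence
  zero.\<close>

lemma horn_limit_if_degenerate:
  assumes i: "i = 0 \<or> i = Suc m"
    and deg: "\<And>T x. x \<in> El T (Suc m) \<Longrightarrow> x \<in> degenerate T (Suc m)"
  shows "limit_over (horn (Suc m) i) (Fob X (Suc m))
    (\<lambda>(k, \<sigma>). Far X (Suc m) k \<sigma>)"
proof -
  let ?K = "horn (Suc m) i" and ?x = "Fob X (Suc m)"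
  have iSm: "i \<le> Suc m" using i by auto
  have Far_eq: "Far X (Suc m) k \<sigma> = pull (Suc m) k \<sigma> (Id A ?x)" if "\<sigma> \<in> ?K k" for k \<sigma>
    using Comp_Id[OF X_Hom[OF horn_Hom[OF iSm that]]] by (simp add: pull_def)
  have "cone_over ?K ?x (\<lambda>(k, \<sigma>). pull (Suc m) k \<sigma> (Id A ?x))"
    by (rule operators_cone[OF horn_Hom[OF iSm] Id_Hom[OF X_Obj]])
  hence cone: "cone_over ?K ?x (\<lambda>(k, \<sigma>). Far X (Suc m) k \<sigma>)"
    unfolding cone_over_iff using Far_eq by auto
  have "\<exists>!u. u \<in> Hom A M ?x \<and>
      (\<forall>j \<in> Obj (opposite (simplices ?K)). (case j of (k, \<sigma>) \<Rightarrow> Far X (Suc m) k \<sigma>) \<cdot> u = \<rho> j)"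
    if c: "cone_over ?K M \<rho>" for M \<rho>
  proof -
    have M: "M \<in> Obj A" using c unfolding cone_over_iff by blast
    obtain x where x: "x \<in> degenerate M (Suc m)"
      and x\<rho>: "\<And>k \<sigma>. \<sigma> \<in> ?K k \<Longrightarrow> pull (Suc m) k \<sigma> x = \<rho> (k, \<sigma>)"
      using horn_cone_filler[OF i c] by blast
    have obj: "(\<forall>j \<in> Obj (opposite (simplices ?K)). (case j of (k, \<sigma>) \<Rightarrow> Far X (Suc m) k \<sigma>) \<cdot> u = \<rho> j)
        \<longleftrightarrow> (\<forall>k. \<forall>\<sigma> \<in> ?K k. pull (Suc m) k \<sigma> u = \<rho> (k, \<sigma>))" for u
      by (auto simp: opposite_def simplices_def pull_def)
    have "u = x" if u: "u \<in> Hom A M ?x" "\<forall>k. \<forall>\<sigma> \<in> ?K k. pull (Suc m) k \<sigma> u = \<rho> (k, \<sigma>)" for u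
    proof -
      note xH = degenerate_Hom[OF x M]
      have "sub_el M (Suc m) u x = zero_el M (Suc m)"
      proof (rule outer_faces_degenerate_zero[OF i deg[OF Sub_Hom[OF u(1) xH]] M])
        fix j assume j: "j \<le> Suc m" "j \<noteq> i"
        have k: "coface (Suc m) j \<in> ?K m" using coface_mem_horn[OF iSm j] .
        show "face_el m j (sub_el M (Suc m) u x) = zero_el M m"
          using pull_Sub[OF u(1) xH coface_Hom[OF j(1)]] u(2) x\<rho>[OF k] k
            Sub_self[OF pull_Hom[OF xH coface_Hom[OF j(1)]]] by simp
      qed
      thus ?thesis using Sub_eq_Zero[OF u(1) xH] by simp
    qed
    thus ?thesis unfolding obj using degenerate_Hom[OF x M] x\<rho> by blast
  qed
  thus ?thesis unfolding is_limit_def using cone by simp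
qed

text \<open>The limit over the horn is the kernel of the projection to the Moore object: degenerate fillers lie in it,
  and it contains no nonzero normalised element. Without an existing limit, the chosen one that occurs in
  the definition of outer Kan complexes would be meaningless.\<close>

lemma horn_0_limit_exists:
  "\<exists>L \<pi>. limit_over (horn (Suc m) 0) L \<pi>"
proof -
  let ?K = "horn (Suc m) 0" and ?x = "Fob X (Suc m)" and ?r = "moore_proj (Suc m)"
  obtain L l where ker: "is_kernel A ?x (moore_X (Suc m)) ?r L l"
    using ex_kernel[OF moore_proj_Hom] by blast
  hence l: "l \<in> Hom A L ?x" and rl: "?r \<cdot> l = Zero A L (moore_X (Suc m))"
    unfolding is_kernel_def by blast+
  let ?\<pi> = "\<lambda>(k, \<sigma>). pull (Suc m) k \<sigma> l"
  have H: "\<sigma> \<in> ?K k \<Longrightarrow> \<sigma> \<in> Hom Delta k (Suc m)" for k \<sigma> using horn_Hom[of 0 m] by simp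
  have cone: "cone_over ?K L ?\<pi>" by (rule operators_cone[OF H l])
  have "\<exists>!u. u \<in> Hom A M L \<and> (\<forall>j \<in> Obj (opposite (simplices ?K)). ?\<pi> j \<cdot> u = \<rho> j)"
    if c: "cone_over ?K M \<rho>" for M \<rho>
  proof -
    have M: "M \<in> Obj A" using c unfolding cone_over_iff by blast
    obtain x where x: "x \<in> degenerate M (Suc m)"
      and x\<rho>: "\<And>k \<sigma>. \<sigma> \<in> ?K k \<Longrightarrow> pull (Suc m) k \<sigma> x = \<rho> (k, \<sigma>)"
      using horn_cone_filler[OF _ c] by blast
    have obj: "(\<forall>j \<in> Obj (opposite (simplices ?K)). ?\<pi> j \<cdot> u = \<rho> j)
        \<longleftrightarrow> (\<forall>k. \<forall>\<sigma> \<in> ?K k. pull (Suc m) k \<sigma> (l \<cdot> u) = \<rho> (k, \<sigma>))" if "u \<in> Hom A M L" for u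
      using pull_Comp[OF l H that] by (auto simp: opposite_def simplices_def)
    note xH = degenerate_Hom[OF x M]
    have "?r \<cdot> x = Zero A M (moore_X (Suc m))" using moore_proj_degenerate[OF x M] .
    then obtain v where v: "v \<in> Hom A M L" "l \<cdot> v = x" using ker xH unfolding is_kernel_def by blast
    have "u = v" if u: "u \<in> Hom A M L" "\<forall>k. \<forall>\<sigma> \<in> ?K k. pull (Suc m) k \<sigma> (l \<cdot> u) = \<rho> (k, \<sigma>)" for u
    proof -
      note luH = Comp_Hom[OF u(1) l]
      let ?s = "sub_el M (Suc m) (l \<cdot> u) x"
      have "?s \<in> normalized M (Suc m)"
      proof (rule normalizedI[OF Sub_Hom[OF luH xH]])
        fix n' j assume n: "Suc m = Suc n'" and j: "1 \<le> j" "j \<le> Suc m"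
        have k: "coface (Suc m) j \<in> ?K m" using coface_mem_horn[of 0 m j] j by simp
        show "face_el n' j ?s = zero_el M n'"
          using pull_Sub[OF luH xH coface_Hom[OF j(2)]] u(2) x\<rho>[OF k] k n
            Sub_self[OF pull_Hom[OF xH coface_Hom[OF j(2)]]] by simp
      qed
      then obtain t where t: "t \<in> Hom A M (moore_X (Suc m))" "incl (Suc m) \<cdot> t = ?s"
        using normalized_factor by blast
      have "?r \<cdot> (l \<cdot> u) = Zero A M (moore_X (Suc m))"
        using Comp_assoc[OF u(1) l moore_proj_Hom] rl Zero_Comp[OF u(1) moore_Obj] by simp
      hence "?r \<cdot> ?s = Zero A M (moore_X (Suc m))"
        using Comp_Sub[OF luH xH moore_proj_Hom] moore_proj_degenerate[OF x M]
          Sub_self[OF Zero_Hom[OF M moore_Obj]] by simp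
      moreover have "?r \<cdot> ?s = t"
        using Comp_assoc[OF t(1) incl_Hom moore_proj_Hom] moore_proj_incl Id_Comp[OF t(1)] t(2) by simp
      ultimately have "?s = zero_el M (Suc m)" using t(2) Comp_Zero[OF incl_Hom M] by simp
      hence "l \<cdot> u = x" using Sub_eq_Zero[OF luH xH] by simp
      moreover have "\<exists>!u. u \<in> Hom A M L \<and> l \<cdot> u = x"
        using ker xH \<open>?r \<cdot> x = Zero A M (moore_X (Suc m))\<close> unfolding is_kernel_def by blast
      ultimately show ?thesis using u v by blast
    qed
    note uniq = this
    have "\<forall>k. \<forall>\<sigma> \<in> ?K k. pull (Suc m) k \<sigma> (l \<cdot> v) = \<rho> (k, \<sigma>)" using v(2) x\<rho> by simp
    hence "v \<in> Hom A M L \<and> (\<forall>j \<in> Obj (opposite (simplices ?K)). ?\<pi> j \<cdot> v = \<rho> j)"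
      using v(1) obj[OF v(1)] by simp
    thus ?thesis
    proof (rule ex1I)
      fix u assume u: "u \<in> Hom A M L \<and> (\<forall>j \<in> Obj (opposite (simplices ?K)). ?\<pi> j \<cdot> u = \<rho> j)"
      show "u = v" using uniq[OF conjunct1[OF u]] obj[OF conjunct1[OF u]] conjunct2[OF u] by simp
    qed
  qed
  hence "limit_over ?K L ?\<pi>" unfolding is_limit_def using cone by simp
  thus ?thesis by blast
qed

lemma subset_limit_is_limit:
  assumes "limit_over K L \<pi>"
  shows "limit_over K (fst (subset_limit A X K)) (snd (subset_limit A X K))"
  unfolding subset_limit_def limit_cone_def
  by (rule some_pair[where P = "limit_over K", OF assms])

lemma canonical_map:
  assumes K: "\<And>k \<sigma>. \<sigma> \<in> K k \<Longrightarrow> \<sigma> \<in> Hom Delta k n"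
    and lim: "limit_over K L \<pi>"
  shows "canonical_map A X n K \<in> Hom A (Fob X n) (fst (subset_limit A X K)) \<and>
    (\<forall>k. \<forall>\<sigma> \<in> K k. snd (subset_limit A X K) (k, \<sigma>) \<cdot> canonical_map A X n K = Far X n k \<sigma>)"
proof -
  let ?L = "fst (subset_limit A X K)" and ?\<pi> = "snd (subset_limit A X K)"
  have "cone_over K (Fob X n) (\<lambda>(k, \<sigma>). pull n k \<sigma> (Id A (Fob X n)))"
    by (rule operators_cone[OF K Id_Hom[OF X_Obj]])
  hence "\<exists>!u. u \<in> Hom A (Fob X n) ?L \<and>
      (\<forall>j \<in> Obj (opposite (simplices K)). ?\<pi> j \<cdot> u = (\<lambda>(k, \<sigma>). pull n k \<sigma> (Id A (Fob X n))) j)"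
    using subset_limit_is_limit[OF lim] unfolding is_limit_def by blast
  moreover have "(\<forall>j \<in> Obj (opposite (simplices K)). ?\<pi> j \<cdot> u = (\<lambda>(k, \<sigma>). pull n k \<sigma> (Id A (Fob X n))) j)
      \<longleftrightarrow> (\<forall>(k, \<sigma>) \<in> Obj (simplices K). ?\<pi> (k, \<sigma>) \<cdot> u = Far X n k \<sigma>)" for u
    using Comp_Id[OF X_Hom[OF K]] by (auto simp: opposite_def simplices_def pull_def)
  ultimately have "\<exists>!u. u \<in> Hom A (Fob X n) ?L \<and>
      (\<forall>(k, \<sigma>) \<in> Obj (simplices K). ?\<pi> (k, \<sigma>) \<cdot> u = Far X n k \<sigma>)" by simp
  from theI'[OF this] show ?thesis
    unfolding canonical_map_def by (auto simp: case_prod_beta simplices_def)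
qed

lemma limit_factor:
  assumes lim: "limit_over K L \<pi>"
    and cone: "cone_over K M \<rho>"
  obtains u where "u \<in> Hom A M L" "\<And>k \<sigma>. \<sigma> \<in> K k \<Longrightarrow> \<pi> (k, \<sigma>) \<cdot> u = \<rho> (k, \<sigma>)"
proof -
  have "\<exists>!u. u \<in> Hom A M L \<and> (\<forall>j \<in> Obj (opposite (simplices K)). \<pi> j \<cdot> u = \<rho> j)"
    using lim cone unfolding is_limit_def by simp
  thus ?thesis using that by (auto simp: opposite_def simplices_def)
qed

lemma limit_unique:
  assumes lim: "limit_over K L \<pi>"
    and cone: "cone_over K M \<rho>"
    and u: "u \<in> Hom A M L" "\<And>k \<sigma>. \<sigma> \<in> K k \<Longrightarrow> \<pi> (k, \<sigma>) \<cdot> u = \<rho> (k, \<sigma>)"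
    and v: "v \<in> Hom A M L" "\<And>k \<sigma>. \<sigma> \<in> K k \<Longrightarrow> \<pi> (k, \<sigma>) \<cdot> v = \<rho> (k, \<sigma>)"
  shows "u = v"
proof -
  have obj: "Obj (opposite (simplices K)) = {(k, \<sigma>). \<sigma> \<in> K k}"
    by (simp add: opposite_def simplices_def)
  have "\<exists>!u. u \<in> Hom A M L \<and> (\<forall>j \<in> Obj (opposite (simplices K)). \<pi> j \<cdot> u = \<rho> j)"
    using lim cone unfolding is_limit_def by simp
  moreover have "\<forall>j \<in> Obj (opposite (simplices K)). \<pi> j \<cdot> u = \<rho> j"
    "\<forall>j \<in> Obj (opposite (simplices K)). \<pi> j \<cdot> v = \<rho> j"
    using u(2) v(2) by (auto simp: obj)
  ultimately show ?thesis using u(1) v(1) by blast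
qed

lemma canonical_map_iso:
  assumes K: "\<And>k \<sigma>. \<sigma> \<in> K k \<Longrightarrow> \<sigma> \<in> Hom Delta k n"
    and lim: "limit_over K (Fob X n) (\<lambda>(k, \<sigma>). Far X n k \<sigma>)"
  shows "is_iso A (Fob X n) (fst (subset_limit A X K)) (canonical_map A X n K)"
proof -
  let ?L = "fst (subset_limit A X K)" and ?\<pi> = "snd (subset_limit A X K)" and ?c = "canonical_map A X n K"
  let ?J = "opposite (simplices K)" and ?\<phi> = "\<lambda>(k, \<sigma>). Far X n k \<sigma>"
  note L = subset_limit_is_limit[OF lim]
  have c: "?c \<in> Hom A (Fob X n) ?L" "\<And>k \<sigma>. \<sigma> \<in> K k \<Longrightarrow> ?\<pi> (k, \<sigma>) \<cdot> ?c = Far X n k \<sigma>"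
    using canonical_map[OF K lim] by blast+
  have coneL: "is_cone ?J A diagram ?L ?\<pi>" using L unfolding is_limit_def by blast
  have coneX: "is_cone ?J A diagram (Fob X n) ?\<phi>" using lim unfolding is_limit_def by blast
  have LO: "?L \<in> Obj A" and \<pi>H: "\<And>k \<sigma>. \<sigma> \<in> K k \<Longrightarrow> ?\<pi> (k, \<sigma>) \<in> Hom A ?L (Fob X k)"
    using coneL unfolding cone_over_iff by simp_all
  obtain d where d: "d \<in> Hom A ?L (Fob X n)" "\<And>k \<sigma>. \<sigma> \<in> K k \<Longrightarrow> Far X n k \<sigma> \<cdot> d = ?\<pi> (k, \<sigma>)"
    using limit_factor[OF lim coneL] by auto
  have "d \<cdot> ?c = Id A (Fob X n)"
  proof (rule limit_unique[OF lim coneX Comp_Hom[OF c(1) d(1)] _ Id_Hom[OF X_Obj]])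
    fix k \<sigma> assume \<sigma>: "\<sigma> \<in> K k"
    show "?\<phi> (k, \<sigma>) \<cdot> (d \<cdot> ?c) = ?\<phi> (k, \<sigma>)" "?\<phi> (k, \<sigma>) \<cdot> Id A (Fob X n) = ?\<phi> (k, \<sigma>)"
      using Comp_assoc[OF c(1) d(1) X_Hom[OF K[OF \<sigma>]]] d(2)[OF \<sigma>] c(2)[OF \<sigma>] Comp_Id[OF X_Hom[OF K[OF \<sigma>]]]
      by simp_all
  qed
  moreover have "?c \<cdot> d = Id A ?L"
  proof (rule limit_unique[OF L coneL Comp_Hom[OF d(1) c(1)] _ Id_Hom[OF LO]])
    fix k \<sigma> assume \<sigma>: "\<sigma> \<in> K k"
    show "?\<pi> (k, \<sigma>) \<cdot> (?c \<cdot> d) = ?\<pi> (k, \<sigma>)" "?\<pi> (k, \<sigma>) \<cdot> Id A ?L = ?\<pi> (k, \<sigma>)"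
      using Comp_assoc[OF d(1) c(1) \<pi>H[OF \<sigma>]] d(2)[OF \<sigma>] c(2)[OF \<sigma>] Comp_Id[OF \<pi>H[OF \<sigma>]] by simp_all
  qed
  ultimately show ?thesis unfolding is_iso_def using c(1) d(1) by blast
qed

lemma canonical_map_monic:
  assumes K: "\<And>k \<sigma>. \<sigma> \<in> K k \<Longrightarrow> \<sigma> \<in> Hom Delta k n"
    and lim: "limit_over K L \<pi>"
    and iso: "is_iso A (Fob X n) (fst (subset_limit A X K)) (canonical_map A X n K)"
    and x: "x \<in> El T n" and 0: "\<And>k \<sigma>. \<sigma> \<in> K k \<Longrightarrow> pull n k \<sigma> x = zero_el T k"
  shows "x = zero_el T n"
proof -
  let ?L = "fst (subset_limit A X K)" and ?\<pi> = "snd (subset_limit A X K)" and ?c = "canonical_map A X n K"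
  let ?J = "opposite (simplices K)"
  note L = subset_limit_is_limit[OF lim]
  have c: "?c \<in> Hom A (Fob X n) ?L" "\<And>k \<sigma>. \<sigma> \<in> K k \<Longrightarrow> ?\<pi> (k, \<sigma>) \<cdot> ?c = Far X n k \<sigma>"
    using canonical_map[OF K lim] by blast+
  have T: "T \<in> Obj A" using Hom_Obj[OF x] by simp
  have coneL: "is_cone ?J A diagram ?L ?\<pi>" using L unfolding is_limit_def by blast
  hence LO: "?L \<in> Obj A" and \<pi>H: "\<And>k \<sigma>. \<sigma> \<in> K k \<Longrightarrow> ?\<pi> (k, \<sigma>) \<in> Hom A ?L (Fob X k)"
    unfolding cone_over_iff by simp_all
  have zero_cone: "is_cone ?J A diagram T (\<lambda>(k, \<sigma>). zero_el T k)"
    unfolding cone_over_iff using T Zero_Hom[OF T X_Obj] pull_Zero[OF T] by simp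
  have cx: "?c \<cdot> x = Zero A T ?L"
  proof (rule limit_unique[OF L zero_cone Comp_Hom[OF x c(1)] _ Zero_Hom[OF T LO]])
    fix k \<sigma> assume \<sigma>: "\<sigma> \<in> K k"
    show "?\<pi> (k, \<sigma>) \<cdot> (?c \<cdot> x) = (case (k, \<sigma>) of (k, \<sigma>) \<Rightarrow> zero_el T k)"
      "?\<pi> (k, \<sigma>) \<cdot> Zero A T ?L = (case (k, \<sigma>) of (k, \<sigma>) \<Rightarrow> zero_el T k)"
      using Comp_assoc[OF x c(1) \<pi>H[OF \<sigma>]] c(2)[OF \<sigma>] 0[OF \<sigma>] Comp_Zero[OF \<pi>H[OF \<sigma>] T]
      by (simp_all add: pull_def)
  qed
  obtain d where d: "d \<in> Hom A ?L (Fob X n)" "d \<cdot> ?c = Id A (Fob X n)"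
    using iso unfolding is_iso_def by blast
  have "x = d \<cdot> (?c \<cdot> x)" using Comp_assoc[OF x c(1) d(1)] d(2) Id_Comp[OF x] by simp
  thus ?thesis using cx Comp_Zero[OF d(1) T] by simp
qed

lemma zero_moore_iff: "zero_object A (moore_X n) \<longleftrightarrow> (\<forall>T. \<forall>x \<in> normalized T n. x = zero_el T n)"
proof
  assume z: "zero_object A (moore_X n)"
  show "\<forall>T. \<forall>x \<in> normalized T n. x = zero_el T n"
  proof (intro allI ballI)
    fix T x assume x: "x \<in> normalized T n"
    have T: "T \<in> Obj A" using Hom_Obj[OF normalized_Hom[OF x]] by simp
    obtain v where v: "v \<in> Hom A T (moore_X n)" "incl n \<cdot> v = x" using normalized_factor[OF x] by blast
    show "x = zero_el T n" using zero_object_arrow[OF z v(1)] v(2) Comp_Zero[OF incl_Hom T] by simp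
  qed
next
  assume 0: "\<forall>T. \<forall>x \<in> normalized T n. x = zero_el T n"
  have "Id A (moore_X n) = Zero A (moore_X n) (moore_X n)"
    by (rule incl_monic[OF Id_Hom[OF moore_Obj] Zero_Hom[OF moore_Obj moore_Obj]])
      (use 0 incl_normalized Comp_Id[OF incl_Hom] Comp_Zero[OF incl_Hom moore_Obj] in auto)
  thus "zero_object A (moore_X n)" using zero_objectI[OF moore_Obj] by simp
qed

text \<open>The horn at 0 alone forces the Moore object to vanish, since elements of the latter have the same
  faces on this horn as 0.\<close>

lemma outer_horns_iso_iff:
  assumes n: "0 < n"
  shows "(\<forall>i \<in> {0, n}. is_iso A (Fob X n) (fst (subset_limit A X (horn n i))) (canonical_map A X n (horn n i)))
    \<longleftrightarrow> zero_object A (moore_X n)"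
proof -
  obtain m where m: "n = Suc m" using n by (cases n) auto
  have H: "\<sigma> \<in> horn n i k \<Longrightarrow> \<sigma> \<in> Hom Delta k n" if "i \<in> {0, n}" for i k \<sigma>
    using horn_Hom[of i m \<sigma> k] that m by auto
  show ?thesis
  proof
    assume iso: "\<forall>i \<in> {0, n}. is_iso A (Fob X n) (fst (subset_limit A X (horn n i))) (canonical_map A X n (horn n i))"
    obtain L \<pi> where lim: "limit_over (horn n 0) L \<pi>"
      using horn_0_limit_exists[of m] m by blast
    have "x = zero_el T n" if x: "x \<in> normalized T n" for T x
    proof (rule canonical_map_monic[OF H lim _ normalized_Hom[OF x]])
      show "is_iso A (Fob X n) (fst (subset_limit A X (horn n 0))) (canonical_map A X n (horn n 0))"
        using iso by simp
      show "pull n k \<sigma> x = zero_el T k" if "\<sigma> \<in> horn n 0 k" for k \<sigma>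
        using horn_faces_zero[of 0 m x T \<sigma> k] normalized_Hom[OF x] normalized_face[of x T m] x that m by simp
    qed simp_all
    thus "zero_object A (moore_X n)" unfolding zero_moore_iff by blast
  next
    assume "zero_object A (moore_X n)"
    hence 0: "\<And>T x. x \<in> normalized T n \<Longrightarrow> x = zero_el T n" unfolding zero_moore_iff by blast
    have deg: "x \<in> degenerate T (Suc m)" if x: "x \<in> El T (Suc m)" for T x
    proof -
      have T: "T \<in> Obj A" using Hom_Obj[OF x] by simp
      obtain c z where c: "c \<in> normalized T n" "z \<in> degenerate T n" "x = add_el T n c z"
        using normalized_degenerate_decomposition x m by blast
      thus ?thesis using 0[OF c(1)] Add_Zero(2)[OF degenerate_Hom[OF c(2) T]] m by simp
    qed
    show "\<forall>i \<in> {0, n}. is_iso A (Fob X n) (fst (subset_limit A X (horn n i))) (canonical_map A X n (horn n i))"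
    proof
      fix i assume i: "i \<in> {0, n}"
      have "limit_over (horn (Suc m) i) (Fob X (Suc m))
          (\<lambda>(k, \<sigma>). Far X (Suc m) k \<sigma>)"
        by (rule horn_limit_if_degenerate[OF _ deg]) (use i m in auto)
      thus "is_iso A (Fob X n) (fst (subset_limit A X (horn n i))) (canonical_map A X n (horn n i))"
        using canonical_map_iso[OF H[OF i]] m by simp
    qed
  qed
qed

end

context abelian_category
begin

lemma outer_Kan_iff_truncated:
  assumes X: "X \<in> Obj (simplicial_category A)"
  shows "X \<in> outer_Kan A m \<longleftrightarrow> Fob (moore A) X \<in> truncated A m"
proof -
  interpret X: simplicial_object A X using simplicial_object_Obj[OF X] .
  have "(\<forall>i \<in> {0, n}. is_iso A (Fob X n) (fst (subset_limit A X (horn n i))) (canonical_map A X n (horn n i)))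
    \<longleftrightarrow> zero_object A (moore_ob A X n)" if "m < n" for n
    by (rule X.outer_horns_iso_iff) (use that in simp)
  hence "X \<in> outer_Kan A m \<longleftrightarrow> (\<forall>n > m. zero_object A (moore_ob A X n))"
    unfolding outer_Kan_def using X by blast
  also have "\<dots> \<longleftrightarrow> Fob (moore A) X \<in> truncated A m"
    using X.moore_is_chain_complex by (simp add: truncated_def chain_category_simps moore_simps)
  finally show ?thesis .
qed

lemma truncated_iso_closed:
  assumes iso: "is_iso (chain_category A) Y Z e" and Z: "Z \<in> truncated A m"
  shows "Y \<in> truncated A m"
proof -
  obtain e' where e: "e \<in> Hom (chain_category A) Y Z" and e': "e' \<in> Hom (chain_category A) Z Y"
    and e'e: "Comp (chain_category A) e' e = Id (chain_category A) Y"
    using iso unfolding is_iso_def by blast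
  have "zero_object A (Deg Y n)" if n: "m < n" for n
  proof -
    have z: "zero_object A (Deg Z n)" using Z n by (simp add: truncated_def)
    have eH: "e n \<in> Hom A (Deg Y n) (Deg Z n)" and e'H: "e' n \<in> Hom A (Deg Z n) (Deg Y n)"
      using e e' by (simp_all add: chain_Hom_iff)
    have Yn: "Deg Y n \<in> Obj A" using Hom_Obj[OF eH] by simp
    have "e' n \<cdot> e n = Id A (Deg Y n)" using e'e by (metis chain_category_simps(2,3))
    hence "Id A (Deg Y n) = Zero A (Deg Y n) (Deg Y n)"
      using zero_object_arrow[OF z eH] Comp_Zero[OF e'H Yn] by simp
    thus ?thesis using zero_objectI[OF Yn] by simp
  qed
  thus ?thesis using e by (simp add: truncated_def chain_category_simps chain_Hom_iff)
qed

end

theorem theorem4p5: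
  fixes A :: "('o, 'a) addcat" and m :: nat
  assumes "abelian_category A"
  shows "(\<exists>N \<eta> \<epsilon>. adjunction (simplicial_category A) (chain_category A) (moore A) N \<eta> \<epsilon>) \<and>
    (\<forall>N \<eta> \<epsilon>. adjunction (simplicial_category A) (chain_category A) (moore A) N \<eta> \<epsilon> \<longrightarrow>
      adjoint_equivalence
        (full_subcategory (simplicial_category A) (outer_Kan A m))
        (full_subcategory (chain_category A) (truncated A m))
        (moore A) N \<eta> \<epsilon>)"
proof -
  interpret abelian_category A by fact
  interpret M: equivalence_functor "simplicial_category A" "chain_category A" "moore A"
    by (rule moore_equivalence_functor)
  show ?thesis
  proof (intro conjI allI impI)
    show "\<exists>N \<eta> \<epsilon>. adjunction (simplicial_category A) (chain_category A) (moore A) N \<eta> \<epsilon>"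
      by (rule M.adjunction_exists)
    fix N \<eta> \<epsilon>
    assume adj: "adjunction (simplicial_category A) (chain_category A) (moore A) N \<eta> \<epsilon>"
    show "adjoint_equivalence (full_subcategory (simplicial_category A) (outer_Kan A m))
        (full_subcategory (chain_category A) (truncated A m)) (moore A) N \<eta> \<epsilon>"
    proof (rule M.adjunction_restricts[OF adj])
      show "X \<in> outer_Kan A m \<longleftrightarrow> Fob (moore A) X \<in> truncated A m"
        if "X \<in> Obj (simplicial_category A)" for X
        using outer_Kan_iff_truncated[OF that] .
      show "Y \<in> truncated A m" if "is_iso (chain_category A) Y Z e" "Z \<in> truncated A m" for Y Z e
        using truncated_iso_closed[OF that] .
    qed
  qed
qed

end
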